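(* Suppose that $(J_1,J_2)$ is a simultaneous $M$-ideal in $(X_1,X_2)$, and let $q_i:X_i\to X_i/J_i$ be the quotient maps for $i=1,2$. Let $(Y_1,Y_2)$ be a pair of a Banach space and a subspace with $Y_1$ separable, and let $T:(Y_1,Y_2)\to(X_1/J_1,X_2/J_2)$ be a linear map with $\|T\|=1$. If either (a) $(Y_1,Y_2)$ has the $\lambda$-BAP; or (b) $(J_1,J_2)$ is a Lindenstrauss pair, then there exists a bounded linear map $L:(Y_1,Y_2)\to(X_1,X_2)$ such that $q_1\circ L=T$. Moreover, $L$ can be taken with $\|L\|\le\lambda$ under assumption (a), and with $\|L\|\le 1$ under assumption (b).
   Context: A pair of a Banach space and a subspace $(X_1,X_2)$ consists of a Banach space $X_1$ and a closed subspace $X_2\subseteq X_1$. For such pairs, $(J_1,J_2)\subseteq(X_1,X_2)$ means $J_1\subseteq X_1$ and $J_2\subseteq X_2$. The notation $f:(A_1,A_2)\to(B_1,B_2)$ means that $f:A_1\to B_1$ is a map with $f(A_2)\subseteq B_2$. A linear projection $P$ on a Banach space $X$ is an $L$-projection if $\|x\|=\|Px\|+\|x-Px\|$ for all $x\in X$. A closed subspace $J\subseteq X$ is an $M$-ideal in $X$ if $J^\perp\subseteq X^*$ is the range of an $L$-projection on $X^*$ (which is then unique). Given pairs $(J_1,J_2)\subseteq(X_1,X_2)$, $(J_1,J_2)$ is a simultaneous $M$-ideal in $(X_1,X_2)$ if $J_k$ is an $M$-ideal in $X_k$ for $k=1,2$, and the associated $L$-projections $Q_k$ of $X_k^*$ onto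 $J_k^\perp\subseteq X_k^*$ satisfy $r\circ Q_1=Q_2\circ r$, where $r:X_1^*\to X_2^*$ is the restriction map. In this case the canonical map $X_2/J_2\to X_1/J_1$, $x+J_2\mapsto x+J_1$, is an isometric embedding, and $X_2/J_2$ is regarded as a closed subspace of $X_1/J_1$ through it. The pair $(Y_1,Y_2)$ has the $\lambda$-BAP if for each $\varepsilon>0$ and each compact $K\subset Y_1$ there is a finite-rank linear map $S:Y_1\to Y_1$ with $\|S\|\le\lambda$, $\|S(y)-y\|\le\varepsilon$ for each $y\in K$, and $S(Y_2)\subseteq Y_2$. A pair $(X_1,X_2)$ is $\lambda$-injective if whenever $(F_1,F_2)\subseteq(E_1,E_2)$ are pairs of a Banach space and a subspace with $F_2=F_1\cap E_2$, and $t:(F_1,F_2)\to(X_1,X_2)$ is a bounded linear map, there exists a bounded linear extension $\tilde t:(E_1,E_2)\to(X_1,X_2)$ of $t$ with $\|\tilde t\|\le\lambda\|t\|$. A pair $(X_1,X_2)$ is a Lindenstrauss pair if $(X_1^{**},X_2^{**})$ is $1$-injective, where $X_2^{**}$ is canonically identified with $X_2^{\perp\perp}\subseteq X_1^{**}$. *)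

theory Defs
  imports "HOL-Analysis.Analysis" "HOL-Library.Function_Algebras"
begin

text \<open>
  Scalars are real. The spaces \<open>X\<^sub>1\<close> and \<open>Y\<^sub>1\<close> are types of class \<open>banach\<close> and their closed
  subspaces are sets. Duals and biduals of subspaces, and the test spaces in the definition of
  injectivity, are not types; they are given as a linear subspace \<open>V\<close> of a real vector space
  together with a norm \<open>p\<close>, of which only the values on \<open>V\<close> matter. The following instance
  provides the pointwise vector space structure on functions that this needs.
\<close>

instantiation "fun" :: (type, real_vector) real_vector
begin

definition scaleR_fun :: "real \<Rightarrow> ('a \<Rightarrow> 'b) \<Rightarrow> 'a \<Rightarrow> 'b"
  where "scaleR_fun c f = (\<lambda>x. c *\<^sub>R f x)"

instance
  by standard (auto simp: scaleR_fun_def fun_eq_iff scaleR_add_right scaleR_add_left)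

end


subsection \<open>Normed spaces on carriers\<close>

definition normed_space_on :: "'v::real_vector set \<Rightarrow> ('v \<Rightarrow> real) \<Rightarrow> bool" where
  "normed_space_on V p \<longleftrightarrow> subspace V \<and>
     (\<forall>x\<in>V. 0 \<le> p x \<and> (p x = 0 \<longleftrightarrow> x = 0)) \<and>
     (\<forall>c. \<forall>x\<in>V. p (c *\<^sub>R x) = \<bar>c\<bar> * p x) \<and>
     (\<forall>x\<in>V. \<forall>y\<in>V. p (x + y) \<le> p x + p y)"

definition banach_space_on :: "'v::real_vector set \<Rightarrow> ('v \<Rightarrow> real) \<Rightarrow> bool" where
  "banach_space_on V p \<longleftrightarrow> normed_space_on V p \<and>
     (\<forall>s :: nat \<Rightarrow> 'v. (\<forall>n. s n \<in> V) \<longrightarrow>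
        (\<forall>e>0. \<exists>N. \<forall>m\<ge>N. \<forall>n\<ge>N. p (s m - s n) < e) \<longrightarrow>
        (\<exists>l\<in>V. (\<lambda>n. p (s n - l)) \<longlonglongrightarrow> 0))"

definition closed_subspace_on ::
    "'v::real_vector set \<Rightarrow> ('v \<Rightarrow> real) \<Rightarrow> 'v set \<Rightarrow> bool" where
  "closed_subspace_on V p W \<longleftrightarrow> subspace W \<and> W \<subseteq> V \<and>
     (\<forall>s :: nat \<Rightarrow> 'v. \<forall>l\<in>V. (\<forall>n. s n \<in> W) \<longrightarrow> (\<lambda>n. p (s n - l)) \<longlonglongrightarrow> 0 \<longrightarrow> l \<in> W)"

definition banach_pair_on ::
    "'v::real_vector set \<Rightarrow> 'v set \<Rightarrow> ('v \<Rightarrow> real) \<Rightarrow> bool" where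
  "banach_pair_on V1 V2 p \<longleftrightarrow> banach_space_on V1 p \<and> closed_subspace_on V1 p V2"

definition linear_map_on ::
    "'v::real_vector set \<Rightarrow> 'w::real_vector set \<Rightarrow> ('v \<Rightarrow> 'w) \<Rightarrow> bool" where
  "linear_map_on V W t \<longleftrightarrow> t ` V \<subseteq> W \<and>
     (\<forall>x\<in>V. \<forall>y\<in>V. t (x + y) = t x + t y) \<and> (\<forall>c. \<forall>x\<in>V. t (c *\<^sub>R x) = c *\<^sub>R t x)"

definition bounded_on :: "'v set \<Rightarrow> ('v \<Rightarrow> real) \<Rightarrow> ('w \<Rightarrow> real) \<Rightarrow> ('v \<Rightarrow> 'w) \<Rightarrow> bool" where
  "bounded_on V p q t \<longleftrightarrow> (\<exists>C. \<forall>x\<in>V. q (t x) \<le> C * p x)"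

text \<open>The operator norm is only meaningful for maps satisfying \<^const>\<open>bounded_on\<close>.\<close>

definition op_norm :: "'v set \<Rightarrow> ('v \<Rightarrow> real) \<Rightarrow> ('w \<Rightarrow> real) \<Rightarrow> ('v \<Rightarrow> 'w) \<Rightarrow> real" where
  "op_norm V p q t = (SUP x\<in>{x\<in>V. p x \<le> 1}. q (t x))"


subsection \<open>Duals and annihilators\<close>

text \<open>
  A functional on \<open>V\<close> is represented by the function that extends it by \<open>0\<close> off \<open>V\<close>. Distinct
  functionals are then distinct functions, and pointwise operations are the operations of the dual.
\<close>

definition dual_space :: "'v::real_vector set \<Rightarrow> ('v \<Rightarrow> real) \<Rightarrow> ('v \<Rightarrow> real) set" where
  "dual_space V p = {f. linear_map_on V UNIV f \<and> bounded_on V p abs f \<and> (\<forall>x. x \<notin> V \<longrightarrow> f x = 0)}"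

definition dual_norm :: "'v::real_vector set \<Rightarrow> ('v \<Rightarrow> real) \<Rightarrow> ('v \<Rightarrow> real) \<Rightarrow> real" where
  "dual_norm V p f = op_norm V p abs f"

definition restrict_functional :: "'v set \<Rightarrow> ('v \<Rightarrow> real) \<Rightarrow> 'v \<Rightarrow> real" where
  "restrict_functional W f = (\<lambda>x. if x \<in> W then f x else 0)"

definition annihilator ::
    "'v::real_vector set \<Rightarrow> ('v \<Rightarrow> real) \<Rightarrow> 'v set \<Rightarrow> ('v \<Rightarrow> real) set" where
  "annihilator V p W = {f \<in> dual_space V p. \<forall>x\<in>W. f x = 0}"

definition bidual_space :: "'v::real_vector set \<Rightarrow> ('v \<Rightarrow> real) \<Rightarrow> (('v \<Rightarrow> real) \<Rightarrow> real) set" where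
  "bidual_space V p = dual_space (dual_space V p) (dual_norm V p)"

definition bidual_norm ::
    "'v::real_vector set \<Rightarrow> ('v \<Rightarrow> real) \<Rightarrow> (('v \<Rightarrow> real) \<Rightarrow> real) \<Rightarrow> real" where
  "bidual_norm V p = dual_norm (dual_space V p) (dual_norm V p)"

definition biannihilator ::
    "'v::real_vector set \<Rightarrow> ('v \<Rightarrow> real) \<Rightarrow> 'v set \<Rightarrow> (('v \<Rightarrow> real) \<Rightarrow> real) set" where
  "biannihilator V p W = annihilator (dual_space V p) (dual_norm V p) (annihilator V p W)"


subsection \<open>Simultaneous M-ideals\<close>

definition L_projection_on ::
    "'v::real_vector set \<Rightarrow> ('v \<Rightarrow> real) \<Rightarrow> ('v \<Rightarrow> 'v) \<Rightarrow> bool" where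
  "L_projection_on V p P \<longleftrightarrow> linear_map_on V V P \<and> (\<forall>x\<in>V. P (P x) = P x) \<and>
     (\<forall>x\<in>V. p x = p (P x) + p (x - P x))"

definition M_ideal_projection ::
    "'a::real_normed_vector set \<Rightarrow> 'a set \<Rightarrow> (('a \<Rightarrow> real) \<Rightarrow> ('a \<Rightarrow> real)) \<Rightarrow> bool" where
  "M_ideal_projection X J Q \<longleftrightarrow>
     L_projection_on (dual_space X norm) (dual_norm X norm) Q \<and>
     Q ` dual_space X norm = annihilator X norm J"

definition M_ideal :: "'a::real_normed_vector set \<Rightarrow> 'a set \<Rightarrow> bool" where
  "M_ideal X J \<longleftrightarrow> subspace J \<and> closed J \<and> J \<subseteq> X \<and> (\<exists>Q. M_ideal_projection X J Q)"

definition closed_pair :: "'a::real_normed_vector set \<Rightarrow> 'a set \<Rightarrow> bool" where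
  "closed_pair X1 X2 \<longleftrightarrow>
     subspace X1 \<and> closed X1 \<and> subspace X2 \<and> closed X2 \<and> X2 \<subseteq> X1"

text \<open>
  The associated projections are unique as maps on the dual spaces, so quantifying over all of
  them (given that they exist, by \<^const>\<open>M_ideal\<close>) is the same as picking them.
\<close>

definition simultaneous_M_ideal ::
    "'a::banach set \<Rightarrow> 'a set \<Rightarrow> 'a set \<Rightarrow> 'a set \<Rightarrow> bool" where
  "simultaneous_M_ideal X1 X2 J1 J2 \<longleftrightarrow>
     closed_pair X1 X2 \<and> closed_pair J1 J2 \<and> M_ideal X1 J1 \<and> M_ideal X2 J2 \<and>
     (\<forall>Q1 Q2. M_ideal_projection X1 J1 Q1 \<longrightarrow> M_ideal_projection X2 J2 Q2 \<longrightarrow>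
        (\<forall>f\<in>dual_space X1 norm.
           restrict_functional X2 (Q1 f) = Q2 (restrict_functional X2 f)))"


subsection \<open>Quotients\<close>

definition coset :: "'a::real_normed_vector set \<Rightarrow> 'a \<Rightarrow> 'a set" where
  "coset J x = (\<lambda>j. x + j) ` J"

definition coset_add :: "'a::real_normed_vector set \<Rightarrow> 'a set \<Rightarrow> 'a set" where
  "coset_add A B = {a + b | a b. a \<in> A \<and> b \<in> B}"

text \<open>The summand \<open>j\<close> makes \<open>0\<close> times a coset equal to \<open>J\<close> rather than \<open>{0}\<close>.\<close>

definition coset_scale :: "'a::real_normed_vector set \<Rightarrow> real \<Rightarrow> 'a set \<Rightarrow> 'a set" where
  "coset_scale J c A = {c *\<^sub>R a + j | a j. a \<in> A \<and> j \<in> J}"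

definition coset_norm :: "'a::real_normed_vector set \<Rightarrow> real" where
  "coset_norm A = (INF a\<in>A. norm a)"

lemma coset_add_coset:
  assumes "subspace J" shows "coset_add (coset J x) (coset J y) = coset J (x + y)"
proof (intro set_eqI iffI)
  fix z assume "z \<in> coset_add (coset J x) (coset J y)"
  then obtain i j where "i \<in> J" "j \<in> J" "z = (x + y) + (i + j)"
    by (auto simp: coset_add_def coset_def algebra_simps)
  then show "z \<in> coset J (x + y)"
    using subspace_add[OF assms] by (auto simp: coset_def)
next
  fix z assume "z \<in> coset J (x + y)"
  then obtain j where j: "j \<in> J" "z = (x + y) + j"
    by (auto simp: coset_def)
  then have "z = (x + j) + (y + 0)"
    by (simp add: algebra_simps)
  then show "z \<in> coset_add (coset J x) (coset J y)"
    unfolding coset_add_def coset_def using j(1) subspace_0[OF assms] by blast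
qed

lemma coset_scale_coset:
  assumes "subspace J" shows "coset_scale J c (coset J x) = coset J (c *\<^sub>R x)"
proof (intro set_eqI iffI)
  fix z assume "z \<in> coset_scale J c (coset J x)"
  then obtain i j where "i \<in> J" "j \<in> J" "z = c *\<^sub>R x + (c *\<^sub>R i + j)"
    by (auto simp: coset_scale_def coset_def algebra_simps)
  then show "z \<in> coset J (c *\<^sub>R x)"
    using subspace_add[OF assms] subspace_scale[OF assms] by (auto simp: coset_def)
next
  fix z assume "z \<in> coset J (c *\<^sub>R x)"
  then obtain j where j: "j \<in> J" "z = c *\<^sub>R (x + 0) + j"
    by (auto simp: coset_def)
  then show "z \<in> coset_scale J c (coset J x)"
    unfolding coset_scale_def coset_def using subspace_0[OF assms] by blast
qed

text \<open>
  Bounded linear maps \<open>(Y\<^sub>1,Y\<^sub>2) \<rightarrow> (X\<^sub>1/J\<^sub>1,X\<^sub>2/J\<^sub>2)\<close>, where \<open>Y\<^sub>1\<close> is the whole type. An element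
  \<open>x + J\<^sub>2\<close> of \<open>X\<^sub>2/J\<^sub>2\<close> is regarded as the element \<open>x + J\<^sub>1\<close> of \<open>X\<^sub>1/J\<^sub>1\<close>.
\<close>

definition bounded_linear_quotient_pair ::
    "'b::real_normed_vector set \<Rightarrow> 'a::real_normed_vector set \<Rightarrow> 'a set \<Rightarrow> 'a set \<Rightarrow>
     ('b \<Rightarrow> 'a set) \<Rightarrow> bool" where
  "bounded_linear_quotient_pair Y2 X1 X2 J1 T \<longleftrightarrow>
     range T \<subseteq> coset J1 ` X1 \<and> T ` Y2 \<subseteq> coset J1 ` X2 \<and>
     (\<forall>y z. T (y + z) = coset_add (T y) (T z)) \<and>
     (\<forall>c y. T (c *\<^sub>R y) = coset_scale J1 c (T y)) \<and>
     bounded_on UNIV norm coset_norm T"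


subsection \<open>The bounded approximation property for pairs\<close>

text \<open>The pair is \<open>(UNIV, Y2)\<close>.\<close>

definition BAP_pair :: "real \<Rightarrow> 'b::banach set \<Rightarrow> bool" where
  "BAP_pair lam Y2 \<longleftrightarrow>
     (\<forall>e>0. \<forall>K. compact K \<longrightarrow>
        (\<exists>S :: 'b \<Rightarrow> 'b. bounded_linear S \<and> (\<exists>B. finite B \<and> range S \<subseteq> span B) \<and>
             onorm S \<le> lam \<and> (\<forall>y\<in>K. norm (S y - y) \<le> e) \<and> S ` Y2 \<subseteq> Y2))"


subsection \<open>Injective pairs and Lindenstrauss pairs\<close>

text \<open>
  HOL cannot quantify over all types, so the test spaces \<open>E\<^sub>1\<close> range over all Banach spaces
  carried by a linear subspace of \<open>'v \<Rightarrow> real\<close>, where \<open>'v\<close> is the type that carries \<open>X\<^sub>1\<close>.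
  This universe is large enough to give the unrestricted notion:
  \<^item> Suppose \<open>x \<in> X\<^sub>1\<close>, \<open>\<parallel>x\<parallel> = 1\<close>. Let \<open>E\<^sub>1\<close> be two-dimensional, \<open>E\<^sub>2\<close> the span of \<open>e\<close>, \<open>F\<^sub>1\<close> the
    span of \<open>f\<close>, with \<open>\<parallel>f\<parallel> = 1\<close>, \<open>\<parallel>f - e\<parallel> \<le> d\<close>, \<open>E\<^sub>2 \<noteq> F\<^sub>1\<close>, and \<open>t f = x\<close>. An extension as
    required shows that the distance of \<open>x\<close> to \<open>X\<^sub>2\<close> is at most \<open>lam * d\<close>. As \<open>d > 0\<close> is
    arbitrary, \<open>X\<^sub>2 = X\<^sub>1\<close>.
  \<^item> If \<open>X\<^sub>2 = X\<^sub>1\<close>, only the injectivity of \<open>X\<^sub>1\<close> is at stake. Choosing a norming functional for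
    each point embeds \<open>X\<^sub>1\<close> isometrically in the bounded functions on the set \<open>X\<^sub>1\<close>, a space in
    the universe. So there is a projection onto the copy of \<open>X\<^sub>1\<close> of norm at most \<open>lam\<close>, and
    composing it with coordinatewise Hahn-Banach extensions handles every Banach space \<open>E\<^sub>1\<close>.
\<close>

definition injective_pair ::
    "real \<Rightarrow> 'v::real_vector set \<Rightarrow> 'v set \<Rightarrow> ('v \<Rightarrow> real) \<Rightarrow> bool" where
  "injective_pair lam X1 X2 p \<longleftrightarrow>
     (\<forall>(E1 :: ('v \<Rightarrow> real) set) E2 F1 F2 n (t :: ('v \<Rightarrow> real) \<Rightarrow> 'v).
        banach_pair_on E1 E2 n \<and> banach_pair_on F1 F2 n \<and>
        F1 \<subseteq> E1 \<and> F2 \<subseteq> E2 \<and> F2 = F1 \<inter> E2 \<and>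
        linear_map_on F1 X1 t \<and> t ` F2 \<subseteq> X2 \<and> bounded_on F1 n p t \<longrightarrow>
        (\<exists>t'. linear_map_on E1 X1 t' \<and> t' ` E2 \<subseteq> X2 \<and> bounded_on E1 n p t' \<and>
              (\<forall>x\<in>F1. t' x = t x) \<and> op_norm E1 n p t' \<le> lam * op_norm F1 n p t))"

definition Lindenstrauss_pair :: "'a::real_normed_vector set \<Rightarrow> 'a set \<Rightarrow> bool" where
  "Lindenstrauss_pair X1 X2 \<longleftrightarrow>
     injective_pair 1 (bidual_space X1 norm) (biannihilator X1 norm X2) (bidual_norm X1 norm)"

end

theory Submission
  imports Defs
begin

text \<open>
  Some lift of \<open>T\<close> on a finite-dimensional space exists trivially; it has to be corrected by an
  operator into \<open>J\<^sub>1\<close> to make it small. If no correction satisfies finitely many norm constraints,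
  Hahn-Banach in a finite power of \<open>X\<^sub>1\<close> gives functionals \<open>f\<^sub>i\<close> that witness this. Splitting \<open>f\<^sub>i = Q f\<^sub>i + (f\<^sub>i - Q f\<^sub>i)\<close>
  with the \<open>L\<close>-projection \<open>Q\<close>, the first parts only see the quotient map, hence only \<open>T\<close>, while the
  second parts only see the \<open>J\<^sub>1\<^sup>*\<^sup>*\<close>-component of a comparison operator, which may be chosen freely;
  since \<open>\<parallel>f\<^sub>i\<parallel> = \<parallel>Q f\<^sub>i\<parallel> + \<parallel>f\<^sub>i - Q f\<^sub>i\<parallel>\<close>, the two bounds do not add up. Commutation of the projections
  with restriction lets all of this respect the subspaces.

  One builds lifts \<open>L\<^sub>n\<close> of \<open>T S\<^sub>n\<close> with \<open>S\<^sub>n\<close> of finite rank (a), or of \<open>T\<close> restricted to an increasing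
  sequence of finite-dimensional subspaces (b), each close to the previous one on more and more
  vectors of a dense sequence; the limit is the lifting. The comparison operator for the next step
  is \<open>L\<^sub>n\<close> itself in (a), and in (b) an extension to the larger subspace of the \<open>J\<^sub>1\<^sup>*\<^sup>*\<close>-component of
  \<open>L\<^sub>n\<close>, provided by injectivity. It is multiplied by a factor slightly below \<open>1\<close>, so that norms do
  not grow along the sequence.
\<close>

subsection \<open>The Hahn-Banach theorem\<close>

text \<open>A lift has two independent parts, one seen by the annihilator of
  \<open>J\<^sub>1\<close> and one by its complement \<open>ker_Q\<close>. The exact sum formula for
  dual norms means that the larger of the two bounds controls the lift, so a step costs an
  arbitrarily small additive error and no constant factor. The bidual of \<open>X\<^sub>1\<close>
  never appears: its \<open>J\<^sub>1\<close>-part is encoded by linear functions on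
  \<open>ker_Q\<close>.

  Separation handles only finitely many constraints at a time, so operator norms are tested on
  finite nets and closeness on finitely many vectors.

  A lift of norm \<open>lam + d\<close> cannot serve as comparison for a bound
  \<open>lam + e\<close> with \<open>e < d\<close>. The factor \<open>lam / (lam + d)\<close> brings
  its norm down to \<open>lam\<close> and moves its value at \<open>z\<close> by at most
  \<open>d * norm z\<close>; the sequence of values for \<open>d\<close> makes these costs summable
  along the dense sequence.

  Commutation is used in one form: if a functional kills \<open>J\<^sub>2\<close>, then
  \<open>Q\<close> does not change it on \<open>X\<^sub>2\<close>. This fits bases that contain a
  basis of the part in \<open>Y\<^sub>2\<close>, because corrections at those vectors range over
  \<open>J\<^sub>2\<close> and separating functionals then kill just
  \<open>J\<^sub>2\<close>.\<close>

definition sublinear :: "('v::real_vector \<Rightarrow> real) \<Rightarrow> bool" where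
  "sublinear p \<longleftrightarrow> (\<forall>x y. p (x + y) \<le> p x + p y) \<and> (\<forall>c\<ge>0. \<forall>x. p (c *\<^sub>R x) = c * p x)"

lemma sublinear_add: "sublinear p \<Longrightarrow> p (x + y) \<le> p x + p y"
  and sublinear_scale: "sublinear p \<Longrightarrow> 0 \<le> c \<Longrightarrow> p (c *\<^sub>R x) = c * p x"
  by (auto simp: sublinear_def)

lemma sublinear_0: "sublinear p \<Longrightarrow> p 0 = 0"
  using sublinear_scale[of p 0 0] by simp

lemma sublinear_minus: "sublinear p \<Longrightarrow> - p (- x) \<le> p x"
  using sublinear_add[of p x "- x"] sublinear_0[of p] by simp

lemma sublinearI_pos:
  assumes add: "\<And>x y. p (x + y) \<le> p x + p y" and scale: "\<And>c x. 0 < c \<Longrightarrow> p (c *\<^sub>R x) \<le> c * p x"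
    and zero: "p 0 = 0"
  shows "sublinear p"
  unfolding sublinear_def
proof (intro conjI allI impI)
  fix c :: real and x
  assume "0 \<le> c"
  show "p (c *\<^sub>R x) = c * p x"
  proof (cases "c = 0")
    case False
    with \<open>0 \<le> c\<close> have c: "0 < c" by simp
    have "p x \<le> inverse c * p (c *\<^sub>R x)"
      using scale[of "inverse c" "c *\<^sub>R x"] c by simp
    then have "c * p x \<le> p (c *\<^sub>R x)"
      using c by (simp add: field_simps)
    with scale[OF c, of x] show ?thesis by simp
  qed (simp add: zero)
qed (use add in auto)

text \<open>The parameter 0 puts this below \<open>q\<close>, and the parameter 1 gives a value of
  at most \<open>- q x\<close> at \<open>- x\<close>. If \<open>q\<close> is minimal, the shift
  equals \<open>q\<close>, and the parameter 1 then yields superadditivity in the direction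
  \<open>x\<close>.\<close>

definition sublinear_shift :: "('v::real_vector \<Rightarrow> real) \<Rightarrow> 'v \<Rightarrow> 'v \<Rightarrow> real" where
  "sublinear_shift q x y = (INF t\<in>{0..}. q (y + t *\<^sub>R x) - t * q x)"

lemma sublinear_shift_lower:
  assumes q: "sublinear q" and t: "0 \<le> t"
  shows "- q (- y) \<le> q (y + t *\<^sub>R x) - t * q x"
  using sublinear_add[OF q, of "y + t *\<^sub>R x" "- y"] sublinear_scale[OF q t, of x] by simp

lemma sublinear_shift_le:
  assumes "sublinear q" "0 \<le> t"
  shows "sublinear_shift q x y \<le> q (y + t *\<^sub>R x) - t * q x"
  unfolding sublinear_shift_def
  by (rule cINF_lower) (use assms sublinear_shift_lower[OF assms(1)] in \<open>auto intro!: bdd_belowI2\<close>)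

lemma sublinear_shift_greatest:
  assumes "\<And>t. 0 \<le> t \<Longrightarrow> m \<le> q (y + t *\<^sub>R x) - t * q x"
  shows "m \<le> sublinear_shift q x y"
  unfolding sublinear_shift_def by (rule cINF_greatest) (use assms in auto)

lemma sublinear_sublinear_shift:
  assumes q: "sublinear q"
  shows "sublinear (sublinear_shift q x)"
proof (rule sublinearI_pos)
  fix y z
  have 1: "sublinear_shift q x (y + z) \<le> (q (y + s *\<^sub>R x) - s * q x) + (q (z + t *\<^sub>R x) - t * q x)"
    if "0 \<le> s" "0 \<le> t" for s t
    using sublinear_shift_le[OF q, of "s + t" x "y + z"] that
      sublinear_add[OF q, of "y + s *\<^sub>R x" "z + t *\<^sub>R x"]
    by (simp add: algebra_simps)
  have "sublinear_shift q x (y + z) - (q (y + s *\<^sub>R x) - s * q x) \<le> sublinear_shift q x z"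
    if "0 \<le> s" for s
    by (rule sublinear_shift_greatest) (use 1[OF that] in \<open>force simp: algebra_simps\<close>)
  then have "sublinear_shift q x (y + z) - sublinear_shift q x z \<le> sublinear_shift q x y"
    by (intro sublinear_shift_greatest) (force simp: algebra_simps)
  then show "sublinear_shift q x (y + z) \<le> sublinear_shift q x y + sublinear_shift q x z"
    by simp
next
  fix c :: real and y
  assume c: "0 < c"
  have "inverse c * sublinear_shift q x (c *\<^sub>R y) \<le> sublinear_shift q x y"
  proof (rule sublinear_shift_greatest)
    fix t :: real assume t: "0 \<le> t"
    have "sublinear_shift q x (c *\<^sub>R y) \<le> q (c *\<^sub>R y + (c * t) *\<^sub>R x) - (c * t) * q x"
      by (rule sublinear_shift_le[OF q]) (use c t in simp)
    also have "\<dots> = c * (q (y + t *\<^sub>R x) - t * q x)"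
      using sublinear_scale[OF q, of c "y + t *\<^sub>R x"] c by (simp add: algebra_simps)
    finally show "inverse c * sublinear_shift q x (c *\<^sub>R y) \<le> q (y + t *\<^sub>R x) - t * q x"
      using c by (simp add: field_simps)
  qed
  then show "sublinear_shift q x (c *\<^sub>R y) \<le> c * sublinear_shift q x y"
    using c by (simp add: field_simps)
next
  have "sublinear_shift q x 0 \<le> 0"
    using sublinear_shift_le[OF q, of 0 x 0] sublinear_0[OF q] by simp
  moreover have "0 \<le> sublinear_shift q x 0"
    by (rule sublinear_shift_greatest) (use sublinear_scale[OF q] in simp)
  ultimately show "sublinear_shift q x 0 = 0" by simp
qed

lemma minimal_sublinear_below:
  fixes p :: "'v::real_vector \<Rightarrow> real"
  assumes p: "sublinear p"
  obtains q where "sublinear q" "q \<le> p" "\<And>q'. sublinear q' \<Longrightarrow> q' \<le> q \<Longrightarrow> q' = q"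
proof -
  let ?A = "{q. sublinear q \<and> q \<le> p}"
  let ?P = "\<lambda>q q' :: 'v \<Rightarrow> real. q' \<le> q"
  have "\<exists>m\<in>?A. \<forall>a\<in>?A. ?P m a \<longrightarrow> a = m"
  proof (rule predicate_Zorn)
    show "partial_order_on ?A (relation_of ?P ?A)"
      by (rule partial_order_on_relation_ofI) auto
    fix C assume C: "C \<in> Chains (relation_of ?P ?A)"
    then have CA: "C \<subseteq> ?A" and chain: "\<And>a b. a \<in> C \<Longrightarrow> b \<in> C \<Longrightarrow> a \<le> b \<or> b \<le> a"
      by (auto simp: Chains_def relation_of_def)
    show "\<exists>u\<in>?A. \<forall>a\<in>C. ?P a u"
    proof (cases "C = {}")
      case True
      then show ?thesis using p by auto
    next
      case False
      define u where "u x = (INF q\<in>C. q x)" for x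
      \<comment> \<open>A lower bound common to all members of the chain, so that the pointwise
        infimum is finite.\<close>
      have lower: "- p (- x) \<le> q x" if "q \<in> C" for q x
      proof -
        have "sublinear q" "q (- x) \<le> p (- x)" using that CA by (auto simp: le_fun_def)
        then show ?thesis using sublinear_minus[of q x] by linarith
      qed
      have u_le: "u x \<le> q x" if "q \<in> C" for q x
        unfolding u_def by (rule cINF_lower) (use that lower in \<open>auto intro!: bdd_belowI2\<close>)
      have u_ge: "m \<le> u x" if "\<And>q. q \<in> C \<Longrightarrow> m \<le> q x" for m x
        unfolding u_def by (rule cINF_greatest) (use that False in auto)
      have "sublinear u"
      proof (rule sublinearI_pos)
        fix x y
        \<comment> \<open>Of two members of a chain, the smaller one may be used at both
          points.\<close>
        have 1: "u (x + y) \<le> q x + q' y" if qq': "q \<in> C" "q' \<in> C" for q q'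
        proof -
          consider "q \<le> q'" | "q' \<le> q" using chain[OF qq'] by blast
          then show ?thesis
          proof cases
            case 1
            then have "q (x + y) \<le> q x + q' y"
              using CA qq' sublinear_add[of q x y] le_funD[of q q' y] by (auto intro: order_trans)
            then show ?thesis using u_le[OF qq'(1), of "x + y"] by simp
          next
            case 2
            then have "q' (x + y) \<le> q x + q' y"
              using CA qq' sublinear_add[of q' x y] le_funD[of q' q x] by (auto intro: order_trans)
            then show ?thesis using u_le[OF qq'(2), of "x + y"] by simp
          qed
        qed
        have "u (x + y) - q x \<le> u y" if "q \<in> C" for q
          by (rule u_ge) (use 1[OF that] in \<open>force simp: algebra_simps\<close>)
        then have "u (x + y) - u y \<le> u x"
          by (intro u_ge) (force simp: algebra_simps)
        then show "u (x + y) \<le> u x + u y" by simp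
      next
        fix c :: real and x assume c: "0 < c"
        have "inverse c * u (c *\<^sub>R x) \<le> u x"
        proof (rule u_ge)
          fix q assume "q \<in> C"
          then have "u (c *\<^sub>R x) \<le> c * q x"
            using u_le[of q "c *\<^sub>R x"] sublinear_scale[of q c x] CA c by auto
          then show "inverse c * u (c *\<^sub>R x) \<le> q x" using c by (simp add: field_simps)
        qed
        then show "u (c *\<^sub>R x) \<le> c * u x" using c by (simp add: field_simps)
      next
        have zero: "q 0 = 0" if "q \<in> C" for q
          using that CA sublinear_0 by auto
        obtain q where "q \<in> C" using False by blast
        then have "u 0 \<le> 0" using u_le[of q 0] zero[of q] by simp
        moreover have "0 \<le> u 0" by (rule u_ge) (simp add: zero)
        ultimately show "u 0 = 0" by simp
      qed
      moreover obtain q where "q \<in> C" using False by blast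
      then have "u \<le> q" "q \<le> p" using u_le CA by (auto simp: le_fun_def)
      then have "u \<le> p" by (rule order_trans)
      ultimately show ?thesis using u_le by (auto simp: le_fun_def)
    qed
  qed
  then obtain q where q: "sublinear q" "q \<le> p" "\<And>a. sublinear a \<Longrightarrow> a \<le> p \<Longrightarrow> a \<le> q \<Longrightarrow> a = q"
    by blast
  show thesis by (rule that[of q]) (use q order_trans in blast)+
qed

text \<open>A minimal sublinear functional is linear. Minimising below the shift of \<open>p\<close>
  by \<open>w\<close>, and not below \<open>p\<close> itself, forces the value \<open>p w\<close> at
  \<open>w\<close>, because the shift is at most \<open>- p w\<close> at \<open>- w\<close>.\<close>

theorem Hahn_Banach_sublinear:
  fixes p :: "'v::real_vector \<Rightarrow> real"
  assumes p: "sublinear p"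
  obtains F where "linear F" "\<And>x. F x \<le> p x" "F w = p w"
proof -
  obtain q where q: "sublinear q" "q \<le> sublinear_shift p w"
    and min: "\<And>q'. sublinear q' \<Longrightarrow> q' \<le> q \<Longrightarrow> q' = q"
    using minimal_sublinear_below[OF sublinear_sublinear_shift[OF p]] by metis
  have add: "q (x + y) = q x + q y" for x y
  proof -
    have "sublinear_shift q x = q"
      by (rule min[OF sublinear_sublinear_shift[OF q(1)]])
        (use sublinear_shift_le[OF q(1), of 0] in \<open>auto simp: le_fun_def\<close>)
    then have "q y \<le> q (y + x) - q x"
      using sublinear_shift_le[OF q(1), of 1 x y] by simp
    then show ?thesis
      using sublinear_add[OF q(1), of x y] by (simp add: add.commute)
  qed
  have neg: "q (- x) = - q x" for x
    using add[of x "- x"] sublinear_0[OF q(1)] by simp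
  have lin: "linear q"
  proof (rule linearI[OF add])
    fix c :: real and x
    show "q (c *\<^sub>R x) = c *\<^sub>R q x"
      using sublinear_scale[OF q(1), of c x] sublinear_scale[OF q(1), of "- c" x] neg[of "c *\<^sub>R x"]
      by (cases "0 \<le> c") auto
  qed
  have le: "q x \<le> p x" for x
    using q(2) sublinear_shift_le[OF p, of 0 w x] by (simp add: le_fun_def) (metis order_trans)
  have "q (- w) \<le> - p w"
    using q(2) sublinear_shift_le[OF p, of 1 w "- w"] sublinear_0[OF p]
    by (simp add: le_fun_def) (metis order_trans)
  with neg le[of w] have "q w = p w" by simp
  with lin le show thesis by (rule that)
qed

subsection \<open>Finite-dimensional subspaces\<close>

text \<open>\<open>d\<close> is the radius of a ball around \<open>b\<close> that misses
  \<open>span B\<close>; dividing by \<open>t\<close> shows that a smaller norm would put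
  \<open>- v / t\<close> into this ball. The coefficient of \<open>b\<close> is thus controlled by
  the norm, which drives the inductions over finite bases below.\<close>

lemma closed_span_insert_coefficient:
  fixes b :: "'a::real_normed_vector"
  assumes "closed (span B)" "b \<notin> span B"
  obtains d where "0 < d" "\<And>v t. v \<in> span B \<Longrightarrow> \<bar>t\<bar> * d \<le> norm (v + t *\<^sub>R b)"
proof -
  have "open (- span B)" "b \<in> - span B" using assms by auto
  then obtain d where d: "0 < d" "ball b d \<subseteq> - span B" by (meson openE)
  have "\<bar>t\<bar> * d \<le> norm (v + t *\<^sub>R b)" if v: "v \<in> span B" for v t
  proof (cases "t = 0")
    case False
    have "- inverse t *\<^sub>R v \<in> span B" using v by (rule span_scale)
    then have "- inverse t *\<^sub>R v \<notin> ball b d" using d by blast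
    then have "d \<le> norm (b + inverse t *\<^sub>R v)" by (simp add: dist_norm)
    then have "\<bar>t\<bar> * d \<le> \<bar>t\<bar> * norm (b + inverse t *\<^sub>R v)" by (simp add: mult_left_mono)
    also have "\<dots> = norm (t *\<^sub>R (b + inverse t *\<^sub>R v))" by simp
    also have "t *\<^sub>R (b + inverse t *\<^sub>R v) = v + t *\<^sub>R b" using False by (simp add: scaleR_add_right)
    finally show ?thesis .
  qed simp
  with d(1) show thesis by (rule that)
qed

lemma closed_if_bounded_parts:
  fixes S :: "'a::real_normed_vector set"
  assumes "\<And>r. compact (S \<inter> cball 0 r)"
  shows "closed S"
  unfolding closed_sequential_limits
proof (intro allI impI)
  fix x l assume x: "(\<forall>n. x n \<in> S) \<and> x \<longlonglongrightarrow> l"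
  then have "Bseq x" by (metis convergentI convergent_imp_Bseq)
  then obtain r where "\<And>n. norm (x n) \<le> r" by (auto simp: Bseq_def)
  with x have "\<forall>n. x n \<in> S \<inter> cball 0 r" by auto
  moreover have "closed (S \<inter> cball 0 r)" using assms compact_imp_closed by blast
  ultimately have "l \<in> S \<inter> cball 0 r" using x closed_sequentially by blast
  then show "l \<in> S" by simp
qed

text \<open>For a new vector \<open>b\<close>, the coefficient bound confines the ball to the image
  of a compact product under \<open>(v, t) \<mapsto> v + t b\<close>. The radius has to vary in the
  induction: the remainder \<open>v\<close> may be longer than \<open>r\<close>, and closedness of
  \<open>span B\<close> needs all radii.\<close>

lemma compact_span_cball:
  fixes B :: "'a::real_normed_vector set"
  assumes "finite B"
  shows "compact (span B \<inter> cball 0 r)"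
  using assms
proof (induction B arbitrary: r rule: finite_induct)
  case empty
  have "span {} \<inter> cball (0::'a) r \<subseteq> {0}" by auto
  then show ?case by (meson finite.emptyI finite.insertI finite_subset finite_imp_compact)
next
  case (insert b B)
  have closed: "closed (span B)" by (rule closed_if_bounded_parts) (rule insert.IH)
  show ?case
  proof (cases "b \<in> span B")
    case True
    then show ?thesis using insert.IH by (simp add: span_redundant)
  next
    case False
    then obtain d where d: "0 < d" "\<And>v t. v \<in> span B \<Longrightarrow> \<bar>t\<bar> * d \<le> norm (v + t *\<^sub>R b)"
      using closed_span_insert_coefficient[OF closed] by metis
    define K where "K = (\<lambda>(v, t). v + t *\<^sub>R b) ` ((span B \<inter> cball 0 (r + r / d * norm b)) \<times> {- (r / d)..r / d})"
    have "compact K"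
      unfolding K_def split_def
      by (intro compact_continuous_image compact_Times insert.IH continuous_intros) auto
    moreover have "span (insert b B) \<inter> cball 0 r = K \<inter> cball 0 r"
    proof (intro antisym subsetI)
      fix x assume x: "x \<in> span (insert b B) \<inter> cball 0 r"
      then obtain t where t: "x - t *\<^sub>R b \<in> span B" by (auto simp: span_insert)
      have "\<bar>t\<bar> * d \<le> norm x" using d(2)[OF t, of t] by simp
      then have "\<bar>t\<bar> * d \<le> r" using x by simp
      then have tr: "\<bar>t\<bar> \<le> r / d" using d(1) by (simp add: field_simps)
      have "norm (x - t *\<^sub>R b) \<le> norm x + \<bar>t\<bar> * norm b"
        using norm_triangle_ineq4[of x "t *\<^sub>R b"] by simp
      also have "\<dots> \<le> r + r / d * norm b"
        using x tr by (intro add_mono mult_right_mono) auto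
      finally have "(x - t *\<^sub>R b, t) \<in> (span B \<inter> cball 0 (r + r / d * norm b)) \<times> {- (r / d)..r / d}"
        using t tr by auto
      then have "x \<in> K" unfolding K_def by (rule rev_image_eqI) simp
      with x show "x \<in> K \<inter> cball 0 r" by simp
    next
      fix x assume "x \<in> K \<inter> cball 0 r"
      then obtain v t where "v \<in> span B" "x = v + t *\<^sub>R b" "x \<in> cball 0 r"
        by (auto simp: K_def)
      then show "x \<in> span (insert b B) \<inter> cball 0 r"
        unfolding span_insert by (auto intro!: exI[of _ t])
    qed
    ultimately show ?thesis by (simp add: compact_Int_closed)
  qed
qed

lemma closed_span_finite:
  fixes B :: "'a::real_normed_vector set"
  shows "finite B \<Longrightarrow> closed (span B)"
  by (rule closed_if_bounded_parts) (rule compact_span_cball)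

lemma linear_bounded_on_span:
  fixes f :: "'a::real_normed_vector \<Rightarrow> 'c::real_normed_vector"
  assumes f: "linear f" and "finite B"
  shows "\<exists>c\<ge>0. \<forall>x\<in>span B. norm (f x) \<le> c * norm x"
  using assms(2)
proof (induction B rule: finite_induct)
  case empty
  show ?case by (rule exI[of _ 0]) (simp add: linear_0[OF f])
next
  case (insert b B)
  then obtain c where c: "0 \<le> c" "\<And>x. x \<in> span B \<Longrightarrow> norm (f x) \<le> c * norm x" by blast
  show ?case
  proof (cases "b \<in> span B")
    case True
    then show ?thesis using c by (auto simp: span_redundant)
  next
    case False
    then obtain d where d: "0 < d" "\<And>v t. v \<in> span B \<Longrightarrow> \<bar>t\<bar> * d \<le> norm (v + t *\<^sub>R b)"
      using closed_span_insert_coefficient[OF closed_span_finite] insert.hyps by metis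
    have "norm (f x) \<le> (c * (1 + norm b / d) + norm (f b) / d) * norm x"
      if x: "x \<in> span (insert b B)" for x
    proof -
      obtain t where t: "x - t *\<^sub>R b \<in> span B" using x unfolding span_insert by blast
      have td: "\<bar>t\<bar> \<le> norm x / d" using d(2)[OF t, of t] d(1) by (simp add: field_simps)
      have "norm (x - t *\<^sub>R b) \<le> norm x + \<bar>t\<bar> * norm b"
        using norm_triangle_ineq4[of x "t *\<^sub>R b"] by simp
      also have "\<dots> \<le> norm x + norm x / d * norm b"
        using mult_right_mono[OF td norm_ge_zero[of b]] by simp
      finally have 1: "c * norm (x - t *\<^sub>R b) \<le> c * (norm x + norm x / d * norm b)"
        using c(1) by (rule mult_left_mono)
      have "f x = f (x - t *\<^sub>R b) + t *\<^sub>R f b"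
        by (simp add: linear_diff[OF f] linear_scale[OF f])
      then have "norm (f x) \<le> norm (f (x - t *\<^sub>R b)) + \<bar>t\<bar> * norm (f b)"
        by (metis norm_scaleR norm_triangle_ineq)
      also have "\<dots> \<le> c * (norm x + norm x / d * norm b) + norm x / d * norm (f b)"
        using c(2)[OF t] 1 td by (intro add_mono mult_right_mono) auto
      finally show ?thesis by (simp add: algebra_simps add_divide_distrib)
    qed
    moreover have "0 \<le> c * (1 + norm b / d) + norm (f b) / d"
      using c(1) d(1) by simp
    ultimately show ?thesis by blast
  qed
qed

text \<open>A linear map sends \<open>V \<inter> W\<close> into a subspace as soon as it does so
  with the basis vectors in \<open>W\<close>. An ordinary basis of \<open>V\<close> may contain no
  vector of \<open>W\<close> at all, so a basis of \<open>V \<inter> W\<close> is chosen first and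
  then extended.\<close>

lemma adapted_basis:
  assumes V: "V = span G" "finite G" and W: "subspace W"
  obtains B where "finite B" "independent B" "span B = V" "span (B \<inter> W) = V \<inter> W"
proof -
  have VW: "subspace (V \<inter> W)" using V W by (simp add: subspace_inter)
  obtain B2 where B2: "B2 \<subseteq> V \<inter> W" "independent B2" "V \<inter> W \<subseteq> span B2"
    using maximal_independent_subset[of "V \<inter> W"] by blast
  have span_B2: "span B2 = V \<inter> W"
    using B2(3) span_minimal[OF B2(1) VW] by (rule subset_antisym[rotated])
  obtain B where B: "B2 \<subseteq> B" "B \<subseteq> V" "independent B" "V \<subseteq> span B"
    using maximal_independent_subset_extend[of B2 V] B2 by blast
  have "span B = V" using B V(1) by (metis span_minimal subspace_span subset_antisym)
  moreover have "finite B" using independent_span_bound[OF V(2) B(3)] B(2) V(1) by simp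
  moreover have "B \<inter> W = B2"
  proof
    show "B \<inter> W \<subseteq> B2"
    proof
      fix e assume e: "e \<in> B \<inter> W"
      then have "e \<in> span B2" using B(2) span_B2 by auto
      show "e \<in> B2"
      proof (rule ccontr)
        assume "e \<notin> B2"
        then have "span B2 \<subseteq> span (B - {e})" using B(1) by (intro span_mono) auto
        with \<open>e \<in> span B2\<close> e B(3) show False by (auto simp: dependent_def)
      qed
    qed
  qed (use B(1) B2(1) in auto)
  ultimately show thesis using that B(3) span_B2 by metis
qed

text \<open>\<open>P\<close> is \<Phi> followed by a linear right inverse on its range. It reduces
  questions about a finite-rank operator on the whole space to the finite-dimensional range of
  \<open>P\<close>.\<close>

lemma finite_rank_projection:
  fixes \<Phi> :: "'b::real_normed_vector \<Rightarrow> 'c::real_normed_vector"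
  assumes \<Phi>: "bounded_linear \<Phi>" and G: "finite G" "range \<Phi> \<subseteq> span G" and W: "subspace W"
  obtains P H where "bounded_linear P" "finite H" "range P = span H"
    "\<And>x. P (P x) = P x" "\<And>x. \<Phi> (P x) = \<Phi> x" "P ` W \<subseteq> W"
proof -
  have lin: "linear \<Phi>" using \<Phi> by (rule bounded_linear.linear)
  obtain G0 where G0: "finite G0" "range \<Phi> = span G0"
  proof -
    obtain G0 where "G0 \<subseteq> range \<Phi>" "independent G0" "range \<Phi> \<subseteq> span G0"
      using maximal_independent_subset[of "range \<Phi>"] by blast
    moreover have "subspace (range \<Phi>)" using lin by (simp add: linear_subspace_image)
    ultimately show thesis
      using that[of G0] independent_span_bound[OF G(1), of G0] G(2) span_minimal[of G0 "range \<Phi>"]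
      by (meson order_trans subset_antisym)
  qed
  obtain C where C: "finite C" "independent C" "span C = range \<Phi>"
    "span (C \<inter> \<Phi> ` W) = range \<Phi> \<inter> \<Phi> ` W"
    using adapted_basis[OF G0(2,1) linear_subspace_image[OF lin W]] by metis
  \<comment> \<open>Preimages are taken in \<open>W\<close> whenever possible. Since
    \<open>C\<close> is adapted to the image of \<open>W\<close>, the right inverse then maps this
    whole image back into \<open>W\<close>.\<close>
  have "\<forall>c\<in>C. \<exists>w. \<Phi> w = c \<and> (c \<in> \<Phi> ` W \<longrightarrow> w \<in> W)"
    using C(3) span_base by (smt (verit) imageE)
  then obtain w where w: "\<And>c. c \<in> C \<Longrightarrow> \<Phi> (w c) = c" "\<And>c. c \<in> C \<Longrightarrow> c \<in> \<Phi> ` W \<Longrightarrow> w c \<in> W"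
    by metis
  obtain \<psi> where \<psi>: "linear \<psi>" "\<And>c. c \<in> C \<Longrightarrow> \<psi> c = w c"
    using linear_independent_extend[OF C(2)] by metis
  have inv: "\<Phi> (\<psi> v) = v" if "v \<in> span C" for v
  proof -
    have "(\<Phi> \<circ> \<psi>) v = id v"
      by (rule linear_eq_on[OF linear_compose[OF \<psi>(1) lin] linear_id that]) (use w \<psi> in auto)
    then show ?thesis by simp
  qed
  have inW: "\<psi> v \<in> W" if "v \<in> \<Phi> ` W" for v
  proof -
    have "v \<in> span (C \<inter> \<Phi> ` W)" using that C(4) by auto
    then have "\<psi> v \<in> span (\<psi> ` (C \<inter> \<Phi> ` W))" using linear_span_image[OF \<psi>(1)] by blast
    also have "\<dots> \<subseteq> W" using \<psi>(2) w(2) by (intro span_minimal W) auto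
    finally show ?thesis .
  qed
  obtain c where c: "0 \<le> c" "\<And>x. x \<in> span C \<Longrightarrow> norm (\<psi> x) \<le> c * norm x"
    using linear_bounded_on_span[OF \<psi>(1) C(1)] by blast
  show thesis
  proof (rule that[of "\<psi> \<circ> \<Phi>" "\<psi> ` C"])
    interpret \<Phi>: bounded_linear \<Phi> by (rule \<Phi>)
    obtain k where k: "\<And>x. norm (\<Phi> x) \<le> norm x * k" using \<Phi>.bounded by blast
    show "bounded_linear (\<psi> \<circ> \<Phi>)"
    proof (rule bounded_linear_intro[of _ "k * c"])
      fix x
      have "norm ((\<psi> \<circ> \<Phi>) x) \<le> c * norm (\<Phi> x)" using c(2)[of "\<Phi> x"] C(3) by simp
      also have "\<dots> \<le> c * (norm x * k)" using c(1) k by (simp add: mult_left_mono)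
      finally show "norm ((\<psi> \<circ> \<Phi>) x) \<le> norm x * (k * c)" by (simp add: mult_ac)
    qed (simp_all add: \<Phi>.add \<Phi>.scaleR linear_add[OF \<psi>(1)] linear_scale[OF \<psi>(1)])
    show "range (\<psi> \<circ> \<Phi>) = span (\<psi> ` C)"
      using C(3) linear_span_image[OF \<psi>(1), of C] by (metis image_comp)
    show "(\<psi> \<circ> \<Phi>) ((\<psi> \<circ> \<Phi>) x) = (\<psi> \<circ> \<Phi>) x" "\<Phi> ((\<psi> \<circ> \<Phi>) x) = \<Phi> x" for x
      using inv[of "\<Phi> x"] C(3) by simp_all
    show "(\<psi> \<circ> \<Phi>) ` W \<subseteq> W" using inW by auto
  qed (use C(1) in simp)
qed

text \<open>\<open>Z\<close> is a \<delta>-net of \<open>B\<close>, fixed before \<open>U\<close> is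
  known, so that finitely many constraints control a norm. For the supremum \<open>s\<close> of
  \<open>norm (U x)\<close> over \<open>B\<close>, the net gives
  \<open>s \<le> m + \<delta> * s\<close>. A general \<open>B\<close> is allowed because the
  relevant set may be the image of a unit ball under a projection of norm above 1.\<close>

lemma norming_finite_subset:
  fixes V :: "'b::real_normed_vector set"
  assumes V: "V = span G" "finite G" and B: "B \<subseteq> V" "bounded B" "V \<inter> cball 0 1 \<subseteq> B" and \<delta>: "0 < \<delta>" "\<delta> < 1"
  obtains Z where "finite Z" "Z \<subseteq> B"
    "\<And>(U :: 'b \<Rightarrow> 'c::real_normed_vector) m z. linear U \<Longrightarrow> (\<And>z. z \<in> Z \<Longrightarrow> norm (U z) \<le> m) \<Longrightarrow> z \<in> B \<Longrightarrow>
       norm (U z) \<le> m / (1 - \<delta>)"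
proof -
  obtain r where r: "B \<subseteq> cball 0 r" using B(2) by (fastforce simp: bounded_iff)
  have comp: "compact (V \<inter> cball 0 r)" using V compact_span_cball by simp
  have "closure B \<subseteq> V \<inter> cball 0 r"
    using B(1) r compact_imp_closed[OF comp] by (intro closure_minimal) auto
  then have cpt: "compact (closure B)"
    using comp closed_closure compact_Int_closed by (metis inf.absorb_iff2 inf_commute)
  have cover: "closure B \<subseteq> (\<Union>z\<in>B. ball z \<delta>)"
  proof
    fix x assume "x \<in> closure B"
    then obtain z where "z \<in> B" "dist z x < \<delta>" using \<delta>(1) closure_approachable by blast
    then show "x \<in> (\<Union>z\<in>B. ball z \<delta>)" by auto
  qed
  obtain Z where Z: "Z \<subseteq> B" "finite Z" "closure B \<subseteq> (\<Union>z\<in>Z. ball z \<delta>)"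
    by (rule compactE_image[OF cpt _ cover]) auto
  have bound: "norm (U z) \<le> m / (1 - \<delta>)"
    if U: "linear U" "\<And>z. z \<in> Z \<Longrightarrow> norm (U z) \<le> m" and z: "z \<in> B" for U :: "'b \<Rightarrow> 'c" and m z
  proof -
    obtain c where c: "0 \<le> c" "\<And>x. x \<in> V \<Longrightarrow> norm (U x) \<le> c * norm x"
      using linear_bounded_on_span[OF U(1) V(2)] V(1) by blast
    have "norm (U x) \<le> c * r" if "x \<in> B" for x
    proof -
      have "norm (U x) \<le> c * norm x" using c(2) that B(1) by blast
      also have "\<dots> \<le> c * r" using r that c(1) by (intro mult_left_mono) auto
      finally show ?thesis .
    qed
    then have bdd: "bdd_above ((\<lambda>x. norm (U x)) ` B)" by (auto intro!: bdd_aboveI2)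
    define s where "s = (SUP x\<in>B. norm (U x))"
    have le_s: "norm (U x) \<le> s" if "x \<in> B" for x
      unfolding s_def using bdd that by (rule cSUP_upper2) simp
    have "s \<le> m + \<delta> * s"
      unfolding s_def
    proof (rule cSUP_least)
      fix x assume x: "x \<in> B"
      then have "x \<in> (\<Union>z\<in>Z. ball z \<delta>)" using Z(3) closure_subset by blast
      then obtain z0 where z0: "z0 \<in> Z" "dist z0 x < \<delta>" by auto
      \<comment> \<open>The error \<open>x - z0\<close>, enlarged by
        \<open>inverse \<delta>\<close>, lies in the unit ball of \<open>V\<close> and hence in
        \<open>B\<close>, where \<open>s\<close> bounds \<open>U\<close>.\<close>
      have "inverse \<delta> *\<^sub>R (x - z0) \<in> V"
        using x z0 Z(1) B(1) V(1) by (auto intro!: span_scale span_diff)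
      moreover have "norm (inverse \<delta> *\<^sub>R (x - z0)) \<le> 1"
        using z0(2) \<delta>(1) by (simp add: dist_norm norm_minus_commute divide_simps)
      ultimately have "norm (U (inverse \<delta> *\<^sub>R (x - z0))) \<le> s"
        using B(3) by (intro le_s) auto
      then have 1: "norm (U (x - z0)) \<le> \<delta> * s"
        using \<delta>(1) by (simp add: linear_scale[OF U(1)] divide_simps mult.commute)
      have "norm (U x) \<le> norm (U z0) + norm (U (x - z0))"
        using norm_triangle_ineq[of "U z0" "U (x - z0)"] by (simp add: linear_diff[OF U(1)])
      then show "norm (U x) \<le> m + \<delta> * (SUP x\<in>B. norm (U x))"
        using U(2)[OF z0(1)] 1 by (simp add: s_def)
    qed (use z in auto)
    then have "s \<le> m / (1 - \<delta>)" using \<delta>(2) by (simp add: field_simps)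
    with le_s[OF z] show ?thesis by simp
  qed
  show thesis by (rule that[OF Z(2,1)]) (rule bound)
qed

subsection \<open>Operator norms and dual spaces\<close>

lemma linear_map_on_imageI: "linear_map_on V W t \<Longrightarrow> x \<in> V \<Longrightarrow> t x \<in> W"
  and linear_map_on_add: "linear_map_on V W t \<Longrightarrow> x \<in> V \<Longrightarrow> y \<in> V \<Longrightarrow> t (x + y) = t x + t y"
  and linear_map_on_scale: "linear_map_on V W t \<Longrightarrow> x \<in> V \<Longrightarrow> t (c *\<^sub>R x) = c *\<^sub>R t x"
  by (auto simp: linear_map_on_def)

lemma linear_map_on_sum:
  assumes V: "subspace V" and t: "linear_map_on V W t" and x: "\<And>i. i \<in> I \<Longrightarrow> x i \<in> V"
  shows "t (\<Sum>i\<in>I. a i *\<^sub>R x i) = (\<Sum>i\<in>I. a i *\<^sub>R t (x i))"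
  using x
proof (induction I rule: infinite_finite_induct)
  case (insert j I)
  then show ?case
    using V t by (simp add: linear_map_on_add linear_map_on_scale subspace_sum subspace_scale)
qed (use linear_map_on_scale[OF t subspace_0[OF V], of 0] in auto)

lemma linear_map_on_diff:
  assumes "subspace V" "linear_map_on V W t" "x \<in> V" "y \<in> V"
  shows "t (x - y) = t x - t y"
  using linear_map_on_add[OF assms(2), of x "(- 1) *\<^sub>R y"] linear_map_on_scale[OF assms(2), of y "- 1"]
    subspace_scale[OF assms(1,4), of "- 1"] assms by simp

lemma sum_fun_apply: "(\<Sum>i\<in>I. f i) x = (\<Sum>i\<in>I. f i x)"
  by (induction I rule: infinite_finite_induct) auto

lemma normed_space_on_norm: "subspace V \<Longrightarrow> normed_space_on V norm"
  by (auto simp: normed_space_on_def norm_triangle_ineq)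

lemma normed_space_on_abs: "normed_space_on (UNIV :: real set) abs"
  by (auto simp: normed_space_on_def subspace_UNIV abs_mult)

context
  fixes V :: "'v::real_vector set" and p and W :: "'w::real_vector set" and q and t
  assumes V: "normed_space_on V p" and W: "normed_space_on W q"
    and t: "linear_map_on V W t"
begin

lemma le_op_norm:
  assumes bdd: "bounded_on V p q t" and x: "x \<in> V"
  shows "q (t x) \<le> op_norm V p q t * p x"
proof -
  have sub: "subspace V" and nonneg: "\<And>x. x \<in> V \<Longrightarrow> 0 \<le> p x"
    and p_eq_0: "\<And>x. x \<in> V \<Longrightarrow> p x = 0 \<longleftrightarrow> x = 0"
    and p_scale: "\<And>c x. x \<in> V \<Longrightarrow> p (c *\<^sub>R x) = \<bar>c\<bar> * p x"
    and q_scale: "\<And>c x. x \<in> W \<Longrightarrow> q (c *\<^sub>R x) = \<bar>c\<bar> * q x"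
    using V W by (auto simp: normed_space_on_def)
  obtain C where C: "\<And>x. x \<in> V \<Longrightarrow> q (t x) \<le> C * p x"
    using bdd by (auto simp: bounded_on_def)
  have "bdd_above ((\<lambda>x. q (t x)) ` {x \<in> V. p x \<le> 1})"
  proof (rule bdd_aboveI2)
    fix x assume x: "x \<in> {x \<in> V. p x \<le> 1}"
    then have "q (t x) \<le> C * p x" using C by auto
    also have "\<dots> \<le> \<bar>C\<bar> * 1" using x nonneg by (intro mult_mono) auto
    finally show "q (t x) \<le> \<bar>C\<bar> * 1" .
  qed
  then have le: "q (t y) \<le> op_norm V p q t" if "y \<in> V" "p y \<le> 1" for y
    unfolding op_norm_def using that by (intro cSUP_upper) auto
  show ?thesis
  proof (cases "x = 0")
    case True
    then have "t x = 0" using linear_map_on_scale[OF t subspace_0[OF sub], of 0] by simp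
    moreover have "q 0 = 0" using W by (auto simp: normed_space_on_def subspace_0)
    moreover have "p 0 = 0" using p_eq_0[of 0] subspace_0[OF sub] by simp
    ultimately show ?thesis using True by simp
  next
    case False
    then have px: "0 < p x" using nonneg[OF x] p_eq_0[OF x] by simp
    have "q (t (inverse (p x) *\<^sub>R x)) \<le> op_norm V p q t"
      using x px by (intro le) (auto simp: subspace_scale[OF sub] p_scale)
    then show ?thesis
      using px x by (simp add: linear_map_on_scale[OF t] linear_map_on_imageI[OF t] q_scale field_simps)
  qed
qed

lemma op_norm_le:
  assumes "0 \<le> C" "\<And>x. x \<in> V \<Longrightarrow> q (t x) \<le> C * p x"
  shows "op_norm V p q t \<le> C"
  unfolding op_norm_def
proof (rule cSUP_least)
  show "{x \<in> V. p x \<le> 1} \<noteq> {}"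
    using V subspace_0[of V] by (force simp: normed_space_on_def)
  fix x assume x: "x \<in> {x \<in> V. p x \<le> 1}"
  then have "q (t x) \<le> C * p x" using assms by auto
  also have "\<dots> \<le> C * 1" using x assms(1) by (intro mult_left_mono) auto
  finally show "q (t x) \<le> C" by simp
qed

lemma op_norm_nonneg:
  assumes bdd: "bounded_on V p q t"
  shows "0 \<le> op_norm V p q t"
proof (cases "\<exists>x\<in>V. p x \<noteq> 0")
  case True
  then obtain x where x: "x \<in> V" "p x \<noteq> 0" by blast
  have "0 \<le> q (t x)"
    using W x linear_map_on_imageI[OF t] by (auto simp: normed_space_on_def)
  then have "0 \<le> op_norm V p q t * p x" using le_op_norm[OF bdd x(1)] by linarith
  moreover have "0 < p x" using V x by (auto simp: normed_space_on_def order.strict_iff_order)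
  ultimately show ?thesis by (simp add: zero_le_mult_iff)
next
  case False
  then have "{x \<in> V. p x \<le> 1} = {0}"
    using V by (auto simp: normed_space_on_def subspace_0)
  moreover have "t 0 = 0"
    using V linear_map_on_scale[OF t, of 0 0] by (auto simp: normed_space_on_def subspace_0)
  ultimately show ?thesis
    using W by (auto simp: op_norm_def normed_space_on_def subspace_0)
qed

end

lemma dual_spaceD:
  assumes "f \<in> dual_space V p"
  shows "linear_map_on V UNIV f" "bounded_on V p abs f" "x \<notin> V \<Longrightarrow> f x = 0"
  using assms by (auto simp: dual_space_def)

lemma dual_spaceI:
  assumes "\<And>x y. x \<in> V \<Longrightarrow> y \<in> V \<Longrightarrow> f (x + y) = f x + f y"
    "\<And>c x. x \<in> V \<Longrightarrow> f (c *\<^sub>R x) = c * f x"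
    "\<And>x. x \<in> V \<Longrightarrow> \<bar>f x\<bar> \<le> C * p x" "\<And>x. x \<notin> V \<Longrightarrow> f x = 0"
  shows "f \<in> dual_space V p"
  using assms by (auto simp: dual_space_def linear_map_on_def bounded_on_def intro!: exI[of _ C])

context
  fixes V :: "'v::real_vector set" and p
  assumes V: "normed_space_on V p"
begin

lemma le_dual_norm: "f \<in> dual_space V p \<Longrightarrow> x \<in> V \<Longrightarrow> \<bar>f x\<bar> \<le> dual_norm V p f * p x"
  unfolding dual_norm_def
  by (rule le_op_norm[OF V normed_space_on_abs]) (auto dest: dual_spaceD)

lemma dual_norm_le:
  "f \<in> dual_space V p \<Longrightarrow> 0 \<le> C \<Longrightarrow> (\<And>x. x \<in> V \<Longrightarrow> \<bar>f x\<bar> \<le> C * p x) \<Longrightarrow> dual_norm V p f \<le> C"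
  unfolding dual_norm_def
  by (rule op_norm_le[OF V normed_space_on_abs]) (auto dest: dual_spaceD)

lemma dual_norm_nonneg: "f \<in> dual_space V p \<Longrightarrow> 0 \<le> dual_norm V p f"
  unfolding dual_norm_def
  by (rule op_norm_nonneg[OF V normed_space_on_abs]) (auto dest: dual_spaceD)

lemma dual_space_add_scale:
  assumes f: "f \<in> dual_space V p" and g: "g \<in> dual_space V p"
  shows "f + g \<in> dual_space V p" "c *\<^sub>R f \<in> dual_space V p"
proof -
  show "f + g \<in> dual_space V p"
  proof (rule dual_spaceI[where C = "dual_norm V p f + dual_norm V p g"])
    fix x assume x: "x \<in> V"
    show "\<bar>(f + g) x\<bar> \<le> (dual_norm V p f + dual_norm V p g) * p x"
      using le_dual_norm[OF f x] le_dual_norm[OF g x] by (simp add: algebra_simps)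
  qed (use dual_spaceD[OF f] dual_spaceD[OF g] in \<open>auto simp: linear_map_on_def algebra_simps\<close>)
  show "c *\<^sub>R f \<in> dual_space V p"
  proof (rule dual_spaceI[where C = "\<bar>c\<bar> * dual_norm V p f"])
    fix x assume x: "x \<in> V"
    show "\<bar>(c *\<^sub>R f) x\<bar> \<le> (\<bar>c\<bar> * dual_norm V p f) * p x"
      using mult_left_mono[OF le_dual_norm[OF f x], of "\<bar>c\<bar>"]
      by (simp add: scaleR_fun_def abs_mult mult.assoc)
  qed (use dual_spaceD[OF f] in \<open>auto simp: linear_map_on_def algebra_simps scaleR_fun_def\<close>)
qed

lemma normed_space_on_dual: "normed_space_on (dual_space V p) (dual_norm V p)"
proof -
  have zero: "0 \<in> dual_space V p" by (rule dual_spaceI[where C = 0]) auto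
  have sub: "subspace (dual_space V p)"
    using zero dual_space_add_scale by (simp add: subspace_def)
  have add: "dual_norm V p (f + g) \<le> dual_norm V p f + dual_norm V p g"
    if f: "f \<in> dual_space V p" and g: "g \<in> dual_space V p" for f g
  proof (rule dual_norm_le)
    fix x assume x: "x \<in> V"
    show "\<bar>(f + g) x\<bar> \<le> (dual_norm V p f + dual_norm V p g) * p x"
      using le_dual_norm[OF f x] le_dual_norm[OF g x] by (simp add: algebra_simps)
  qed (use f g dual_norm_nonneg dual_space_add_scale in auto)
  have scale_le: "dual_norm V p (c *\<^sub>R f) \<le> \<bar>c\<bar> * dual_norm V p f"
    if f: "f \<in> dual_space V p" for c f
  proof (rule dual_norm_le)
    fix x assume x: "x \<in> V"
    show "\<bar>(c *\<^sub>R f) x\<bar> \<le> \<bar>c\<bar> * dual_norm V p f * p x"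
      using mult_left_mono[OF le_dual_norm[OF f x], of "\<bar>c\<bar>"]
      by (simp add: scaleR_fun_def abs_mult mult.assoc)
  qed (use f dual_norm_nonneg dual_space_add_scale in auto)
  have eq_0: "dual_norm V p f = 0 \<longleftrightarrow> f = 0" if f: "f \<in> dual_space V p" for f
  proof
    assume "dual_norm V p f = 0"
    then have "f x = 0" for x
      using le_dual_norm[OF f, of x] dual_spaceD(3)[OF f, of x] by (cases "x \<in> V") auto
    then show "f = 0" by (simp add: fun_eq_iff)
  next
    assume "f = 0"
    then have "dual_norm V p f \<le> 0" using f by (intro dual_norm_le) auto
    then show "dual_norm V p f = 0" using dual_norm_nonneg[OF f] by simp
  qed
  have scale: "dual_norm V p (c *\<^sub>R f) = \<bar>c\<bar> * dual_norm V p f" if f: "f \<in> dual_space V p" for c f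
  proof (cases "c = 0")
    case True
    then show ?thesis using eq_0[OF zero] by simp
  next
    case False
    have "dual_norm V p (inverse c *\<^sub>R (c *\<^sub>R f)) \<le> \<bar>inverse c\<bar> * dual_norm V p (c *\<^sub>R f)"
      by (rule scale_le) (use dual_space_add_scale f in blast)
    then have "\<bar>c\<bar> * dual_norm V p f \<le> dual_norm V p (c *\<^sub>R f)"
      using False by (simp add: field_simps)
    with scale_le[OF f, of c] show ?thesis by simp
  qed
  show ?thesis
    unfolding normed_space_on_def using sub dual_norm_nonneg eq_0 scale add by blast
qed

end

lemma dual_space_UNIV: "dual_space (UNIV :: 'a::real_normed_vector set) norm = Collect bounded_linear"
proof (intro equalityI subsetI CollectI)
  fix f :: "'a \<Rightarrow> real" assume f: "f \<in> dual_space UNIV norm"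
  then obtain C where "\<And>x. \<bar>f x\<bar> \<le> C * norm x"
    by (auto simp: dual_space_def bounded_on_def)
  with f show "bounded_linear f"
    by (intro bounded_linear_intro[of _ C])
      (auto dest!: dual_spaceD(1) simp: linear_map_on_def mult.commute)
next
  fix f :: "'a \<Rightarrow> real" assume "f \<in> Collect bounded_linear"
  then interpret f: bounded_linear f by simp
  obtain C where C: "\<And>x. norm (f x) \<le> norm x * C" using f.bounded by blast
  show "f \<in> dual_space UNIV norm"
    by (rule dual_spaceI[where C = C]) (use C in \<open>auto simp: f.add f.scaleR mult.commute\<close>)
qed

lemma dual_norm_UNIV:
  fixes f :: "'a::real_normed_vector \<Rightarrow> real"
  assumes f: "bounded_linear f"
  shows "dual_norm UNIV norm f = onorm f"
proof (rule antisym)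
  have f': "f \<in> dual_space UNIV norm" using f by (simp add: dual_space_UNIV)
  note V = normed_space_on_norm[OF subspace_UNIV]
  show "dual_norm UNIV norm f \<le> onorm f"
    by (rule dual_norm_le[OF V f' onorm_pos_le[OF f]]) (use onorm[OF f] in auto)
  show "onorm f \<le> dual_norm UNIV norm f"
    by (rule onorm_bound) (use le_dual_norm[OF V f'] dual_norm_nonneg[OF V f'] in auto)
qed

lemma subspace_bounded_linear: "subspace {f :: 'a::real_normed_vector \<Rightarrow> real. bounded_linear f}"
  using normed_space_on_dual[OF normed_space_on_norm[OF subspace_UNIV[where 'a = 'a]]]
  by (simp add: dual_space_UNIV normed_space_on_def)

text \<open>The functional comes from domination by \<open>p x\<close>, the infimum of
  \<open>k * norm (x - j) + g j\<close> over \<open>j\<close> in \<open>J\<close>. The choice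
  \<open>j = 0\<close> bounds its norm by \<open>k\<close>; the choice \<open>j = x\<close> bounds
  it by \<open>g\<close> on \<open>J\<close>, and replacing \<open>x\<close> by \<open>- x\<close>
  turns this into equality.\<close>

lemma extend_functional:
  fixes J :: "'a::real_normed_vector set"
  assumes J: "subspace J" and g: "g \<in> dual_space J norm"
  obtains f where "bounded_linear f" "\<And>x. x \<in> J \<Longrightarrow> f x = g x" "onorm f \<le> dual_norm J norm g"
proof -
  note V = normed_space_on_norm[OF J]
  define k where "k = dual_norm J norm g"
  have k: "0 \<le> k" "\<And>x. x \<in> J \<Longrightarrow> \<bar>g x\<bar> \<le> k * norm x"
    unfolding k_def using dual_norm_nonneg[OF V g] le_dual_norm[OF V g] by auto
  have g_lin: "linear_map_on J UNIV g" using g by (rule dual_spaceD)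
  have g_add: "g (x + y) = g x + g y" and g_scale: "g (c *\<^sub>R x) = c * g x"
    if "x \<in> J" "y \<in> J" for x y c
    using g_lin that by (auto simp: linear_map_on_def)
  have g_0: "g 0 = 0" using g_scale[of 0 0 0] subspace_0[OF J] by simp
  define p where "p x = (INF j\<in>J. k * norm (x - j) + g j)" for x
  have lower: "- (k * norm x) \<le> k * norm (x - j) + g j" if "j \<in> J" for x j
  proof -
    have "k * norm j \<le> k * (norm (x - j) + norm x)"
      using norm_triangle_ineq4[of x "x - j"] k(1) by (intro mult_left_mono) (auto simp: add.commute)
    moreover have "- (k * norm j) \<le> g j" using k(2)[OF that] by linarith
    ultimately show ?thesis by (simp add: algebra_simps)
  qed
  have p_le: "p x \<le> k * norm (x - j) + g j" if "j \<in> J" for x j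
    unfolding p_def by (rule cINF_lower) (use that lower in \<open>auto intro!: bdd_belowI2\<close>)
  have p_ge: "m \<le> p x" if "\<And>j. j \<in> J \<Longrightarrow> m \<le> k * norm (x - j) + g j" for m x
    unfolding p_def by (rule cINF_greatest) (use that subspace_0[OF J] in auto)
  have "sublinear p"
  proof (rule sublinearI_pos)
    fix x y
    have 1: "p (x + y) \<le> (k * norm (x - i) + g i) + (k * norm (y - j) + g j)"
      if ij: "i \<in> J" "j \<in> J" for i j
    proof -
      have "p (x + y) \<le> k * norm ((x - i) + (y - j)) + (g i + g j)"
        using p_le[OF subspace_add[OF J ij], of "x + y"] g_add[OF ij] by (simp add: algebra_simps)
      also have "\<dots> \<le> k * (norm (x - i) + norm (y - j)) + (g i + g j)"
        using k(1) by (intro add_right_mono mult_left_mono norm_triangle_ineq)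
      finally show ?thesis by (simp add: algebra_simps)
    qed
    have "p (x + y) - (k * norm (x - i) + g i) \<le> p y" if "i \<in> J" for i
      by (rule p_ge) (use 1[OF that] in \<open>simp add: algebra_simps\<close>)
    then have "p (x + y) - p y \<le> p x"
      by (intro p_ge) (force simp: algebra_simps)
    then show "p (x + y) \<le> p x + p y" by simp
  next
    fix c :: real and x assume c: "0 < c"
    have "inverse c * p (c *\<^sub>R x) \<le> p x"
    proof (rule p_ge)
      fix j assume j: "j \<in> J"
      have "p (c *\<^sub>R x) \<le> k * norm (c *\<^sub>R (x - j)) + c * g j"
        using p_le[OF subspace_scale[OF J j, of c], of "c *\<^sub>R x"] g_scale[OF j j]
        by (simp add: scaleR_diff_right)
      then have "p (c *\<^sub>R x) \<le> c * (k * norm (x - j) + g j)"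
        unfolding norm_scaleR using c by (simp add: distrib_left mult.left_commute)
      then show "inverse c * p (c *\<^sub>R x) \<le> k * norm (x - j) + g j"
        using c by (simp add: field_simps)
    qed
    then show "p (c *\<^sub>R x) \<le> c * p x" using c by (simp add: field_simps)
  next
    have "p 0 \<le> 0" using p_le[OF subspace_0[OF J], of 0] g_0 by simp
    moreover have "0 \<le> p 0" by (rule p_ge) (use lower[of _ 0] in simp)
    ultimately show "p 0 = 0" by simp
  qed
  then obtain f where f: "linear f" "\<And>x. f x \<le> p x" using Hahn_Banach_sublinear by metis
  have f_le: "f x \<le> k * norm x" for x
    using f(2)[of x] p_le[OF subspace_0[OF J], of x] g_0 by simp
  have f_abs: "\<bar>f x\<bar> \<le> k * norm x" for x
    using f_le[of x] f_le[of "- x"] by (simp add: linear_neg[OF f(1)] abs_le_iff)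
  have bl: "bounded_linear f"
    by (rule bounded_linear_intro[of _ k])
      (use f_abs in \<open>auto simp: linear_add[OF f(1)] linear_scale[OF f(1)] mult.commute\<close>)
  have f_le_g: "f x \<le> g x" if "x \<in> J" for x
    using f(2)[of x] p_le[OF that, of x] by simp
  have "f x = g x" if x: "x \<in> J" for x
    using f_le_g[OF x] f_le_g[of "- x"] subspace_neg[OF J x] g_scale[OF x x, of "- 1"]
    by (simp add: linear_neg[OF f(1)])
  moreover have "onorm f \<le> k" by (rule onorm_bound) (use f_abs k in auto)
  ultimately show thesis using bl that k_def by blast
qed

subsection \<open>Corrections with values in an M-ideal\<close>

lemma onorm_almost_attained:
  fixes f :: "'a::real_normed_vector \<Rightarrow> real"
  assumes f: "bounded_linear f" and e: "0 < e"
  obtains v where "norm v \<le> 1" "onorm f - e \<le> f v"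
proof -
  interpret f: bounded_linear f by (rule f)
  have "\<exists>v. norm v \<le> 1 \<and> onorm f - e \<le> f v"
  proof (rule ccontr)
    assume "\<not> ?thesis"
    then have lt: "f v < onorm f - e" if "norm v \<le> 1" for v using that by force
    have "0 \<le> onorm f - e" using lt[of 0] by (simp add: f.zero)
    moreover have "norm (f v) \<le> (onorm f - e) * norm v" for v
    proof (cases "v = 0")
      case False
      have "f (inverse (norm v) *\<^sub>R v) < onorm f - e" "f (inverse (norm v) *\<^sub>R (- v)) < onorm f - e"
        using lt False by simp_all
      then have "\<bar>f v\<bar> / norm v \<le> onorm f - e"
        using False by (simp add: f.scaleR f.neg divide_inverse_commute abs_if)
      then show ?thesis using False by (simp add: pos_divide_le_eq)
    qed (simp add: f.zero)
    ultimately have "onorm f \<le> onorm f - e" by (rule onorm_bound)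
    with e show False by simp
  qed
  with that show thesis by blast
qed

text \<open>\<open>N\<close> is the maximum norm with weights \<open>1 / s i\<close>, and
  \<open>far\<close> says that \<open>w\<close> has distance at least 1 from \<open>D\<close>. A
  functional dominated by this distance and equal to it at \<open>w\<close> vanishes on
  \<open>D\<close>. The dual of the weighted maximum norm is the sum norm with weights
  \<open>s i\<close>, whence the bound on the \<open>onorm (f i)\<close>.\<close>

lemma tuple_separation:
  fixes D :: "('i \<Rightarrow> 'a::real_normed_vector) set"
  assumes I: "finite I" and D: "subspace D" and s: "\<And>i. i \<in> I \<Longrightarrow> 0 < s i"
    and far: "\<And>d. d \<in> D \<Longrightarrow> \<exists>i\<in>I. s i \<le> norm (w i - d i)"
  obtains f :: "'i \<Rightarrow> 'a \<Rightarrow> real" where "\<And>i. i \<in> I \<Longrightarrow> bounded_linear (f i)" "(\<Sum>i\<in>I. s i * onorm (f i)) \<le> 1"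
    "\<And>d. d \<in> D \<Longrightarrow> (\<Sum>i\<in>I. f i (d i)) = 0" "1 \<le> (\<Sum>i\<in>I. f i (w i))"
proof -
  have I_ne: "I \<noteq> {}" using far[OF subspace_0[OF D]] by auto
  define N where "N x = (MAX i\<in>I. norm (x i) / s i)" for x :: "'i \<Rightarrow> 'a"
  have le_N: "norm (x i) / s i \<le> N x" if "i \<in> I" for x i
    unfolding N_def using I that by (intro Max_ge) auto
  have N_le: "N x \<le> m" if "\<And>i. i \<in> I \<Longrightarrow> norm (x i) / s i \<le> m" for x m
    unfolding N_def using I I_ne that by (subst Max_le_iff) auto
  have N_nonneg: "0 \<le> N x" for x
  proof -
    obtain i where "i \<in> I" using I_ne by blast
    then show ?thesis using le_N[of i x] s[of i] by (meson divide_nonneg_pos norm_ge_zero order_trans)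
  qed
  have N_add: "N (x + y) \<le> N x + N y" for x y
  proof (rule N_le)
    fix i assume i: "i \<in> I"
    have "norm ((x + y) i) / s i \<le> norm (x i) / s i + norm (y i) / s i"
      using s[OF i] norm_triangle_ineq[of "x i" "y i"]
      by (simp add: add_divide_distrib[symmetric] divide_right_mono)
    with le_N[OF i, of x] le_N[OF i, of y] show "norm ((x + y) i) / s i \<le> N x + N y" by linarith
  qed
  have N_scale: "N (c *\<^sub>R x) \<le> c * N x" if c: "0 < c" for c x
  proof (rule N_le)
    fix i assume i: "i \<in> I"
    show "norm ((c *\<^sub>R x) i) / s i \<le> c * N x"
      using mult_left_mono[OF le_N[OF i, of x], of c] c by (simp add: scaleR_fun_def)
  qed
  define p where "p x = (INF d\<in>D. N (x - d))" for x
  have p_le: "p x \<le> N (x - d)" if "d \<in> D" for x d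
    unfolding p_def by (rule cINF_lower) (use that N_nonneg in \<open>auto intro!: bdd_belowI2\<close>)
  have p_ge: "m \<le> p x" if "\<And>d. d \<in> D \<Longrightarrow> m \<le> N (x - d)" for m x
    unfolding p_def by (rule cINF_greatest) (use that subspace_0[OF D] in auto)
  have "sublinear p"
  proof (rule sublinearI_pos)
    fix x y
    have 1: "p (x + y) \<le> N (x - d) + N (y - d')" if "d \<in> D" "d' \<in> D" for d d'
      using p_le[OF subspace_add[OF D that], of "x + y"] N_add[of "x - d" "y - d'"]
      by (simp add: algebra_simps)
    have "p (x + y) - N (x - d) \<le> p y" if "d \<in> D" for d
      by (rule p_ge) (use 1[OF that] in \<open>simp add: algebra_simps\<close>)
    then have "p (x + y) - p y \<le> p x"
      by (intro p_ge) (simp add: algebra_simps)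
    then show "p (x + y) \<le> p x + p y" by simp
  next
    fix c :: real and x assume c: "0 < c"
    have "inverse c * p (c *\<^sub>R x) \<le> p x"
    proof (rule p_ge)
      fix d assume d: "d \<in> D"
      have "p (c *\<^sub>R x) \<le> c * N (x - d)"
        using p_le[OF subspace_scale[OF D d, of c], of "c *\<^sub>R x"] N_scale[OF c, of "x - d"]
        by (simp add: scaleR_diff_right)
      then show "inverse c * p (c *\<^sub>R x) \<le> N (x - d)" using c by (simp add: field_simps)
    qed
    then show "p (c *\<^sub>R x) \<le> c * p x" using c by (simp add: field_simps)
  next
    have "N 0 \<le> 0" by (rule N_le) simp
    then have "p 0 \<le> 0" using p_le[OF subspace_0[OF D], of 0] by simp
    moreover have "0 \<le> p 0" by (rule p_ge) (rule N_nonneg)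
    ultimately show "p 0 = 0" by simp
  qed
  then obtain F where F: "linear F" "\<And>x. F x \<le> p x" "F w = p w"
    using Hahn_Banach_sublinear by metis
  have F_le_N: "F x \<le> N x" for x
    using F(2)[of x] p_le[OF subspace_0[OF D], of x] by simp
  have F_D: "F d = 0" if d: "d \<in> D" for d
  proof -
    have le: "F d \<le> 0" if "d \<in> D" for d
    proof -
      have "N 0 \<le> 0" by (rule N_le) simp
      then show ?thesis using F(2)[of d] p_le[OF that, of d] by simp
    qed
    show ?thesis
      using le[OF d] le[OF subspace_neg[OF D d]] by (simp add: linear_neg[OF F(1)])
  qed
  define single where "single i v = (\<lambda>k. if k = i then v else 0)" for i :: 'i and v :: 'a
  define f where "f i v = F (single i v)" for i v
  have F_eq: "F x = (\<Sum>i\<in>I. f i (x i))" for x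
  proof -
    \<comment> \<open>Tuples are functions on the whole index type. Coordinates outside
      \<open>I\<close> are invisible to \<open>N\<close>, hence to \<open>F\<close>.\<close>
    define y where "y = x - (\<Sum>i\<in>I. single i (x i))"
    have y: "y i = 0" if "i \<in> I" for i
      using that I by (simp add: y_def sum_fun_apply single_def sum.delta)
    have "F y \<le> 0" by (rule order_trans[OF F_le_N N_le]) (simp add: y)
    moreover have "F (- y) \<le> 0" by (rule order_trans[OF F_le_N N_le]) (simp add: y)
    ultimately have "F y = 0" by (simp add: linear_neg[OF F(1)])
    then show ?thesis by (simp add: y_def f_def linear_diff[OF F(1)] linear_sum[OF F(1)])
  qed
  have f_bl: "bounded_linear (f i)" if i: "i \<in> I" for i
  proof (rule bounded_linear_intro[of _ "inverse (s i)"])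
    have "single i (u + v) = single i u + single i v" "single i (c *\<^sub>R u) = c *\<^sub>R single i u" for u v c
      by (auto simp: single_def scaleR_fun_def)
    then show "f i (u + v) = f i u + f i v" "f i (c *\<^sub>R u) = c *\<^sub>R f i u" for u v c
      by (simp_all add: f_def linear_add[OF F(1)] linear_scale[OF F(1)])
    fix v
    have le: "F (single i u) \<le> norm u * inverse (s i)" for u
    proof (rule order_trans[OF F_le_N N_le])
      fix k assume "k \<in> I"
      show "norm (single i u k) / s k \<le> norm u * inverse (s i)"
        using s[OF i] by (simp add: single_def divide_inverse)
    qed
    have "single i (- v) = - single i v" by (auto simp: single_def)
    then show "norm (f i v) \<le> norm v * inverse (s i)"
      using le[of v] le[of "- v"] by (simp add: f_def linear_neg[OF F(1)] abs_le_iff)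
  qed
  have "(\<Sum>i\<in>I. s i * onorm (f i)) \<le> 1"
  proof (rule field_le_epsilon)
    fix e :: real assume e: "0 < e"
    \<comment> \<open>The weights \<open>s i\<close> amplify a loss of \<open>e'\<close> in each
      coordinate to a total loss of exactly \<open>e\<close>.\<close>
    define e' where "e' = e / (\<Sum>i\<in>I. s i)"
    have s_pos: "0 < (\<Sum>i\<in>I. s i)" using I I_ne s by (simp add: sum_pos)
    then have "0 < e'" using e by (simp add: e'_def)
    then have "\<forall>i\<in>I. \<exists>v. norm v \<le> 1 \<and> onorm (f i) - e' \<le> f i v"
      using onorm_almost_attained f_bl by metis
    then obtain v where v: "\<And>i. i \<in> I \<Longrightarrow> norm (v i) \<le> 1" "\<And>i. i \<in> I \<Longrightarrow> onorm (f i) - e' \<le> f i (v i)"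
      by metis
    have "(\<Sum>i\<in>I. s i * (onorm (f i) - e')) \<le> (\<Sum>i\<in>I. s i * f i (v i))"
      using v(2) s by (intro sum_mono mult_left_mono) (auto intro: less_imp_le)
    also have "\<dots> = F (\<lambda>i. s i *\<^sub>R v i)"
      unfolding F_eq by (rule sum.cong) (auto dest!: f_bl simp: linear_scale[OF bounded_linear.linear])
    also have "\<dots> \<le> 1"
    proof (rule order_trans[OF F_le_N N_le])
      fix i assume i: "i \<in> I"
      show "norm (s i *\<^sub>R v i) / s i \<le> 1" using v(1)[OF i] s[OF i] by simp
    qed
    finally have "(\<Sum>i\<in>I. s i * onorm (f i)) - (\<Sum>i\<in>I. s i) * e' \<le> 1"
      by (simp add: right_diff_distrib sum_subtractf sum_distrib_right)
    then show "(\<Sum>i\<in>I. s i * onorm (f i)) \<le> 1 + e" using s_pos by (simp add: e'_def)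
  qed
  moreover have "1 \<le> F w"
    unfolding F(3)
  proof (rule p_ge)
    fix d assume "d \<in> D"
    then obtain i where i: "i \<in> I" "s i \<le> norm (w i - d i)" using far by blast
    then have "1 \<le> norm ((w - d) i) / s i" using s[OF i(1)] by simp
    with le_N[OF i(1), of "w - d"] show "1 \<le> N (w - d)" by linarith
  qed
  ultimately show thesis
    using that[of f] f_bl F_D unfolding F_eq by blast
qed

text \<open>\<open>Q\<close> is the projection for \<open>J1\<close> in the whole space. The
  projection for \<open>J2\<close> survives only in \<open>Q_restrict\<close>: if \<open>f\<close>
  kills \<open>J2\<close>, that projection fixes the restriction of \<open>f\<close> to
  \<open>X2\<close>, and by commutation \<open>Q f\<close> and \<open>f\<close> agree on
  \<open>X2\<close>.\<close>

locale simultaneous_L_projection =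
  fixes X2 J1 J2 :: "'a::banach set" and Q :: "('a \<Rightarrow> real) \<Rightarrow> ('a \<Rightarrow> real)"
  assumes subspace_X2: "subspace X2" and closed_X2: "closed X2"
    and subspace_J1: "subspace J1" and closed_J1: "closed J1"
    and subspace_J2: "subspace J2" and J2_le_J1: "J2 \<subseteq> J1" and J2_le_X2: "J2 \<subseteq> X2"
    and Q_linear: "linear_map_on (Collect bounded_linear) (Collect bounded_linear) Q"
    and Q_annihilates: "bounded_linear f \<Longrightarrow> x \<in> J1 \<Longrightarrow> Q f x = 0"
    and Q_fixes: "bounded_linear f \<Longrightarrow> (\<And>x. x \<in> J1 \<Longrightarrow> f x = 0) \<Longrightarrow> Q f = f"
    and Q_norm: "bounded_linear f \<Longrightarrow> onorm f = onorm (Q f) + onorm (f - Q f)"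
    and Q_restrict: "bounded_linear f \<Longrightarrow> (\<And>x. x \<in> J2 \<Longrightarrow> f x = 0) \<Longrightarrow> x \<in> X2 \<Longrightarrow> Q f x = f x"
begin

definition ker_Q :: "('a \<Rightarrow> real) set" where
  "ker_Q = {f. bounded_linear f \<and> Q f = 0}"

lemma Q_bounded_linear: "bounded_linear f \<Longrightarrow> bounded_linear (Q f)"
  using linear_map_on_imageI[OF Q_linear] by blast

lemma bounded_linear_minus_Q: "bounded_linear f \<Longrightarrow> bounded_linear (f - Q f)"
  using subspace_diff[OF subspace_bounded_linear, of f "Q f"] Q_bounded_linear by simp

lemma minus_Q_in_ker_Q:
  assumes f: "bounded_linear f"
  shows "f - Q f \<in> ker_Q"
proof -
  have "Q (Q f) = Q f"
    using Q_fixes[OF Q_bounded_linear[OF f]] Q_annihilates[OF f] by blast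
  then show ?thesis
    using bounded_linear_minus_Q[OF f] linear_map_on_diff[OF subspace_bounded_linear Q_linear, of f "Q f"]
      f Q_bounded_linear[OF f]
    by (simp add: ker_Q_def)
qed

lemma subspace_ker_Q: "subspace ker_Q"
proof -
  have "Q 0 = 0"
    using linear_map_on_scale[OF Q_linear, of 0 0] subspace_0[OF subspace_bounded_linear] by simp
  then show ?thesis
    using subspace_bounded_linear linear_map_on_add[OF Q_linear] linear_map_on_scale[OF Q_linear]
    by (auto simp: ker_Q_def subspace_def)
qed

text \<open>The indices \<open>k\<close> stand for basis vectors with uncorrected lifts
  \<open>A k\<close>, the indices \<open>i\<close> for norm constraints on combinations with
  coefficients \<open>a i k\<close>. The hypothesis \<open>ker\<close> is the constraint as seen by
  \<open>ker_Q\<close>, with the comparison values \<open>c k\<close> in place of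
  \<open>A k\<close>; \<open>ann\<close> is the constraint as seen by the annihilator, where
  corrections are invisible. If no correction works, a separating tuple is split by
  \<open>Q\<close>. On its \<open>ker_Q\<close> part, \<open>A k\<close> can be exchanged for
  \<open>c k\<close>, and then both bounds apply, with norms that add up to
  \<open>onorm (f i)\<close>.\<close>

lemma separated_correction:
  fixes a :: "'i \<Rightarrow> 'k \<Rightarrow> real"
  assumes I: "finite I" and K: "finite K" and e: "0 < e"
    and A: "\<And>k. k \<in> K2 \<Longrightarrow> A k \<in> X2"
    and c: "\<And>k. k \<in> K \<Longrightarrow> linear_map_on ker_Q UNIV (c k)"
    and c_K2: "\<And>k f. k \<in> K \<inter> K2 \<Longrightarrow> f \<in> ker_Q \<Longrightarrow> (\<And>x. x \<in> X2 \<Longrightarrow> f x = 0) \<Longrightarrow> c k f = 0"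
    and r: "\<And>i. i \<in> I \<Longrightarrow> 0 \<le> r i"
    and ker: "\<And>i f. i \<in> I \<Longrightarrow> f \<in> ker_Q \<Longrightarrow> \<bar>(\<Sum>k\<in>K. a i k * c k f) - f (b i)\<bar> \<le> r i * onorm f"
    and ann: "\<And>i f. i \<in> I \<Longrightarrow> bounded_linear f \<Longrightarrow> (\<And>x. x \<in> J1 \<Longrightarrow> f x = 0) \<Longrightarrow>
      \<bar>f ((\<Sum>k\<in>K. a i k *\<^sub>R A k) - b i)\<bar> \<le> r i * onorm f"
  obtains j where "\<And>k. j k \<in> J1" "\<And>k. k \<in> K2 \<Longrightarrow> j k \<in> J2"
    "\<And>i. i \<in> I \<Longrightarrow> norm ((\<Sum>k\<in>K. a i k *\<^sub>R (A k - j k)) - b i) \<le> r i + e"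
proof (rule ccontr)
  note solution = that
  assume contra: "\<not> thesis"
  define J where "J k = (if k \<in> K2 then J2 else J1)" for k
  have J: "subspace (J k)" for k using subspace_J1 subspace_J2 by (simp add: J_def)
  define \<Gamma> where "\<Gamma> j = (\<lambda>i. \<Sum>k\<in>K. a i k *\<^sub>R j k)" for j :: "_ \<Rightarrow> 'a"
  define D where "D = \<Gamma> ` {j. \<forall>k. j k \<in> J k}"
  define w where "w i = (\<Sum>k\<in>K. a i k *\<^sub>R A k) - b i" for i
  have "linear \<Gamma>"
    by (rule linearI)
      (auto simp: \<Gamma>_def fun_eq_iff scaleR_fun_def scaleR_add_right sum.distrib scaleR_sum_right mult.commute)
  moreover have "subspace {j. \<forall>k. j k \<in> J k}"
    using J by (auto simp: subspace_def scaleR_fun_def)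
  ultimately have D: "subspace D" unfolding D_def by (rule linear_subspace_image)
  have far: "\<exists>i\<in>I. r i + e \<le> norm (w i - d i)" if d: "d \<in> D" for d
  proof (rule ccontr)
    assume near: "\<not> ?thesis"
    obtain j where j: "\<And>k. j k \<in> J k" "d = \<Gamma> j" using d by (auto simp: D_def)
    have "(\<Sum>k\<in>K. a i k *\<^sub>R (A k - j k)) - b i = w i - d i" for i
      by (simp add: w_def j(2) \<Gamma>_def scaleR_diff_right sum_subtractf)
    then have "norm ((\<Sum>k\<in>K. a i k *\<^sub>R (A k - j k)) - b i) \<le> r i + e" if "i \<in> I" for i
      using near that by force
    moreover have "j k \<in> J1" "k \<in> K2 \<Longrightarrow> j k \<in> J2" for k
      using j(1)[of k] J2_le_J1 by (auto simp: J_def split: if_splits)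
    ultimately show False using contra solution by blast
  qed
  have pos: "0 < r i + e" if "i \<in> I" for i using r[OF that] e by simp
  obtain f :: "'i \<Rightarrow> 'a \<Rightarrow> real" where f: "\<And>i. i \<in> I \<Longrightarrow> bounded_linear (f i)"
    and f_norm: "(\<Sum>i\<in>I. (r i + e) * onorm (f i)) \<le> 1"
    and f_D: "\<And>d. d \<in> D \<Longrightarrow> (\<Sum>i\<in>I. f i (d i)) = 0"
    and f_w: "1 \<le> (\<Sum>i\<in>I. f i (w i))"
    using tuple_separation[of I D "\<lambda>i. r i + e" w, OF I D pos far] by metis
  define h where "h i = f i - Q (f i)" for i
  have h: "h i \<in> ker_Q" if "i \<in> I" for i
    unfolding h_def using f[OF that] by (rule minus_Q_in_ker_Q)
  \<comment> \<open>The functional that the separating tuple induces on the \<open>k\<close>-th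
    correction. It kills the allowed corrections because the tuple vanishes on
    \<open>D\<close>.\<close>
  define g where "g k = (\<Sum>i\<in>I. a i k *\<^sub>R f i)" for k
  have g: "bounded_linear (g k)" for k
    using subspace_sum[OF subspace_bounded_linear, of I "\<lambda>i. a i k *\<^sub>R f i"]
      subspace_scale[OF subspace_bounded_linear] f by (auto simp: g_def)
  have g_J: "g k x = 0" if k: "k \<in> K" and x: "x \<in> J k" for k x
  proof -
    define j where "j k' = (if k' = k then x else 0)" for k'
    have "\<Gamma> j \<in> D"
      unfolding D_def using x subspace_0[OF J] by (auto simp: j_def)
    moreover have "\<Gamma> j i = a i k *\<^sub>R x" for i
      using k K by (simp add: \<Gamma>_def j_def if_distrib[of "scaleR _"] sum.delta cong: if_cong)
    ultimately have "(\<Sum>i\<in>I. f i (a i k *\<^sub>R x)) = 0" using f_D[of "\<Gamma> j"] by simp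
    moreover have "f i (a i k *\<^sub>R x) = a i k * f i x" if "i \<in> I" for i
      using linear_scale[OF bounded_linear.linear[OF f[OF that]]] by simp
    ultimately show ?thesis by (simp add: g_def sum_fun_apply scaleR_fun_def)
  qed
  define hk where "hk k = (\<Sum>i\<in>I. a i k *\<^sub>R h i)" for k
  have hk_eq: "hk k = g k - Q (g k)" for k
  proof -
    have "Q (g k) = (\<Sum>i\<in>I. a i k *\<^sub>R Q (f i))"
      unfolding g_def using f by (intro linear_map_on_sum[OF subspace_bounded_linear Q_linear]) auto
    then show ?thesis by (simp add: hk_def h_def g_def scaleR_diff_right sum_subtractf)
  qed
  have hk: "hk k \<in> ker_Q" for k
    unfolding hk_def using h by (intro subspace_sum[OF subspace_ker_Q] subspace_scale[OF subspace_ker_Q])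
  \<comment> \<open>This permits the exchange of \<open>A k\<close> for \<open>c k\<close>. For
    \<open>k\<close> outside \<open>K2\<close>, \<open>g k\<close> kills \<open>J1\<close> and its
    \<open>ker_Q\<close> part is 0. For \<open>k\<close> in \<open>K2\<close>, it kills only
    \<open>J2\<close>; its \<open>ker_Q\<close> part still vanishes on \<open>X2\<close>, which
    contains \<open>A k\<close> and to which \<open>c k\<close> is adapted.\<close>
  have hk_0: "hk k (A k) = 0 \<and> c k (hk k) = 0" if k: "k \<in> K" for k
  proof (cases "k \<in> K2")
    case True
    then have "hk k x = 0" if "x \<in> X2" for x
      using Q_restrict[OF g[of k] _ that] g_J[OF k] by (simp add: hk_eq J_def)
    then show ?thesis using c_K2[of k, OF _ hk] k True A[OF True] by blast
  next
    case False
    then have "Q (g k) = g k" using g_J[OF k] by (intro Q_fixes g) (simp add: J_def)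
    then have hk0: "hk k = 0" by (simp add: hk_eq)
    have "c k 0 = 0"
      using linear_map_on_scale[OF c[OF k] subspace_0[OF subspace_ker_Q], of 0] by simp
    with hk0 show ?thesis by simp
  qed
  have "(\<Sum>i\<in>I. h i (\<Sum>k\<in>K. a i k *\<^sub>R A k)) = (\<Sum>i\<in>I. \<Sum>k\<in>K. a i k * h i (A k))"
  proof (rule sum.cong[OF refl])
    fix i assume "i \<in> I"
    then interpret hi: bounded_linear "h i" using h by (simp add: ker_Q_def)
    show "h i (\<Sum>k\<in>K. a i k *\<^sub>R A k) = (\<Sum>k\<in>K. a i k * h i (A k))"
      by (simp add: hi.sum hi.scaleR)
  qed
  also have "\<dots> = (\<Sum>k\<in>K. hk k (A k))"
    by (subst sum.swap) (simp add: hk_def sum_fun_apply scaleR_fun_def)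
  also have "\<dots> = (\<Sum>k\<in>K. c k (hk k))" using hk_0 by simp
  also have "\<dots> = (\<Sum>k\<in>K. \<Sum>i\<in>I. a i k * c k (h i))"
    unfolding hk_def using h
    by (intro sum.cong refl linear_map_on_sum[OF subspace_ker_Q c, unfolded real_scaleR_def])
  also have "\<dots> = (\<Sum>i\<in>I. \<Sum>k\<in>K. a i k * c k (h i))" by (rule sum.swap)
  finally have h_A: "(\<Sum>i\<in>I. h i (\<Sum>k\<in>K. a i k *\<^sub>R A k)) = (\<Sum>i\<in>I. \<Sum>k\<in>K. a i k * c k (h i))" .
  have "(\<Sum>i\<in>I. f i (w i)) = (\<Sum>i\<in>I. Q (f i) (w i)) + (\<Sum>i\<in>I. h i (w i))"
    by (simp add: h_def sum_subtractf)
  also have "(\<Sum>i\<in>I. h i (w i)) = (\<Sum>i\<in>I. h i (\<Sum>k\<in>K. a i k *\<^sub>R A k)) - (\<Sum>i\<in>I. h i (b i))"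
    unfolding sum_subtractf[symmetric]
    by (rule sum.cong) (use h in \<open>auto simp: ker_Q_def w_def linear_diff[OF bounded_linear.linear]\<close>)
  also have "\<dots> = (\<Sum>i\<in>I. (\<Sum>k\<in>K. a i k * c k (h i)) - h i (b i))"
    by (simp add: h_A sum_subtractf)
  also have "\<dots> \<le> (\<Sum>i\<in>I. r i * onorm (h i))"
    using ker h by (intro sum_mono) (meson abs_ge_self order_trans)
  also have "(\<Sum>i\<in>I. Q (f i) (w i)) \<le> (\<Sum>i\<in>I. r i * onorm (Q (f i)))"
  proof (rule sum_mono)
    fix i assume i: "i \<in> I"
    have "\<bar>Q (f i) (w i)\<bar> \<le> r i * onorm (Q (f i))"
      unfolding w_def using Q_bounded_linear[OF f[OF i]] Q_annihilates[OF f[OF i]] by (rule ann[OF i])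
    then show "Q (f i) (w i) \<le> r i * onorm (Q (f i))" by simp
  qed
  finally have "(\<Sum>i\<in>I. f i (w i)) \<le> (\<Sum>i\<in>I. r i * onorm (Q (f i))) + (\<Sum>i\<in>I. r i * onorm (h i))"
    by simp
  also have "\<dots> = (\<Sum>i\<in>I. r i * onorm (f i))"
    unfolding sum.distrib[symmetric]
    by (rule sum.cong) (use Q_norm f in \<open>auto simp: h_def distrib_left\<close>)
  finally have le: "1 \<le> (\<Sum>i\<in>I. r i * onorm (f i))" using f_w by simp
  \<comment> \<open>The slack \<open>e\<close> in the violated constraints is what contradicts the
    estimate just obtained: all norms have to be 0, while the sum of the
    \<open>r i * onorm (f i)\<close> is at least 1.\<close>
  moreover have "(\<Sum>i\<in>I. r i * onorm (f i)) + e * (\<Sum>i\<in>I. onorm (f i)) \<le> 1"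
    using f_norm by (simp add: distrib_right sum.distrib sum_distrib_left)
  moreover have onorm_nonneg: "0 \<le> onorm (f i)" if "i \<in> I" for i
    using f[OF that] by (rule onorm_pos_le)
  ultimately have "e * (\<Sum>i\<in>I. onorm (f i)) \<le> 0" by linarith
  then have "(\<Sum>i\<in>I. onorm (f i)) \<le> 0" using e by (simp add: mult_le_0_iff)
  then have "(\<Sum>i\<in>I. onorm (f i)) = 0" using sum_nonneg[of I "\<lambda>i. onorm (f i)"] onorm_nonneg by force
  then have "onorm (f i) = 0" if "i \<in> I" for i
    using sum_nonneg_eq_0_iff[OF I] onorm_nonneg that by metis
  with le show False by simp
qed

end

subsection \<open>Limits of partially defined operators\<close>

text \<open>A countable dense set may miss \<open>W\<close> altogether. For each of its points
  \<open>z\<close> and each \<open>n\<close>, a point of \<open>W\<close> at distance below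
  \<open>1 / (n + 1)\<close> from \<open>z\<close> is added if there is one.\<close>

lemma dense_sequence_adapted:
  fixes W :: "'b::real_normed_vector set"
  assumes sep: "separable_space (euclidean :: 'b topology)"
  obtains u :: "nat \<Rightarrow> 'b" where "closure (range u) = UNIV" "W \<subseteq> closure (range u \<inter> W)"
proof -
  obtain C :: "'b set" where C: "countable C" "closure C = UNIV"
    using sep by (auto simp: separable_space_def)
  define g where "g z n = (SOME w. w \<in> W \<and> dist z w < inverse (real (Suc n)))" for z and n :: nat
  define P where "P = {(z, n). z \<in> C \<and> (\<exists>w. w \<in> W \<and> dist z w < inverse (real (Suc n)))}"
  define S where "S = C \<union> (\<lambda>(z, n). g z n) ` P"
  have g: "g z n \<in> W" "dist z (g z n) < inverse (real (Suc n))" if "(z, n) \<in> P" for z n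
    using that someI_ex[of "\<lambda>w. w \<in> W \<and> dist z w < inverse (real (Suc n))"]
    by (auto simp: P_def g_def)
  have "P \<subseteq> C \<times> UNIV" by (auto simp: P_def)
  then have "countable S" using C(1) countable_subset[of P "C \<times> UNIV"] by (auto simp: S_def)
  moreover have "S \<noteq> {}" using C(2) by (auto simp: S_def)
  ultimately have range: "range (from_nat_into S) = S" by (rule range_from_nat_into[rotated])
  show thesis
  proof (rule that[of "from_nat_into S"])
    show "closure (range (from_nat_into S)) = UNIV"
      unfolding range using C(2) closure_mono[of C S] by (auto simp: S_def)
    show "W \<subseteq> closure (range (from_nat_into S) \<inter> W)"
      unfolding range
    proof
      fix w assume w: "w \<in> W"
      show "w \<in> closure (S \<inter> W)"
        unfolding closure_approachable
      proof (intro allI impI)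
        fix e :: real assume "0 < e"
        then obtain n :: nat where n: "inverse (real (Suc n)) < e / 2"
          using reals_Archimedean[of "e / 2"] by auto
        obtain z where z: "z \<in> C" "dist z w < inverse (real (Suc n))"
          using C(2) closure_approachable[of w C] by (metis UNIV_I inverse_positive_iff_positive of_nat_0_less_iff zero_less_Suc)
        then have zn: "(z, n) \<in> P" using w by (auto simp: P_def)
        then have "g z n \<in> S \<inter> W" using g(1) by (force simp: S_def)
        moreover have "dist (g z n) w < e"
          using dist_triangle[of "g z n" w z] g(2)[OF zn] z(2) n by (simp add: dist_commute)
        ultimately show "\<exists>y\<in>S \<inter> W. dist y w < e" by blast
      qed
    qed
  qed
qed

lemma approximating_sequence:
  fixes E :: "nat \<Rightarrow> 'b::metric_space set"
  assumes ne: "\<And>n. E n \<noteq> {}" and inc: "incseq E" and y: "y \<in> closure (\<Union>n. E n)"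
  obtains a where "\<And>n. a n \<in> E n" "a \<longlonglongrightarrow> y"
proof -
  have "\<exists>z\<in>E n. dist y z < infdist y (E n) + inverse (real (Suc n))" for n
  proof -
    have "(INF z\<in>E n. dist y z) < infdist y (E n) + inverse (real (Suc n))"
      by (simp add: infdist_notempty[OF ne])
    from cInf_lessD[OF _ this] ne show ?thesis by auto
  qed
  then obtain a where a: "\<And>n. a n \<in> E n" "\<And>n. dist y (a n) < infdist y (E n) + inverse (real (Suc n))"
    by metis
  have "a \<longlonglongrightarrow> y"
    unfolding LIMSEQ_iff_nz
  proof (intro allI impI)
    fix e :: real assume e: "0 < e"
    then obtain d where "d \<in> (\<Union>n. E n)" "dist d y < e / 2"
      using y closure_approachable[of y] by (metis half_gt_zero)
    then obtain N where N: "d \<in> E N" by blast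
    obtain M :: nat where M: "inverse (real (Suc M)) < e / 2"
      using reals_Archimedean[of "e / 2"] e by auto
    have "dist (a n) y < e" if n: "max (Suc M) N \<le> n" for n
    proof -
      have "d \<in> E n" using N incseqD[OF inc, of N n] n by auto
      then have "infdist y (E n) < e / 2"
        using infdist_le[of d "E n" y] \<open>dist d y < e / 2\<close> by (simp add: dist_commute)
      moreover have "inverse (real (Suc n)) \<le> inverse (real (Suc M))"
        using n by (intro le_imp_inverse_le) auto
      ultimately show ?thesis using a(2)[of n] M by (subst dist_commute) linarith
    qed
    then show "\<exists>no>0. \<forall>n\<ge>no. dist (a n) y < e" by (intro exI[of _ "max (Suc M) N"]) auto
  qed
  with a(1) show thesis by (rule that)
qed

lemma Cauchy_if_near_Cauchy:
  fixes x :: "nat \<Rightarrow> 'a::metric_space"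
  assumes "\<And>e. 0 < e \<Longrightarrow> \<exists>w. Cauchy w \<and> (\<forall>\<^sub>F n in sequentially. dist (x n) (w n) < e)"
  shows "Cauchy x"
  unfolding Cauchy_altdef2
proof (intro allI impI)
  fix e :: real assume "0 < e"
  then obtain w N1 where w: "Cauchy w" and N1: "\<And>n. N1 \<le> n \<Longrightarrow> dist (x n) (w n) < e / 3"
    using assms[of "e / 3"] by (auto simp: eventually_sequentially)
  obtain N2 where N2: "\<And>m n. N2 \<le> m \<Longrightarrow> N2 \<le> n \<Longrightarrow> dist (w m) (w n) < e / 3"
    using w \<open>0 < e\<close> unfolding Cauchy_def by (meson divide_pos_pos zero_less_numeral)
  have "dist (x n) (x (max N1 N2)) < e" if "max N1 N2 \<le> n" for n
  proof -
    have "dist (x n) (x (max N1 N2)) \<le> dist (x n) (w n) + dist (w n) (w (max N1 N2)) + dist (w (max N1 N2)) (x (max N1 N2))"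
      by (metis add.assoc add_left_mono dist_triangle order_trans)
    then show ?thesis
      using N1[of n] N1[of "max N1 N2"] N2[of n "max N1 N2"] that by (simp add: dist_commute)
  qed
  then show "\<exists>N. \<forall>n\<ge>N. dist (x n) (x N) < e" by blast
qed

lemma convergent_if_geometric_increments:
  fixes x :: "nat \<Rightarrow> 'a::banach"
  assumes "\<forall>\<^sub>F n in sequentially. norm (x (Suc n) - x n) \<le> C * (1 / 2) ^ n"
  shows "convergent x"
proof -
  have "summable (\<lambda>n. C * (1 / 2 :: real) ^ n)" by (intro summable_mult summable_geometric) simp
  then have "summable (\<lambda>n. x (Suc n) - x n)"
    by (rule summable_comparison_test_ev[OF assms])
  then have "convergent (\<lambda>n. \<Sum>k<n. x (Suc k) - x k)" by (simp add: summable_iff_convergent)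
  then have "convergent (\<lambda>n. (\<Sum>k<n. x (Suc k) - x k) + x 0)"
    by (rule convergent_add[OF _ convergent_const])
  then show ?thesis by (simp add: sum_lessThan_telescope)
qed

text \<open>The operators are uniformly bounded only on their own domains \<open>E n\<close>. Hence
  the limit at \<open>y\<close> is taken along points of \<open>E n\<close> that tend to
  \<open>y\<close>; pointwise convergence on \<open>D\<close> and the uniform bound make the values
  Cauchy.\<close>

lemma limit_of_partial_operators:
  fixes L :: "nat \<Rightarrow> 'b::real_normed_vector \<Rightarrow> 'a::banach"
  assumes E: "\<And>n. subspace (E n)" "incseq E" and D: "closure D = UNIV" "D \<subseteq> (\<Union>n. E n)"
    and L: "\<And>n. linear (L n)" "\<And>n z. z \<in> E n \<Longrightarrow> norm (L n z) \<le> (lam + \<delta> n) * norm z"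
    and \<delta>: "\<delta> \<longlonglongrightarrow> 0" and lam: "0 \<le> lam" and conv: "\<And>d. d \<in> D \<Longrightarrow> convergent (\<lambda>n. L n d)"
  obtains M where "bounded_linear M" "onorm M \<le> lam" "\<And>d. d \<in> D \<Longrightarrow> (\<lambda>n. L n d) \<longlonglongrightarrow> M d"
proof -
  have "(\<lambda>n. lam + \<delta> n) \<longlonglongrightarrow> lam + 0" by (intro tendsto_intros \<delta>)
  then have lim_norm: "(\<lambda>n. lam + \<delta> n) \<longlonglongrightarrow> lam" by simp
  then have "Bseq (\<lambda>n. lam + \<delta> n)" by (metis convergentI convergent_imp_Bseq)
  then obtain C where C: "0 < C" "\<And>n. \<bar>lam + \<delta> n\<bar> \<le> C" by (auto simp: Bseq_def)
  have L_le: "norm (L n z) \<le> C * norm z" if "z \<in> E n" for n z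
  proof -
    have "(lam + \<delta> n) * norm z \<le> C * norm z"
      using C(2)[of n] by (intro mult_right_mono) auto
    with L(2)[OF that] show ?thesis by linarith
  qed
  have D_ev: "\<forall>\<^sub>F n in sequentially. d \<in> E n" if d: "d \<in> D" for d
  proof -
    obtain N where "d \<in> E N" using d D(2) by blast
    then show ?thesis
      unfolding eventually_sequentially using incseqD[OF E(2)] by blast
  qed
  have E_dense: "y \<in> closure (\<Union>n. E n)" for y using D closure_mono[OF D(2)] by blast
  have E_ne: "E n \<noteq> {}" for n using subspace_0[OF E(1)] by blast
  \<comment> \<open>The point \<open>y\<close> itself may lie in no \<open>E n\<close>, and there
    \<open>L n y\<close> is uncontrolled.\<close>
  have "\<exists>a. (\<forall>n. a n \<in> E n) \<and> a \<longlonglongrightarrow> y" for y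
    using approximating_sequence[OF E_ne E(2) E_dense] by metis
  then obtain a where a: "\<And>y n. a y n \<in> E n" "\<And>y. a y \<longlonglongrightarrow> y" by metis
  have Cauchy: "Cauchy (\<lambda>n. L n (a y n))" for y
  proof (rule Cauchy_if_near_Cauchy)
    fix e :: real assume e: "0 < e"
    then have e': "0 < e / (2 * C)" using C(1) by simp
    then obtain d where d: "d \<in> D" "dist d y < e / (2 * C)"
      using D(1) closure_approachable[of y D] by auto
    have "\<forall>\<^sub>F n in sequentially. dist (a y n) y < e / (2 * C)"
      using a(2) e' by (rule tendstoD)
    then have "\<forall>\<^sub>F n in sequentially. dist (L n (a y n)) (L n d) < e"
      using D_ev[OF d(1)]
    proof eventually_elim
      case (elim n)
      have "dist (a y n) d < e / (2 * C) + e / (2 * C)"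
        using elim(1) d(2) dist_triangle2[of "a y n" d y] by linarith
      then have "C * norm (a y n - d) < e" using C(1) by (simp add: dist_norm field_simps)
      moreover have "norm (L n (a y n - d)) \<le> C * norm (a y n - d)"
        using a(1) elim(2) by (intro L_le subspace_diff[OF E(1)])
      ultimately show ?case by (simp add: dist_norm linear_diff[OF L(1)])
    qed
    with conv[OF d(1)] show "\<exists>w. Cauchy w \<and> (\<forall>\<^sub>F n in sequentially. dist (L n (a y n)) (w n) < e)"
      by (metis convergent_Cauchy)
  qed
  define M where "M y = lim (\<lambda>n. L n (a y n))" for y
  have M0: "(\<lambda>n. L n (a y n)) \<longlonglongrightarrow> M y" for y
    unfolding M_def using Cauchy[of y] by (simp add: Cauchy_convergent_iff convergent_LIMSEQ_iff)
  \<comment> \<open>Independence of the approximating sequence; linearity of \<open>M\<close>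
    follows, as sums and multiples of such sequences are again admissible.\<close>
  have M: "(\<lambda>n. L n (z n)) \<longlonglongrightarrow> M y" if z: "\<And>n. z n \<in> E n" "z \<longlonglongrightarrow> y" for z y
  proof -
    have "(\<lambda>n. z n - a y n) \<longlonglongrightarrow> y - y" by (intro tendsto_diff z(2) a(2))
    then have lim: "(\<lambda>n. C * norm (z n - a y n)) \<longlonglongrightarrow> 0"
      by (simp add: tendsto_norm_zero tendsto_mult_right_zero)
    have le: "norm (L n (z n) - L n (a y n)) \<le> C * norm (z n - a y n)" for n
      using L_le[OF subspace_diff[OF E(1) z(1) a(1)], of n y] by (simp add: linear_diff[OF L(1)])
    have "(\<lambda>n. L n (z n) - L n (a y n)) \<longlonglongrightarrow> 0"
      by (rule Lim_null_comparison[OF always_eventually lim]) (intro allI le)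
    from tendsto_add[OF this M0[of y]] show ?thesis by simp
  qed
  show thesis
  proof (rule that[of M])
    have M_norm: "norm (M y) \<le> lam * norm y" for y
    proof (rule LIMSEQ_le)
      show "(\<lambda>n. norm (L n (a y n))) \<longlonglongrightarrow> norm (M y)" by (intro tendsto_norm M0)
      show "(\<lambda>n. (lam + \<delta> n) * norm (a y n)) \<longlonglongrightarrow> lam * norm y"
        by (intro tendsto_mult lim_norm tendsto_norm a(2))
      show "\<exists>N. \<forall>n\<ge>N. norm (L n (a y n)) \<le> (lam + \<delta> n) * norm (a y n)"
        by (intro exI allI impI L(2) a(1))
    qed
    show "bounded_linear M"
    proof (rule bounded_linear_intro[of _ lam])
      fix y y' and c :: real
      have "(\<lambda>n. L n (a y n + a y' n)) \<longlonglongrightarrow> M (y + y')"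
        by (intro M tendsto_add a subspace_add[OF E(1)])
      moreover have "(\<lambda>n. L n (a y n + a y' n)) \<longlonglongrightarrow> M y + M y'"
        using tendsto_add[OF M0[of y] M0[of y']] by (simp add: linear_add[OF L(1)])
      ultimately show "M (y + y') = M y + M y'" by (rule LIMSEQ_unique)
      have "(\<lambda>n. L n (c *\<^sub>R a y n)) \<longlonglongrightarrow> M (c *\<^sub>R y)"
        by (intro M tendsto_scaleR tendsto_const a subspace_scale[OF E(1)])
      moreover have "(\<lambda>n. L n (c *\<^sub>R a y n)) \<longlonglongrightarrow> c *\<^sub>R M y"
        using tendsto_scaleR[OF tendsto_const M0[of y]] by (simp add: linear_scale[OF L(1)])
      ultimately show "M (c *\<^sub>R y) = c *\<^sub>R M y" by (rule LIMSEQ_unique)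
    qed (use M_norm in \<open>simp add: mult.commute\<close>)
    show "onorm M \<le> lam" using M_norm lam by (intro onorm_bound)
    fix d assume d: "d \<in> D"
    define z where "z n = (if d \<in> E n then d else 0)" for n
    have ev: "\<forall>\<^sub>F n in sequentially. z n = d"
      using D_ev[OF d] by eventually_elim (simp add: z_def)
    have "(\<lambda>n. L n (z n)) \<longlonglongrightarrow> M d"
    proof (rule M)
      show "z n \<in> E n" for n using subspace_0[OF E(1)] by (simp add: z_def)
      show "z \<longlonglongrightarrow> d" using ev by (rule tendsto_eventually)
    qed
    moreover have "\<forall>\<^sub>F n in sequentially. L n (z n) = L n d"
      using ev by (rule eventually_mono) simp
    ultimately show "(\<lambda>n. L n d) \<longlonglongrightarrow> M d" by (rule Lim_transform_eventually)
  qed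
qed

subsection \<open>Approximate liftings\<close>

text \<open>Cosets are sets, so \<open>x \<in> T y\<close> says that the quotient map sends \<open>x\<close> to \<open>T y\<close>.\<close>

locale lifting_problem = simultaneous_L_projection X2 J1 J2 Q
  for X2 J1 J2 :: "'a::banach set" and Q +
  fixes Y2 :: "'b::banach set" and T :: "'b \<Rightarrow> 'a set"
  assumes subspace_Y2: "subspace Y2" and closed_Y2: "closed Y2"
    and T_add: "x \<in> T y \<Longrightarrow> x' \<in> T y' \<Longrightarrow> x + x' \<in> T (y + y')"
    and T_scale: "x \<in> T y \<Longrightarrow> c *\<^sub>R x \<in> T (c *\<^sub>R y)"
    and T_zero: "T 0 = J1"
    and T_nonempty: "\<exists>x. x \<in> T y"
    and T_Y2: "y \<in> Y2 \<Longrightarrow> \<exists>x\<in>X2. x \<in> T y"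
    and T_norm: "x \<in> T y \<Longrightarrow> 0 < e \<Longrightarrow> \<exists>j\<in>J1. norm (x + j) \<le> norm y + e"
begin

lemma T_diff: "x \<in> T y \<Longrightarrow> x' \<in> T y' \<Longrightarrow> x - x' \<in> T (y - y')"
  using T_add[of x y "(- 1) *\<^sub>R x'" "(- 1) *\<^sub>R y'"] T_scale[of x' y' "- 1"] by simp

text \<open>Such an \<open>f\<close> factors through the quotient by \<open>J1\<close>, so the norm
  of the coset \<open>T y\<close> counts, not that of its representative \<open>x\<close>.\<close>

lemma T_annihilator:
  assumes f: "bounded_linear f" "\<And>x. x \<in> J1 \<Longrightarrow> f x = 0" and x: "x \<in> T y"
  shows "\<bar>f x :: real\<bar> \<le> onorm f * norm y"
proof (rule field_le_epsilon)
  fix e :: real assume e: "0 < e"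
  have o: "0 \<le> onorm f" using f(1) by (rule onorm_pos_le)
  \<comment> \<open>The summand 1 keeps the denominator positive when \<open>f\<close> is 0.\<close>
  then obtain j where j: "j \<in> J1" "norm (x + j) \<le> norm y + e / (onorm f + 1)"
    using T_norm[OF x, of "e / (onorm f + 1)"] e by auto
  have "\<bar>f x\<bar> = norm (f (x + j))"
    using f(2)[OF j(1)] by (simp add: linear_add[OF bounded_linear.linear[OF f(1)]])
  also have "\<dots> \<le> onorm f * norm (x + j)" using f(1) by (rule onorm)
  also have "\<dots> \<le> onorm f * (norm y + e / (onorm f + 1))" using j(2) o by (rule mult_left_mono)
  also have "\<dots> \<le> onorm f * norm y + e"
    using o e by (simp add: distrib_left divide_simps) (simp add: algebra_simps)
  finally show "\<bar>f x\<bar> \<le> onorm f * norm y + e" .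
qed

text \<open>The coset of \<open>x n - x'\<close> has norm at most \<open>norm (u n - y)\<close>, so
  elements of \<open>J1\<close> approach \<open>x0 - x'\<close>. The arguments \<open>u n\<close>
  vary because the approximate lifts may lift \<open>T\<close> composed with approximations of the
  identity.\<close>

lemma T_closed:
  assumes T: "\<forall>\<^sub>F n in sequentially. x n \<in> T (u n)" and x: "x \<longlonglongrightarrow> x0" and u: "u \<longlonglongrightarrow> y"
  shows "x0 \<in> T y"
proof -
  obtain x' where x': "x' \<in> T y" using T_nonempty by blast
  have "x0 - x' \<in> closure J1"
    unfolding closure_approachable
  proof (intro allI impI)
    fix e :: real assume e: "0 < e"
    have "\<forall>\<^sub>F n in sequentially. dist (x n) x0 < e / 4" "\<forall>\<^sub>F n in sequentially. dist (u n) y < e / 4"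
      using tendstoD[OF x, of "e / 4"] tendstoD[OF u, of "e / 4"] e by auto
    with T have "\<forall>\<^sub>F n in sequentially. \<exists>j\<in>J1. dist j (x0 - x') < e"
    proof eventually_elim
      case (elim n)
      obtain j where j: "j \<in> J1" "norm (x n - x' + j) \<le> norm (u n - y) + e / 4"
        using T_norm[OF T_diff[OF elim(1) x'], of "e / 4"] e by auto
      have "norm (- j - (x0 - x')) \<le> norm (x n - x0) + norm (x n - x' + j)"
        using norm_triangle_ineq4[of "x n - x0" "x n - x' + j"] by (simp add: algebra_simps)
      then have "dist (- j) (x0 - x') < e"
        using j(2) elim(2,3) e unfolding dist_norm by linarith
      then show ?case using subspace_neg[OF subspace_J1 j(1)] by blast
    qed
    then show "\<exists>j\<in>J1. dist j (x0 - x') < e" by (auto simp: eventually_sequentially)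
  qed
  then have "x0 - x' \<in> T 0" using closed_J1 T_zero by simp
  from T_add[OF this x'] show ?thesis by simp
qed

lemma T_span:
  assumes U: "linear U" and R: "linear R" and B: "\<And>b. b \<in> B \<Longrightarrow> U b \<in> T (R b)" and z: "z \<in> span B"
  shows "U z \<in> T (R z)"
proof -
  have "subspace {z. U z \<in> T (R z)}"
    using T_zero subspace_0[OF subspace_J1] T_add T_scale
    by (auto simp: subspace_def linear_0[OF U] linear_0[OF R] linear_add[OF U] linear_add[OF R]
        linear_scale[OF U] linear_scale[OF R])
  then have "span B \<subseteq> {z. U z \<in> T (R z)}" using B by (intro span_minimal) auto
  with z show ?thesis by blast
qed

text \<open>
  \<open>c z\<close> is the \<open>J\<^sub>1\<^sup>*\<^sup>*\<close>-component of the comparison operator at \<open>z\<close>, given by its values on the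
  complement \<^const>\<open>ker_Q\<close> of the annihilator of \<open>J\<^sub>1\<close>, which is a copy of \<open>J\<^sub>1\<^sup>*\<close>.
\<close>

lemma approximate_lift:
  fixes c :: "'b \<Rightarrow> ('a \<Rightarrow> real) \<Rightarrow> real"
  assumes V: "V = span G" "finite G" and B: "B \<subseteq> V" "bounded B" "V \<inter> cball 0 1 \<subseteq> B"
    and R: "linear R" "R ` Y2 \<subseteq> Y2" "\<And>z. z \<in> B \<Longrightarrow> norm (R z) \<le> \<rho>"
    and c_V: "\<And>f. f \<in> ker_Q \<Longrightarrow> linear_map_on V UNIV (\<lambda>z. c z f)"
    and c_ker: "\<And>z. z \<in> V \<Longrightarrow> linear_map_on ker_Q UNIV (c z)"
    and c_norm: "\<And>z f. z \<in> B \<Longrightarrow> f \<in> ker_Q \<Longrightarrow> \<bar>c z f\<bar> \<le> \<rho> * onorm f"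
    and c_Y2: "\<And>z f. z \<in> V \<inter> Y2 \<Longrightarrow> f \<in> ker_Q \<Longrightarrow> (\<And>x. x \<in> X2 \<Longrightarrow> f x = 0) \<Longrightarrow> c z f = 0"
    and Z: "finite Z" "Z \<subseteq> V" and b: "\<And>z. z \<in> Z \<Longrightarrow> b z \<in> T (s z)"
    and Z_norm: "\<And>z. z \<in> Z \<Longrightarrow> norm (R z - s z) \<le> \<eta>"
    and Z_ker: "\<And>z f. z \<in> Z \<Longrightarrow> f \<in> ker_Q \<Longrightarrow> \<bar>c z f - f (b z)\<bar> \<le> \<eta> * onorm f"
    and e: "0 < e"
  obtains U where "linear U" "\<And>z. z \<in> V \<Longrightarrow> U z \<in> T (R z)" "\<And>z. z \<in> V \<inter> Y2 \<Longrightarrow> U z \<in> X2"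
    "\<And>z. z \<in> B \<Longrightarrow> norm (U z) \<le> \<rho> + e" "\<And>z. z \<in> Z \<Longrightarrow> norm (U z - b z) \<le> \<eta> + e"
proof -
  have V_sub: "subspace V" using V(1) by simp
  have "0 \<in> B" using B(3) subspace_0[OF V_sub] by auto
  then have \<rho>: "0 \<le> \<rho>" using R(3)[of 0] linear_0[OF R(1)] by simp
  obtain Bs where Bs: "finite Bs" "independent Bs" "span Bs = V" "span (Bs \<inter> Y2) = V \<inter> Y2"
    using adapted_basis[OF V subspace_Y2] by metis
  have Bs_V: "k \<in> V" if "k \<in> Bs" for k using that Bs(3) span_base by blast
  \<comment> \<open>The trivial lift of the basis, without norm control. Basis vectors in
    \<open>Y2\<close> are lifted into \<open>X2\<close>, as \<open>R\<close> preserves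
    \<open>Y2\<close>.\<close>
  have "\<exists>x. x \<in> T (R k) \<and> (k \<in> Y2 \<longrightarrow> x \<in> X2)" for k
    using T_nonempty[of "R k"] T_Y2[of "R k"] R(2) by blast
  then obtain A0 where A0: "\<And>k. A0 k \<in> T (R k)" "\<And>k. k \<in> Y2 \<Longrightarrow> A0 k \<in> X2" by metis
  obtain A where A: "linear A" "\<And>k. k \<in> Bs \<Longrightarrow> A k = A0 k"
    using linear_independent_extend[OF Bs(2), of A0] by blast
  have A_T: "A z \<in> T (R z)" if "z \<in> V" for z
    by (rule T_span[OF A(1) R(1), of Bs]) (use A A0 Bs that in auto)
  define rep where "rep z k = representation Bs z k" for z k
  have rep: "(\<Sum>k\<in>Bs. rep z k *\<^sub>R k) = z" if "z \<in> V" for z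
    unfolding rep_def using sum_representation_eq[OF Bs(2) _ Bs(1), of z] that Bs(3) by simp
  have rep_linear: "(\<Sum>k\<in>Bs. rep z k *\<^sub>R U k) = U z" if "linear U" "z \<in> V" for U :: "'b \<Rightarrow> 'a" and z
    using arg_cong[OF rep[OF that(2)], of U] by (simp add: linear_sum[OF that(1)] linear_scale[OF that(1)])
  have rep_c: "(\<Sum>k\<in>Bs. rep z k * c k f) = c z f" if "z \<in> V" "f \<in> ker_Q" for z f
    using linear_map_on_sum[OF V_sub c_V[OF that(2)], of Bs "\<lambda>k. k" "rep z"] Bs_V rep[OF that(1)] by simp
  \<comment> \<open>Half of \<open>e\<close> is spent on the constraints at the net points. This
    \<delta> makes the passage from the net to all of \<open>B\<close> use up exactly the other
    half.\<close>
  define \<delta> where "\<delta> = e / (2 * (\<rho> + e))"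
  have \<delta>: "0 < \<delta>" "\<delta> < 1" "(\<rho> + e / 2) / (1 - \<delta>) = \<rho> + e"
    using \<rho> e by (auto simp: \<delta>_def field_simps)
  obtain Zn where Zn: "finite Zn" "Zn \<subseteq> B"
    "\<And>(U :: 'b \<Rightarrow> 'a) m z. linear U \<Longrightarrow> (\<And>z. z \<in> Zn \<Longrightarrow> norm (U z) \<le> m) \<Longrightarrow> z \<in> B \<Longrightarrow>
       norm (U z) \<le> m / (1 - \<delta>)"
    using norming_finite_subset[OF V B \<delta>(1,2), where 'c = 'a] by metis
  \<comment> \<open>The tag \<open>True\<close> marks net points, with target 0 and radius \<rho>;
    the tag \<open>False\<close> marks points of \<open>Z\<close>, with target \<open>b z\<close>
    and radius \<eta>.\<close>
  define I where "I = Zn \<times> {True} \<union> Z \<times> {False}"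
  define b' where "b' i = (if snd i then 0 else b (fst i))" for i :: "'b \<times> bool"
  define r where "r i = (if snd i then \<rho> else \<eta>)" for i :: "'b \<times> bool"
  have I_V: "fst i \<in> V" if "i \<in> I" for i using that Zn(2) B(1) Z(2) by (auto simp: I_def)
  obtain j where j: "\<And>k. j k \<in> J1" "\<And>k. k \<in> Y2 \<Longrightarrow> j k \<in> J2"
    "\<And>i. i \<in> I \<Longrightarrow> norm ((\<Sum>k\<in>Bs. rep (fst i) k *\<^sub>R (A0 k - j k)) - b' i) \<le> r i + e / 2"
  proof (rule separated_correction[of I Bs "e / 2" Y2 A0 c r "\<lambda>i. rep (fst i)" b'])
    show "finite I" using Zn(1) Z(1) by (simp add: I_def)
    have "0 \<le> \<eta>" if "z \<in> Z" for z using Z_norm[OF that] norm_ge_zero[of "R z - s z"] by linarith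
    then show "0 \<le> r i" if "i \<in> I" for i using that \<rho> by (auto simp: I_def r_def)
    show "\<bar>(\<Sum>k\<in>Bs. rep (fst i) k * c k f) - f (b' i)\<bar> \<le> r i * onorm f"
      if i: "i \<in> I" and f: "f \<in> ker_Q" for i f
    proof -
      have "f 0 = 0" using f linear_0[OF bounded_linear.linear] by (auto simp: ker_Q_def)
      then show ?thesis
        using i f Zn(2) Z_ker c_norm by (auto simp: rep_c[OF I_V[OF i] f] I_def b'_def r_def)
    qed
    show "\<bar>f ((\<Sum>k\<in>Bs. rep (fst i) k *\<^sub>R A0 k) - b' i)\<bar> \<le> r i * onorm f"
      if i: "i \<in> I" and f: "bounded_linear f" "\<And>x. x \<in> J1 \<Longrightarrow> f x = 0" for i f
    proof -
      have A_eq: "(\<Sum>k\<in>Bs. rep (fst i) k *\<^sub>R A0 k) = A (fst i)"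
        using rep_linear[OF A(1) I_V[OF i]] A(2) by simp
      have o: "0 \<le> onorm f" using f(1) by (rule onorm_pos_le)
      \<comment> \<open>Seen from the annihilator, the large vector on the left is only a
        representative of a coset \<open>T y\<close> with small \<open>y\<close>: either
        \<open>R z\<close> or \<open>R z - s z\<close>.\<close>
      have "\<exists>y. A (fst i) - b' i \<in> T y \<and> norm y \<le> r i"
      proof (cases "snd i")
        case True
        then show ?thesis
          using A_T[OF I_V[OF i]] R(3) i Zn(2) by (intro exI[of _ "R (fst i)"]) (auto simp: I_def b'_def r_def)
      next
        case False
        then show ?thesis
          using T_diff[OF A_T[OF I_V[OF i]] b] Z_norm i by (intro exI[of _ "R (fst i) - s (fst i)"]) (auto simp: I_def b'_def r_def)
      qed
      then obtain y where y: "A (fst i) - b' i \<in> T y" "norm y \<le> r i" by blast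
      have "\<bar>f (A (fst i) - b' i)\<bar> \<le> onorm f * norm y" using f y(1) by (rule T_annihilator)
      also have "\<dots> \<le> onorm f * r i" using y(2) o by (rule mult_left_mono)
      finally show ?thesis by (simp add: A_eq mult.commute)
    qed
    show "linear_map_on ker_Q UNIV (c k)" if "k \<in> Bs" for k using c_ker Bs_V that by blast
    show "c k f = 0" if "k \<in> Bs \<inter> Y2" "f \<in> ker_Q" "\<And>x. x \<in> X2 \<Longrightarrow> f x = 0" for k f
      using c_Y2 Bs_V that by blast
  qed (use Bs(1) e A0(2) that in auto)
  obtain U where U: "linear U" "\<And>k. k \<in> Bs \<Longrightarrow> U k = A0 k - j k"
    using linear_independent_extend[OF Bs(2), of "\<lambda>k. A0 k - j k"] by blast
  have U_I: "norm (U (fst i) - b' i) \<le> r i + e / 2" if "i \<in> I" for i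
    using j(3)[OF that] rep_linear[OF U(1) I_V[OF that]] U(2) by simp
  show thesis
  proof (rule that[OF U(1)])
    show "U z \<in> T (R z)" if "z \<in> V" for z
    proof (rule T_span[OF U(1) R(1), of Bs])
      fix k assume "k \<in> Bs"
      then show "U k \<in> T (R k)" using T_diff[OF A0(1), of "j k" 0 k] j(1) U(2) T_zero by simp
    qed (use that Bs(3) in simp)
    show "U z \<in> X2" if z: "z \<in> V \<inter> Y2" for z
    proof -
      have "U ` (Bs \<inter> Y2) \<subseteq> X2"
        using U(2) A0(2) j(2) J2_le_X2 by (auto intro!: subspace_diff[OF subspace_X2])
      then have "U ` span (Bs \<inter> Y2) \<subseteq> X2"
        unfolding linear_span_image[OF U(1), symmetric] by (rule span_minimal[OF _ subspace_X2])
      with z Bs(4) show ?thesis by blast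
    qed
    show "norm (U z) \<le> \<rho> + e" if z: "z \<in> B" for z
    proof -
      have "norm (U z') \<le> \<rho> + e / 2" if "z' \<in> Zn" for z'
        using U_I[of "(z', True)"] that by (simp add: I_def b'_def r_def)
      then have "norm (U z) \<le> (\<rho> + e / 2) / (1 - \<delta>)" using U(1) z by (intro Zn(3))
      with \<delta>(3) show ?thesis by simp
    qed
    show "norm (U z - b z) \<le> \<eta> + e" if "z \<in> Z" for z
      using U_I[of "(z, False)"] that e by (simp add: I_def b'_def r_def)
  qed
qed

text \<open>Closedness of the relation \<open>x \<in> T y\<close> is used twice: for a fixed
  \<open>d\<close> in \<open>D\<close> as \<open>S n d\<close> tends to \<open>d\<close>, and then
  along points of \<open>D\<close> tending to \<open>y\<close>. Membership in \<open>X2\<close> is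
  known only on \<open>D \<inter> Y2\<close>, so this set has to be dense in
  \<open>Y2\<close>.\<close>

lemma lifting_limit:
  fixes L :: "nat \<Rightarrow> 'b \<Rightarrow> 'a"
  assumes E: "\<And>n. subspace (E n)" "incseq E" and D: "closure D = UNIV" "D \<subseteq> (\<Union>n. E n)" "Y2 \<subseteq> closure (D \<inter> Y2)"
    and L: "\<And>n. linear (L n)" "\<And>n z. z \<in> E n \<Longrightarrow> norm (L n z) \<le> (lam + \<delta> n) * norm z"
    and \<delta>: "\<delta> \<longlonglongrightarrow> 0" and lam: "0 \<le> lam" and conv: "\<And>d. d \<in> D \<Longrightarrow> convergent (\<lambda>n. L n d)"
    and T: "\<And>d. d \<in> D \<Longrightarrow> \<forall>\<^sub>F n in sequentially. L n d \<in> T (S n d)"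
    and S: "\<And>d. d \<in> D \<Longrightarrow> (\<lambda>n. S n d) \<longlonglongrightarrow> d"
    and X2: "\<And>d. d \<in> D \<inter> Y2 \<Longrightarrow> \<forall>\<^sub>F n in sequentially. L n d \<in> X2"
  shows "\<exists>M. bounded_linear M \<and> M ` Y2 \<subseteq> X2 \<and> (\<forall>y. M y \<in> T y) \<and> onorm M \<le> lam"
proof -
  obtain M where M: "bounded_linear M" "onorm M \<le> lam" "\<And>d. d \<in> D \<Longrightarrow> (\<lambda>n. L n d) \<longlonglongrightarrow> M d"
    using limit_of_partial_operators[OF E D(1,2) L \<delta> lam conv] by metis
  have M_lim: "(\<lambda>n. M (x n)) \<longlonglongrightarrow> M y" if "x \<longlonglongrightarrow> y" for x y
    using bounded_linear.tendsto[OF M(1) that] .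
  have "M y \<in> T y" for y
  proof -
    have "y \<in> closure D" using D(1) by simp
    then obtain d where d: "\<And>n. d n \<in> D" "d \<longlonglongrightarrow> y" by (auto simp: closure_sequential)
    have "M (d n) \<in> T (d n)" for n
      using T[OF d(1)] M(3)[OF d(1)] S[OF d(1)] by (rule T_closed)
    then show ?thesis using M_lim[OF d(2)] d(2) by (intro T_closed[of "\<lambda>n. M (d n)" d]) auto
  qed
  moreover have "M y \<in> X2" if y: "y \<in> Y2" for y
  proof -
    have "y \<in> closure (D \<inter> Y2)" using D(3) y by blast
    then obtain d where d: "\<And>n. d n \<in> D \<inter> Y2" "d \<longlonglongrightarrow> y" unfolding closure_sequential by blast
    have "M (d n) \<in> X2" for n
      by (rule Lim_in_closed_set[OF closed_X2 X2[OF d(1)] sequentially_bot M(3)]) (use d(1) in blast)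
    then show ?thesis using closed_sequentially[OF closed_X2] M_lim[OF d(2)] by metis
  qed
  ultimately show ?thesis using M(1,2) by blast
qed

end

subsection \<open>Liftings from the bounded approximation property\<close>

text \<open>The weight \<delta> \<open>n\<close> is the excess of the norm at stage
  \<open>n\<close>, and damping it away moves a vector by up to \<delta> \<open>n\<close> times its
  norm. Dividing by \<open>1 + (\<Sum>i<n. norm (u i))\<close> keeps this cost summable at each
  vector of the sequence.\<close>

lemma geometric_weights:
  fixes u :: "nat \<Rightarrow> 'b::real_normed_vector"
  obtains \<delta> :: "nat \<Rightarrow> real" where "\<And>n. 0 < \<delta> n" "\<And>n. \<delta> n \<le> (1 / 2) ^ n"
    "\<And>n i. i < n \<Longrightarrow> \<delta> n * norm (u i) \<le> (1 / 2) ^ n" "\<delta> \<longlonglongrightarrow> 0"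
proof -
  define m where "m n = 1 + (\<Sum>i<n. norm (u i))" for n
  define \<delta> where "\<delta> n = (1 / 2 :: real) ^ n / m n" for n
  have m: "1 \<le> m n" for n by (simp add: m_def sum_nonneg)
  have le: "\<delta> n * x \<le> (1 / 2) ^ n" if "x \<le> m n" for n x
  proof -
    have "(1 / 2 :: real) ^ n * x \<le> (1 / 2) ^ n * m n" using that by (intro mult_left_mono) auto
    then show ?thesis using m[of n] by (simp add: \<delta>_def pos_divide_le_eq)
  qed
  have pos: "0 < \<delta> n" for n using m[of n] by (simp add: \<delta>_def)
  have le1: "\<delta> n \<le> (1 / 2) ^ n" for n using le[OF m, of n] by simp
  have "norm (u i) \<le> m n" if "i < n" for i n
    using member_le_sum[of i "{..<n}" "\<lambda>i. norm (u i)"] that by (simp add: m_def)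
  then have "\<delta> n * norm (u i) \<le> (1 / 2) ^ n" if "i < n" for n i using le that by blast
  moreover have "\<delta> \<longlonglongrightarrow> 0"
    by (rule tendsto_sandwich[OF _ _ tendsto_const LIMSEQ_power_zero[of "1 / 2"]])
      (use pos le1 in \<open>auto intro: less_imp_le always_eventually\<close>)
  ultimately show thesis using that pos le1 by blast
qed

text \<open>The relative change under damping is \<open>d / (lam + d)\<close>, whose denominator
  cancels against the bound on \<open>x\<close>. Here \<open>k\<close> is the norm of a functional
  and \<open>m\<close> that of a vector.\<close>

lemma damping_error:
  fixes x :: real
  assumes "0 \<le> lam" "0 < d" "\<bar>x\<bar> \<le> k * ((lam + d) * m)"
  shows "\<bar>lam / (lam + d) * x - x\<bar> \<le> d * m * k"
proof -
  have "lam / (lam + d) * x - x = - (d / (lam + d) * x)"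
    using assms by (simp add: field_simps)
  then have "\<bar>lam / (lam + d) * x - x\<bar> = d / (lam + d) * \<bar>x\<bar>"
    using assms by (simp add: abs_mult)
  also have "\<dots> \<le> d / (lam + d) * (k * ((lam + d) * m))"
    using assms by (intro mult_left_mono) auto
  also have "\<dots> = d * m * k" using assms by simp
  finally show ?thesis .
qed

lemma linear_norm_le_if_unit_ball:
  assumes U: "linear U" and V: "subspace V" and le: "\<And>z. z \<in> V \<Longrightarrow> norm z \<le> 1 \<Longrightarrow> norm (U z) \<le> C"
    and z: "z \<in> V"
  shows "norm (U z) \<le> C * norm z"
proof (cases "z = 0")
  case False
  have "norm (U (inverse (norm z) *\<^sub>R z)) \<le> C"
    using False z by (intro le subspace_scale[OF V]) auto
  then show ?thesis using False by (simp add: linear_scale[OF U] divide_simps mult.commute)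
qed (simp add: linear_0[OF U])

lemma Times_subset_span:
  assumes A: "A \<subseteq> span G" and B: "B \<subseteq> span H"
  shows "A \<times> B \<subseteq> span ((\<lambda>a. (a, 0)) ` G \<union> (\<lambda>b. (0, b)) ` H)" (is "_ \<subseteq> span (?G \<union> ?H)")
proof
  fix x assume "x \<in> A \<times> B"
  then have "(fst x, 0) \<in> (\<lambda>a. (a, 0)) ` span G" "(0, snd x) \<in> (\<lambda>b. (0, b)) ` span H"
    using A B by auto
  moreover have "linear (\<lambda>a :: 'a. (a, 0 :: 'b))" "linear (\<lambda>b :: 'b. (0 :: 'a, b))"
    by (auto intro!: linearI)
  ultimately have "(fst x, 0) \<in> span ?G" "(0, snd x) \<in> span ?H"
    by (simp_all only: linear_span_image)
  then have "(fst x, 0) + (0, snd x) \<in> span (?G \<union> ?H)"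
    using span_mono[of ?G "?G \<union> ?H"] span_mono[of ?H "?G \<union> ?H"] by (intro span_add) auto
  then show "x \<in> span (?G \<union> ?H)" by simp
qed

context lifting_problem
begin

text \<open>The finite-rank operators \<open>L\<close>, \<open>S\<close> and \<open>S'\<close>
  factor through one projection \<open>P\<close>, so the approximate lift is needed on
  \<open>range P\<close> only. Its norm is tested on the image of the unit ball under
  \<open>P\<close>: at \<open>P y\<close> the operators are bounded by multiples of
  \<open>norm y\<close>, and thus the norm of \<open>P\<close> does not enter the bound for the new
  lift.\<close>

lemma BAP_lift_step:
  assumes lam: "0 \<le> lam" and d: "0 < d" and e: "0 < e"
    and L: "bounded_linear L" "finite G" "range L \<subseteq> span G" "\<And>y. L y \<in> T (S y)" "L ` Y2 \<subseteq> X2"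
      "\<And>y. norm (L y) \<le> (lam + d) * norm y"
    and S: "bounded_linear S" "finite H" "range S \<subseteq> span H"
    and S': "bounded_linear S'" "finite H'" "range S' \<subseteq> span H'" "S' ` Y2 \<subseteq> Y2"
      "\<And>y. norm (S' y) \<le> lam * norm y"
    and Z: "finite Z" "\<And>y. y \<in> Z \<Longrightarrow> d * norm y \<le> \<eta>" "\<And>y. y \<in> Z \<Longrightarrow> norm (S' y - S y) \<le> \<eta>"
  obtains L' G' where "bounded_linear L'" "finite G'" "range L' \<subseteq> span G'" "\<And>y. L' y \<in> T (S' y)" "L' ` Y2 \<subseteq> X2"
    "\<And>y. norm (L' y) \<le> (lam + e) * norm y" "\<And>y. y \<in> Z \<Longrightarrow> norm (L' y - L y) \<le> \<eta> + e"
proof -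
  interpret L: bounded_linear L by (rule L)
  define \<Phi> where "\<Phi> y = (L y, S y, S' y)" for y
  have "bounded_linear \<Phi>"
    unfolding \<Phi>_def by (intro bounded_linear_Pair L(1) S(1) S'(1))
  moreover obtain F where "finite F" "range \<Phi> \<subseteq> span F"
  proof -
    have "range \<Phi> \<subseteq> range L \<times> range S \<times> range S'" by (auto simp: \<Phi>_def)
    also have "\<dots> \<subseteq> span ((\<lambda>a. (a, 0)) ` G \<union> (\<lambda>b. (0, b)) ` ((\<lambda>a. (a, 0)) ` H \<union> (\<lambda>b. (0, b)) ` H'))"
      by (intro Times_subset_span L S S')
    finally show thesis using L(2) S(2) S'(2) by (intro that) auto
  qed
  ultimately obtain P K where P: "bounded_linear P" "finite K" "range P = span K" "\<And>x. P (P x) = P x"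
    "\<And>x. \<Phi> (P x) = \<Phi> x" "P ` Y2 \<subseteq> Y2"
    using finite_rank_projection[of \<Phi> F Y2] subspace_Y2 by blast
  interpret P: bounded_linear P by (rule P)
  have LP: "L (P y) = L y" and SP: "S (P y) = S y" and S'P: "S' (P y) = S' y" for y
    using P(5)[of y] by (auto simp: \<Phi>_def)
  \<comment> \<open>The comparison operator is the damped \<open>L\<close>, of norm at most
    \<open>lam\<close>, evaluated by functionals in \<open>ker_Q\<close>.\<close>
  define c where "c z f = lam / (lam + d) * f (L z)" for z and f :: "'a \<Rightarrow> real"
  have f_L: "\<bar>f (L z)\<bar> \<le> onorm f * ((lam + d) * norm y)"
    if f: "f \<in> ker_Q" and z: "z = P y" for f z y
  proof -
    have bl: "bounded_linear f" using f by (simp add: ker_Q_def)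
    have "\<bar>f (L z)\<bar> \<le> onorm f * norm (L y)" using onorm[OF bl, of "L z"] LP z by simp
    also have "\<dots> \<le> onorm f * ((lam + d) * norm y)"
      using L(6) onorm_pos_le[OF bl] by (rule mult_left_mono)
    finally show ?thesis .
  qed
  obtain U where U: "linear U" "\<And>z. z \<in> range P \<Longrightarrow> U z \<in> T (S' z)" "\<And>z. z \<in> range P \<inter> Y2 \<Longrightarrow> U z \<in> X2"
    "\<And>z. z \<in> P ` cball 0 1 \<Longrightarrow> norm (U z) \<le> lam + e" "\<And>z. z \<in> P ` Z \<Longrightarrow> norm (U z - L z) \<le> \<eta> + e"
  proof (rule approximate_lift[OF P(3,2), of "P ` cball 0 1" S' lam c "P ` Z" L S \<eta> e])
    show "bounded (P ` cball 0 1)" by (rule bounded_linear_image[OF bounded_cball P(1)])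
    show "range P \<inter> cball 0 1 \<subseteq> P ` cball 0 1"
    proof
      fix z assume z: "z \<in> range P \<inter> cball 0 1"
      then have "P z = z" using P(4) by auto
      with z show "z \<in> P ` cball 0 1" by (metis IntD2 image_eqI)
    qed
    show "linear S'" using S'(1) by (rule bounded_linear.linear)
    show "norm (S' z) \<le> lam" if "z \<in> P ` cball 0 1" for z
    proof -
      obtain y where y: "z = P y" "norm y \<le> 1" using \<open>z \<in> P ` cball 0 1\<close> by auto
      have "norm (S' z) \<le> lam * norm y" using S'(5) S'P y(1) by simp
      also have "\<dots> \<le> lam" using y(2) lam by (simp add: mult_left_le)
      finally show ?thesis .
    qed
    show "linear_map_on (range P) UNIV (\<lambda>z. c z f)" if "f \<in> ker_Q" for f
    proof -
      interpret f: bounded_linear f using that by (simp add: ker_Q_def)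
      show ?thesis
        by (auto simp: linear_map_on_def c_def L.add L.scaleR f.add f.scaleR distrib_left add_divide_distrib)
    qed
    show "linear_map_on ker_Q UNIV (c z)" for z
      by (auto simp: linear_map_on_def c_def scaleR_fun_def distrib_left add_divide_distrib)
    show "\<bar>c z f\<bar> \<le> lam * onorm f" if z: "z \<in> P ` cball 0 1" and f: "f \<in> ker_Q" for z f
    proof -
      obtain y where y: "z = P y" "norm y \<le> 1" using z by auto
      have o: "0 \<le> onorm f" using f by (simp add: ker_Q_def onorm_pos_le)
      have "\<bar>f (L z)\<bar> \<le> onorm f * ((lam + d) * norm y)" using f y(1) by (rule f_L)
      also have "\<dots> \<le> onorm f * ((lam + d) * 1)"
        using y(2) o lam d by (intro mult_left_mono) auto
      finally have "lam / (lam + d) * \<bar>f (L z)\<bar> \<le> lam / (lam + d) * (onorm f * ((lam + d) * 1))"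
        using lam d by (intro mult_left_mono) auto
      then show ?thesis using lam d by (simp add: c_def abs_mult)
    qed
    show "c z f = 0" if "z \<in> range P \<inter> Y2" "\<And>x. x \<in> X2 \<Longrightarrow> f x = 0" for z f
      using that L(5) by (auto simp: c_def)
    show "norm (S' z - S z) \<le> \<eta>" if "z \<in> P ` Z" for z using that Z(3) by (auto simp: S'P SP)
    show "\<bar>c z f - f (L z)\<bar> \<le> \<eta> * onorm f" if z: "z \<in> P ` Z" and f: "f \<in> ker_Q" for z f
    proof -
      obtain y where y: "z = P y" "y \<in> Z" using z by auto
      have "\<bar>c z f - f (L z)\<bar> \<le> d * norm y * onorm f"
        unfolding c_def using lam d f_L[OF f y(1)] by (rule damping_error)
      also have "\<dots> \<le> \<eta> * onorm f"
        using Z(2)[OF y(2)] f by (intro mult_right_mono) (auto simp: ker_Q_def onorm_pos_le)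
      finally show ?thesis .
    qed
  qed (use Z(1) S'(4) L(4) e that in auto)
  interpret U: linear U by (rule U)
  show thesis
  proof (rule that[of "\<lambda>y. U (P y)" "U ` K"])
    have lin: "linear (\<lambda>y. U (P y))"
      by (auto intro!: linearI simp: P.add P.scaleR U.add U.scale)
    show norm: "norm (U (P y)) \<le> (lam + e) * norm y" for y
      by (rule linear_norm_le_if_unit_ball[OF lin subspace_UNIV]) (use U(4) in auto)
    show "bounded_linear (\<lambda>y. U (P y))"
      by (rule bounded_linear_intro[of _ "lam + e"])
        (use norm in \<open>auto simp: P.add P.scaleR U.add U.scale mult.commute\<close>)
    have "range (\<lambda>y. U (P y)) = U ` range P" by auto
    then show "range (\<lambda>y. U (P y)) \<subseteq> span (U ` K)"
      by (simp add: P(3) linear_span_image[OF U(1)])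
    show "U (P y) \<in> T (S' y)" for y using U(2)[of "P y"] S'P by simp
    show "(\<lambda>y. U (P y)) ` Y2 \<subseteq> X2" using U(3) P(6) by auto
    show "norm (U (P y) - L y) \<le> \<eta> + e" if "y \<in> Z" for y using U(5)[of "P y"] that LP by simp
  qed (use P(2) in simp)
qed

lemma lifting_of_BAP:
  fixes u :: "nat \<Rightarrow> 'b"
  assumes BAP: "BAP_pair lam Y2" and u: "closure (range u) = UNIV" "Y2 \<subseteq> closure (range u \<inter> Y2)"
  shows "\<exists>M. bounded_linear M \<and> M ` Y2 \<subseteq> X2 \<and> (\<forall>y. M y \<in> T y) \<and> onorm M \<le> lam"
proof -
  obtain \<delta> :: "nat \<Rightarrow> real" where \<delta>: "\<And>n. 0 < \<delta> n" "\<And>n. \<delta> n \<le> (1 / 2) ^ n"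
    "\<And>n i. i < n \<Longrightarrow> \<delta> n * norm (u i) \<le> (1 / 2) ^ n" "\<delta> \<longlonglongrightarrow> 0"
    using geometric_weights[of u] by metis
  let ?S = "\<lambda>n S. bounded_linear S \<and> (\<exists>B. finite B \<and> range S \<subseteq> span B) \<and>
    (\<forall>y. norm (S y) \<le> lam * norm y) \<and> (\<forall>i<n. norm (S (u i) - u i) \<le> (1 / 2) ^ n) \<and> S ` Y2 \<subseteq> Y2"
  have S_ex: "\<exists>S. ?S n S \<and> 0 \<le> lam" for n
  proof -
    have "compact (u ` {..<n})" by (simp add: finite_imp_compact)
    then obtain S :: "'b \<Rightarrow> 'b" where S: "bounded_linear S" "\<exists>B. finite B \<and> range S \<subseteq> span B" "onorm S \<le> lam"
      "\<forall>y\<in>u ` {..<n}. norm (S y - y) \<le> (1 / 2) ^ n" "S ` Y2 \<subseteq> Y2"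
      using BAP[unfolded BAP_pair_def, rule_format, of "(1 / 2) ^ n" "u ` {..<n}"] by auto
    have "norm (S y) \<le> lam * norm y" for y
      using onorm[OF S(1), of y] mult_right_mono[OF S(3), of "norm y"] by simp
    moreover have "0 \<le> lam" using onorm_pos_le[OF S(1)] S(3) by linarith
    ultimately show ?thesis using S by auto
  qed
  then have lam: "0 \<le> lam" by blast
  \<comment> \<open>The choice of 0 for the first approximation lets the recursion start from the
    lift 0; at stage 0 no vector has to be approximated yet.\<close>
  have "?S 0 (\<lambda>_. 0)" using subspace_0[OF subspace_Y2] lam by (auto intro!: exI[of _ "{}"])
  then have "\<forall>n. \<exists>S. ?S n S \<and> (n = 0 \<longrightarrow> S = (\<lambda>_. 0))" using S_ex by (metis (no_types, lifting))
  then obtain S where S: "\<And>n. ?S n (S n)" "S 0 = (\<lambda>_. 0)" by metis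
  let ?P = "\<lambda>n L. bounded_linear L \<and> (\<exists>G. finite G \<and> range L \<subseteq> span G) \<and> (\<forall>y. L y \<in> T (S n y)) \<and>
    L ` Y2 \<subseteq> X2 \<and> (\<forall>y. norm (L y) \<le> (lam + \<delta> n) * norm y)"
  let ?R = "\<lambda>n L L'. \<forall>i<n. norm (L' (u i) - L (u i)) \<le> 3 * (1 / 2) ^ n"
  have "\<exists>L. \<forall>n. ?P n (L n) \<and> ?R n (L n) (L (Suc n))"
  proof (rule dependent_nat_choice)
    have "?P 0 (\<lambda>_. 0)"
      using subspace_0[OF subspace_J1] subspace_0[OF subspace_X2] T_zero S(2) lam less_imp_le[OF \<delta>(1)[of 0]]
      by (auto intro!: exI[of _ "{}"])
    then show "\<exists>L. ?P 0 L" by blast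
    fix L n assume L: "?P n L"
    then obtain G where G: "finite G" "range L \<subseteq> span G" by blast
    obtain H where H: "finite H" "range (S n) \<subseteq> span H" using S(1)[of n] by blast
    obtain H' where H': "finite H'" "range (S (Suc n)) \<subseteq> span H'" using S(1)[of "Suc n"] by blast
    have S_diff: "norm (S (Suc n) (u i) - S n (u i)) \<le> 2 * (1 / 2) ^ n" if "i < n" for i
    proof -
      have "norm (S (Suc n) (u i) - S n (u i)) \<le> norm (S (Suc n) (u i) - u i) + norm (S n (u i) - u i)"
        using norm_triangle_ineq4[of "S (Suc n) (u i) - u i" "S n (u i) - u i"] by simp
      also have "\<dots> \<le> (1 / 2) ^ Suc n + (1 / 2) ^ n"
        using S(1)[of n] S(1)[of "Suc n"] that by (intro add_mono) auto
      also have "\<dots> \<le> 2 * (1 / 2) ^ n"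
        using zero_le_power[of "1 / 2 :: real" n] by (simp only: power_Suc) linarith
      finally show ?thesis .
    qed
    \<comment> \<open>The damping error concerns \<open>ker_Q\<close>, the difference of
      \<open>S n\<close> and \<open>S (Suc n)\<close> the annihilator. They do not add up, so one
      \<eta> that dominates both is enough.\<close>
    have weight: "\<delta> n * norm y \<le> 2 * (1 / 2) ^ n" if "y \<in> u ` {..<n}" for y
    proof -
      have "\<delta> n * norm y \<le> (1 / 2) ^ n" using that \<delta>(3) by blast
      also have "\<dots> \<le> 2 * (1 / 2) ^ n" by simp
      finally show ?thesis .
    qed
    have Lf: "bounded_linear L" "\<And>y. L y \<in> T (S n y)" "L ` Y2 \<subseteq> X2" "\<And>y. norm (L y) \<le> (lam + \<delta> n) * norm y"
      using L by auto
    have Sf: "bounded_linear (S k)" "S k ` Y2 \<subseteq> Y2" "\<And>y. norm (S k y) \<le> lam * norm y" for k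
      using S(1)[of k] by auto
    have fin: "finite (u ` {..<n})" by simp
    have S_diff': "norm (S (Suc n) y - S n y) \<le> 2 * (1 / 2) ^ n" if "y \<in> u ` {..<n}" for y
      using S_diff that by blast
    obtain L' G' where L': "bounded_linear L'" "finite G'" "range L' \<subseteq> span G'" "\<And>y. L' y \<in> T (S (Suc n) y)"
      "L' ` Y2 \<subseteq> X2" "\<And>y. norm (L' y) \<le> (lam + \<delta> (Suc n)) * norm y"
      "\<And>y. y \<in> u ` {..<n} \<Longrightarrow> norm (L' y - L y) \<le> 2 * (1 / 2) ^ n + \<delta> (Suc n)"
      using BAP_lift_step[OF lam \<delta>(1)[of n] \<delta>(1)[of "Suc n"] Lf(1) G Lf(2-4) Sf(1) H Sf(1) H' Sf(2,3)
          fin weight S_diff'] by metis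
    have "\<delta> (Suc n) \<le> (1 / 2) ^ n" using \<delta>(2)[of "Suc n"] by (rule order_trans) simp
    then have "norm (L' (u i) - L (u i)) \<le> 3 * (1 / 2) ^ n" if "i < n" for i
      using L'(7)[of "u i"] that by auto
    then show "\<exists>L'. ?P (Suc n) L' \<and> ?R n L L'" using L' by (intro exI[of _ L']) auto
  qed
  then obtain L where ex: "\<forall>n. ?P n (L n) \<and> ?R n (L n) (L (Suc n))" by (rule exE)
  have L: "?P n (L n)" "?R n (L n) (L (Suc n))" for n
    by (rule conjunct1[OF spec[OF ex]], rule conjunct2[OF spec[OF ex]])
  show ?thesis
  proof (rule lifting_limit[of "\<lambda>_. UNIV" "range u" L lam \<delta> S])
    show "convergent (\<lambda>n. L n d)" if d: "d \<in> range u" for d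
    proof -
      obtain i where i: "d = u i" using d by blast
      have "\<forall>\<^sub>F n in sequentially. norm (L (Suc n) d - L n d) \<le> 3 * (1 / 2) ^ n"
        using L(2) i by (auto simp: eventually_sequentially intro!: exI[of _ "Suc i"])
      then show ?thesis by (rule convergent_if_geometric_increments)
    qed
    show "(\<lambda>n. S n d) \<longlonglongrightarrow> d" if d: "d \<in> range u" for d
    proof -
      obtain i where i: "d = u i" using d by blast
      have ev: "\<forall>\<^sub>F n in sequentially. norm (S n d - d) \<le> (1 / 2) ^ n"
        using S(1) i by (auto simp: eventually_sequentially intro!: exI[of _ "Suc i"])
      have "(\<lambda>n. S n d - d) \<longlonglongrightarrow> 0"
        by (rule Lim_null_comparison[OF ev]) (simp add: LIMSEQ_power_zero)
      then show ?thesis by (simp add: LIM_zero_iff)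
    qed
    show "linear (L n)" for n using L(1)[of n] bounded_linear.linear by blast
    show "norm (L n z) \<le> (lam + \<delta> n) * norm z" for n z using L(1)[of n] by blast
    show "\<forall>\<^sub>F n in sequentially. L n d \<in> T (S n d)" for d using L(1) by (intro always_eventually) blast
    show "\<forall>\<^sub>F n in sequentially. L n d \<in> X2" if "d \<in> range u \<inter> Y2" for d
      using L(1) that by (intro always_eventually) blast
  qed (use u \<delta>(4) lam subspace_UNIV in \<open>auto simp: incseq_def\<close>)
qed

end

subsection \<open>Extensions into injective pairs\<close>

text \<open>Test spaces for injectivity live in a prescribed function space, so subspaces have to be
  transported there. Inverting \<Psi> on all of \<open>V\<close>, and not on \<open>U\<close>, gives
  the same norm for every \<open>U\<close> inside \<open>V\<close>, as an extension problem
  requires.\<close>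

lemma banach_pair_on_image:
  fixes \<Psi> :: "'b::banach \<Rightarrow> 'w::real_vector"
  assumes V: "subspace V" and \<Psi>: "linear_map_on V UNIV \<Psi>" "inj_on \<Psi> V"
    and U: "subspace U" "closed U" "U \<subseteq> V" and W: "subspace W" "closed W" "W \<subseteq> U"
  shows "banach_pair_on (\<Psi> ` U) (\<Psi> ` W) (\<lambda>\<phi>. norm (inv_into V \<Psi> \<phi>))"
proof -
  define n where "n \<phi> = norm (inv_into V \<Psi> \<phi>)" for \<phi>
  have n: "n (\<Psi> x) = norm x" if "x \<in> V" for x
    using that \<Psi>(2) by (simp add: n_def)
  have add: "\<Psi> x + \<Psi> y = \<Psi> (x + y)" and scale: "c *\<^sub>R \<Psi> x = \<Psi> (c *\<^sub>R x)"
    and diff: "\<Psi> x - \<Psi> y = \<Psi> (x - y)" if "x \<in> V" "y \<in> V" for x y c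
    using linear_map_on_add[OF \<Psi>(1)] linear_map_on_scale[OF \<Psi>(1)] linear_map_on_diff[OF V \<Psi>(1)] that
    by simp_all
  have zero: "\<Psi> 0 = 0" using linear_map_on_scale[OF \<Psi>(1) subspace_0[OF V], of 0] by simp
  have image: "subspace (\<Psi> ` A)" if "subspace A" "A \<subseteq> V" for A
    unfolding subspace_def
  proof (intro conjI ballI allI)
    show "0 \<in> \<Psi> ` A" using zero subspace_0[OF that(1)] by (metis image_eqI)
  qed (use that in \<open>auto simp: add scale subset_iff intro!: imageI subspace_add[OF that(1)] subspace_scale[OF that(1)]\<close>)
  have normed: "normed_space_on (\<Psi> ` U) n"
    unfolding normed_space_on_def
  proof (intro conjI ballI allI)
    show "subspace (\<Psi> ` U)" using image U by blast
    fix x assume "x \<in> \<Psi> ` U"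
    then obtain x' where x': "x' \<in> U" "x = \<Psi> x'" by blast
    then have xV: "x' \<in> V" using U(3) by blast
    show "0 \<le> n x" by (simp add: n_def)
    have "\<Psi> x' = \<Psi> 0 \<longleftrightarrow> x' = 0" using \<Psi>(2) xV subspace_0[OF V] by (simp add: inj_on_eq_iff)
    then show "(n x = 0) = (x = 0)" using n[OF xV] x'(2) zero by simp
    show "n (c *\<^sub>R x) = \<bar>c\<bar> * n x" for c
      using n[OF xV] n[OF subspace_scale[OF V xV]] x'(2) scale[OF xV xV] by simp
    fix y assume "y \<in> \<Psi> ` U"
    then obtain y' where y': "y' \<in> U" "y = \<Psi> y'" by blast
    then have yV: "y' \<in> V" using U(3) by blast
    show "n (x + y) \<le> n x + n y"
      using n[OF xV] n[OF yV] n[OF subspace_add[OF V xV yV]] x'(2) y'(2) add[OF xV yV]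
      by (simp add: norm_triangle_ineq)
  qed
  have "banach_space_on (\<Psi> ` U) n"
    unfolding banach_space_on_def
  proof (intro conjI normed allI impI)
    fix s :: "nat \<Rightarrow> 'w"
    assume s: "\<forall>n. s n \<in> \<Psi> ` U" and Cau: "\<forall>e>0. \<exists>N. \<forall>m\<ge>N. \<forall>k\<ge>N. n (s m - s k) < e"
    then have "\<forall>k. \<exists>r. r \<in> U \<and> s k = \<Psi> r" by blast
    then obtain r where r: "\<And>k. r k \<in> U" "\<And>k. s k = \<Psi> (r k)" by metis
    then have rV: "r k \<in> V" for k using U(3) by blast
    have n_diff: "n (s m - s k) = dist (r m) (r k)" for m k
      using n[OF subspace_diff[OF V rV rV], of m k] by (simp add: r(2) diff[OF rV rV] dist_norm)
    have "Cauchy r" using Cau by (simp add: n_diff Cauchy_def)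
    then obtain l where l: "r \<longlonglongrightarrow> l" by (metis Cauchy_convergent_iff convergent_def)
    have lU: "l \<in> U" using closed_sequentially[OF U(2) _ l] r(1) by blast
    then have lV: "l \<in> V" using U(3) by blast
    have "n (s k - \<Psi> l) = norm (r k - l)" for k
      using n[OF subspace_diff[OF V rV lV], of k] by (simp add: r(2) diff[OF rV lV])
    then have "(\<lambda>k. n (s k - \<Psi> l)) \<longlonglongrightarrow> 0"
      using l by (simp add: LIM_zero tendsto_norm_zero)
    with lU show "\<exists>l\<in>\<Psi> ` U. (\<lambda>k. n (s k - l)) \<longlonglongrightarrow> 0" by blast
  qed
  moreover have "closed_subspace_on (\<Psi> ` U) n (\<Psi> ` W)"
    unfolding closed_subspace_on_def
  proof (intro conjI allI ballI impI)
    show "subspace (\<Psi> ` W)" using image W U(3) by blast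
    show "\<Psi> ` W \<subseteq> \<Psi> ` U" using W(3) by blast
    fix s :: "nat \<Rightarrow> 'w" and l'
    assume l': "l' \<in> \<Psi> ` U" and s: "\<forall>n. s n \<in> \<Psi> ` W" and lim: "(\<lambda>k. n (s k - l')) \<longlonglongrightarrow> 0"
    obtain l where l: "l \<in> U" "l' = \<Psi> l" using l' by blast
    then have lV: "l \<in> V" using U(3) by blast
    have "\<forall>k. \<exists>r. r \<in> W \<and> s k = \<Psi> r" using s by blast
    then obtain r where r: "\<And>k. r k \<in> W" "\<And>k. s k = \<Psi> (r k)" by metis
    then have rV: "r k \<in> V" for k using U(3) W(3) by blast
    have "n (s k - l') = norm (r k - l)" for k
      using n[OF subspace_diff[OF V rV lV], of k] by (simp add: r(2) l(2) diff[OF rV lV])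
    then have "(\<lambda>k. norm (r k - l)) \<longlonglongrightarrow> 0" using lim by simp
    then have "r \<longlonglongrightarrow> l" by (simp add: tendsto_norm_zero_iff LIM_zero_iff)
    then have "l \<in> W" using closed_sequentially[OF W(2)] r(1) by blast
    then show "l' \<in> \<Psi> ` W" using l(2) by blast
  qed
  ultimately show ?thesis by (simp add: banach_pair_on_def n_def[abs_def])
qed

text \<open>A finite-dimensional \<open>V\<close> embeds in \<open>'v \<Rightarrow> real\<close> by its coordinates, spread over the points of \<open>'v\<close>.\<close>

lemma injective_pair_extend:
  fixes V W Y :: "'b::banach set" and Z1 :: "'v::real_vector set" and t :: "'b \<Rightarrow> 'v"
  assumes inj: "injective_pair lam Z1 Z2 p" and inf: "infinite (UNIV :: 'v set)" and Z1: "normed_space_on Z1 p"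
    and V: "V = span G" "finite G" and W: "W = span H" "finite H" "W \<subseteq> V"
    and Y: "subspace Y" "closed Y"
    and t: "linear_map_on W Z1 t" "t ` (W \<inter> Y) \<subseteq> Z2" "\<And>w. w \<in> W \<Longrightarrow> p (t w) \<le> k * norm w"
    and k: "0 \<le> k" and lam: "0 \<le> lam"
  obtains t' where "linear_map_on V Z1 t'" "t' ` (V \<inter> Y) \<subseteq> Z2" "\<And>w. w \<in> W \<Longrightarrow> t' w = t w"
    "\<And>z. z \<in> V \<Longrightarrow> p (t' z) \<le> lam * k * norm z"
proof -
  have V_sub: "subspace V" "closed V" and W_sub: "subspace W" "closed W"
    using V W closed_span_finite by auto
  obtain Bs where Bs: "finite Bs" "independent Bs" "span Bs = V"
    using adapted_basis[OF V subspace_UNIV] by metis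
  obtain \<iota> :: "'b \<Rightarrow> 'v" where \<iota>: "inj_on \<iota> Bs"
    using infinite_arbitrarily_large[OF inf, of "card Bs"] Bs(1)
    by (metis card_le_inj order_refl)
  define \<kappa> where "\<kappa> = inv_into Bs \<iota>"
  have \<kappa>: "\<kappa> (\<iota> b) = b" if "b \<in> Bs" for b using \<iota> that by (simp add: \<kappa>_def)
  \<comment> \<open>Off the image of \<iota>, the value of \<kappa> is arbitrary. This harms neither
    linearity in \<open>z\<close> nor injectivity, for which the points \<iota> \<open>b\<close>
    suffice.\<close>
  define \<Psi> where "\<Psi> z = (\<lambda>v. representation Bs z (\<kappa> v))" for z
  have \<Psi>_lin: "linear_map_on V UNIV \<Psi>"
    using Bs(2,3)
    by (auto simp: linear_map_on_def \<Psi>_def representation_add representation_scale scaleR_fun_def fun_eq_iff)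
  have \<Psi>_inj: "inj_on \<Psi> V"
  proof (rule inj_onI)
    fix x y assume xy: "x \<in> V" "y \<in> V" "\<Psi> x = \<Psi> y"
    have "representation Bs x b = representation Bs y b" if "b \<in> Bs" for b
      using fun_cong[OF xy(3), of "\<iota> b"] \<kappa>[OF that] by (simp add: \<Psi>_def)
    then have "(\<Sum>b\<in>Bs. representation Bs x b *\<^sub>R b) = (\<Sum>b\<in>Bs. representation Bs y b *\<^sub>R b)" by simp
    then show "x = y"
      using sum_representation_eq[OF Bs(2) _ Bs(1)] xy(1,2) Bs(3) by simp
  qed
  define n where "n \<phi> = norm (inv_into V \<Psi> \<phi>)" for \<phi>
  have inv: "inv_into V \<Psi> (\<Psi> x) = x" if "x \<in> V" for x using \<Psi>_inj that by simp
  have n: "n (\<Psi> x) = norm x" if "x \<in> V" for x using inv[OF that] by (simp add: n_def)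
  have VY: "subspace (V \<inter> Y)" "closed (V \<inter> Y)" and WY: "subspace (W \<inter> Y)" "closed (W \<inter> Y)"
    using V_sub W_sub Y by (auto intro: subspace_inter)
  have pair_V: "banach_pair_on (\<Psi> ` V) (\<Psi> ` (V \<inter> Y)) n"
    using banach_pair_on_image[OF V_sub(1) \<Psi>_lin \<Psi>_inj V_sub order_refl VY] by (simp add: n_def[abs_def])
  have pair_W: "banach_pair_on (\<Psi> ` W) (\<Psi> ` (W \<inter> Y)) n"
    using banach_pair_on_image[OF V_sub(1) \<Psi>_lin \<Psi>_inj W_sub W(3) WY] by (simp add: n_def[abs_def])
  define t0 where "t0 \<phi> = t (inv_into V \<Psi> \<phi>)" for \<phi>
  have t0: "t0 (\<Psi> x) = t x" if "x \<in> V" for x using inv[OF that] by (simp add: t0_def)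
  have t0_lin: "linear_map_on (\<Psi> ` W) Z1 t0"
    unfolding linear_map_on_def
  proof (intro conjI ballI allI)
    show "t0 ` \<Psi> ` W \<subseteq> Z1" using t0 W(3) linear_map_on_imageI[OF t(1)] by auto
    fix \<phi> assume "\<phi> \<in> \<Psi> ` W"
    then obtain x where x: "x \<in> W" "\<phi> = \<Psi> x" by blast
    then have xV: "x \<in> V" using W(3) by blast
    show "t0 (c *\<^sub>R \<phi>) = c *\<^sub>R t0 \<phi>" for c
      using t0[OF subspace_scale[OF V_sub(1) xV]] t0[OF xV] linear_map_on_scale[OF t(1) x(1)]
        linear_map_on_scale[OF \<Psi>_lin xV] x(2) by simp
    fix \<psi> assume "\<psi> \<in> \<Psi> ` W"
    then obtain y where y: "y \<in> W" "\<psi> = \<Psi> y" by blast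
    then have yV: "y \<in> V" using W(3) by blast
    show "t0 (\<phi> + \<psi>) = t0 \<phi> + t0 \<psi>"
      using t0[OF subspace_add[OF V_sub(1) xV yV]] t0[OF xV] t0[OF yV] linear_map_on_add[OF t(1) x(1) y(1)]
        linear_map_on_add[OF \<Psi>_lin xV yV] x(2) y(2) by simp
  qed
  have t0_le: "p (t0 \<phi>) \<le> k * n \<phi>" if "\<phi> \<in> \<Psi> ` W" for \<phi>
    using that t(3) t0 n W(3) by (auto simp: subset_iff)
  have t0_bdd: "bounded_on (\<Psi> ` W) n p t0" using t0_le by (auto simp: bounded_on_def)
  have norm_W: "normed_space_on (\<Psi> ` W) n" and norm_V: "normed_space_on (\<Psi> ` V) n"
    using pair_V pair_W by (auto simp: banach_pair_on_def banach_space_on_def)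
  have t0_norm: "op_norm (\<Psi> ` W) n p t0 \<le> k"
    using op_norm_le[OF norm_W Z1 t0_lin k t0_le] .
  have "\<Psi> ` W \<subseteq> \<Psi> ` V" "\<Psi> ` (W \<inter> Y) \<subseteq> \<Psi> ` (V \<inter> Y)" using W(3) by auto
  \<comment> \<open>The compatibility condition \<open>F2 = F1 \<inter> E2\<close> of the extension
    problem, which rests on the injectivity of \<Psi>.\<close>
  moreover have "\<Psi> ` (W \<inter> Y) = \<Psi> ` W \<inter> \<Psi> ` (V \<inter> Y)"
    using inj_on_image_Int[OF \<Psi>_inj W(3), of "V \<inter> Y"] W(3) by (simp add: inf.absorb1 Int_assoc[symmetric])
  moreover have "t0 ` \<Psi> ` (W \<inter> Y) \<subseteq> Z2" using t(2) t0 W(3) by auto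
  ultimately obtain t1 where t1: "linear_map_on (\<Psi> ` V) Z1 t1" "t1 ` \<Psi> ` (V \<inter> Y) \<subseteq> Z2" "bounded_on (\<Psi> ` V) n p t1"
    "\<forall>x\<in>\<Psi> ` W. t1 x = t0 x" "op_norm (\<Psi> ` V) n p t1 \<le> lam * op_norm (\<Psi> ` W) n p t0"
    using inj[unfolded injective_pair_def, rule_format, of "\<Psi> ` V" "\<Psi> ` (V \<inter> Y)" n "\<Psi> ` W" "\<Psi> ` (W \<inter> Y)" t0]
      pair_V pair_W t0_lin t0_bdd by blast
  show thesis
  proof (rule that[of "\<lambda>z. t1 (\<Psi> z)"])
    show "linear_map_on V Z1 (\<lambda>z. t1 (\<Psi> z))"
      using t1(1) \<Psi>_lin by (auto simp: linear_map_on_def)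
    show "(\<lambda>z. t1 (\<Psi> z)) ` (V \<inter> Y) \<subseteq> Z2" using t1(2) by auto
    show "t1 (\<Psi> w) = t w" if "w \<in> W" for w using t1(4) t0[of w] W(3) that by auto
    show "p (t1 (\<Psi> z)) \<le> lam * k * norm z" if z: "z \<in> V" for z
    proof -
      have "p (t1 (\<Psi> z)) \<le> op_norm (\<Psi> ` V) n p t1 * n (\<Psi> z)"
        using le_op_norm[OF norm_V Z1 t1(1) t1(3)] z by blast
      also have "\<dots> \<le> lam * k * n (\<Psi> z)"
        using t1(5) mult_left_mono[OF t0_norm lam] by (intro mult_right_mono) (auto simp: n_def)
      finally show ?thesis using n[OF z] by simp
    qed
  qed
qed

context simultaneous_L_projection
begin

lemma restrict_in_dual:
  assumes f: "bounded_linear f"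
  shows "restrict_functional J1 f \<in> dual_space J1 norm" "dual_norm J1 norm (restrict_functional J1 f) \<le> onorm f"
proof -
  interpret f: bounded_linear f by (rule f)
  have le: "\<bar>restrict_functional J1 f x\<bar> \<le> onorm f * norm x" if "x \<in> J1" for x
    using onorm[OF f, of x] that by (simp add: restrict_functional_def)
  show dual: "restrict_functional J1 f \<in> dual_space J1 norm"
    by (rule dual_spaceI[where C = "onorm f"])
      (use le subspace_add[OF subspace_J1] subspace_scale[OF subspace_J1] in
        \<open>auto simp: restrict_functional_def f.add f.scaleR\<close>)
  show "dual_norm J1 norm (restrict_functional J1 f) \<le> onorm f"
    by (rule dual_norm_le[OF normed_space_on_norm[OF subspace_J1] dual onorm_pos_le[OF f] le])
qed

lemma restrict_linear: "linear_map_on ker_Q (dual_space J1 norm) (restrict_functional J1)"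
  using restrict_in_dual(1)
  by (auto simp: linear_map_on_def ker_Q_def restrict_functional_def scaleR_fun_def fun_eq_iff)

text \<open>The difference kills \<open>J1\<close>, so \<open>Q\<close> fixes it; it also lies in
  the kernel of \<open>Q\<close>.\<close>

lemma ker_Q_eqI:
  assumes f: "f \<in> ker_Q" and g: "g \<in> ker_Q" and eq: "\<And>x. x \<in> J1 \<Longrightarrow> f x = g x"
  shows "f = g"
proof -
  have "f - g \<in> ker_Q" using subspace_ker_Q f g by (rule subspace_diff)
  moreover then have "Q (f - g) = f - g" using eq by (intro Q_fixes) (auto simp: ker_Q_def)
  ultimately show ?thesis by (simp add: ker_Q_def)
qed

text \<open>Restriction is an isometry of \<^const>\<open>ker_Q\<close> onto \<open>J\<^sub>1\<^sup>*\<close>; this is its inverse.\<close>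

definition lift_functional :: "('a \<Rightarrow> real) \<Rightarrow> 'a \<Rightarrow> real" where
  "lift_functional g = (THE f. f \<in> ker_Q \<and> (\<forall>x\<in>J1. f x = g x))"

lemma lift_functional_eqI: "f \<in> ker_Q \<Longrightarrow> (\<And>x. x \<in> J1 \<Longrightarrow> f x = g x) \<Longrightarrow> lift_functional g = f"
  unfolding lift_functional_def by (rule the_equality) (auto intro: ker_Q_eqI)

text \<open>Take any norm-preserving extension \<open>f\<close> and subtract \<open>Q f\<close>.
  This leaves the values on \<open>J1\<close> alone and, since the norms of the two parts add up,
  cannot increase the norm.\<close>

lemma lift_functional:
  assumes g: "g \<in> dual_space J1 norm"
  shows "lift_functional g \<in> ker_Q" "x \<in> J1 \<Longrightarrow> lift_functional g x = g x"
    "onorm (lift_functional g) \<le> dual_norm J1 norm g"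
proof -
  obtain f where f: "bounded_linear f" "\<And>x. x \<in> J1 \<Longrightarrow> f x = g x" "onorm f \<le> dual_norm J1 norm g"
    using extend_functional[OF subspace_J1 g] by blast
  have "lift_functional g = f - Q f"
    using f(2) Q_annihilates[OF f(1)] minus_Q_in_ker_Q[OF f(1)] by (intro lift_functional_eqI) auto
  moreover have "0 \<le> onorm (Q f)" using Q_bounded_linear[OF f(1)] by (rule onorm_pos_le)
  ultimately show "lift_functional g \<in> ker_Q" "x \<in> J1 \<Longrightarrow> lift_functional g x = g x"
    "onorm (lift_functional g) \<le> dual_norm J1 norm g"
    using f Q_annihilates[OF f(1)] minus_Q_in_ker_Q[OF f(1)] Q_norm[OF f(1)] by auto
qed

lemma lift_functional_restrict: "f \<in> ker_Q \<Longrightarrow> lift_functional (restrict_functional J1 f) = f"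
  by (rule lift_functional_eqI) (auto simp: restrict_functional_def)

lemma lift_functional_linear: "linear_map_on (dual_space J1 norm) ker_Q lift_functional"
  unfolding linear_map_on_def
proof (intro conjI ballI allI)
  show "lift_functional ` dual_space J1 norm \<subseteq> ker_Q" using lift_functional(1) by blast
  show "lift_functional (f + g) = lift_functional f + lift_functional g"
    if "f \<in> dual_space J1 norm" "g \<in> dual_space J1 norm" for f g
    using that lift_functional by (intro lift_functional_eqI subspace_add[OF subspace_ker_Q]) auto
  show "lift_functional (c *\<^sub>R f) = c *\<^sub>R lift_functional f" if "f \<in> dual_space J1 norm" for c f
    using that lift_functional
    by (intro lift_functional_eqI subspace_scale[OF subspace_ker_Q]) (auto simp: scaleR_fun_def)
qed

text \<open>The component in \<open>J\<^sub>1\<^sup>*\<^sup>*\<close> of \<open>x\<close>, regarded as an element of \<open>X\<^sub>1\<^sup>*\<^sup>*\<close>.\<close>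

definition bidual_part :: "'a \<Rightarrow> ('a \<Rightarrow> real) \<Rightarrow> real" where
  "bidual_part x g = (if g \<in> dual_space J1 norm then lift_functional g x else 0)"

lemma normed_space_on_bidual: "normed_space_on (bidual_space J1 norm) (bidual_norm J1 norm)"
  unfolding bidual_space_def bidual_norm_def[abs_def]
  by (intro normed_space_on_dual normed_space_on_norm subspace_J1)

lemma bidual_part:
  shows "bidual_part x \<in> bidual_space J1 norm" "bidual_norm J1 norm (bidual_part x) \<le> norm x"
proof -
  note N = normed_space_on_dual[OF normed_space_on_norm[OF subspace_J1]]
  have sub: "subspace (dual_space J1 norm)" using N by (simp add: normed_space_on_def)
  have le: "\<bar>bidual_part x g\<bar> \<le> norm x * dual_norm J1 norm g" if g: "g \<in> dual_space J1 norm" for g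
  proof -
    have "\<bar>lift_functional g x\<bar> \<le> onorm (lift_functional g) * norm x"
      using onorm[of "lift_functional g" x] lift_functional(1)[OF g] by (simp add: ker_Q_def)
    also have "\<dots> \<le> dual_norm J1 norm g * norm x"
      using lift_functional(3)[OF g] by (intro mult_right_mono) auto
    finally show ?thesis using g by (simp add: bidual_part_def mult.commute)
  qed
  show dual: "bidual_part x \<in> bidual_space J1 norm"
    unfolding bidual_space_def
    by (rule dual_spaceI[where C = "norm x"])
      (use le subspace_add[OF sub] subspace_scale[OF sub] lift_functional_linear in
        \<open>auto simp: bidual_part_def linear_map_on_def scaleR_fun_def\<close>)
  show "bidual_norm J1 norm (bidual_part x) \<le> norm x"
    unfolding bidual_norm_def
    by (rule dual_norm_le[OF N dual[unfolded bidual_space_def] norm_ge_zero le])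
qed

text \<open>If \<open>g\<close> kills \<open>J2\<close>, so does its lift \<open>f\<close>. On
  \<open>X2\<close>, \<open>f\<close> agrees with \<open>Q f\<close>, which is 0 because
  \<open>f\<close> is in \<open>ker_Q\<close>; hence \<open>f\<close> vanishes at
  \<open>x\<close>.\<close>

lemma bidual_part_X2:
  assumes x: "x \<in> X2"
  shows "bidual_part x \<in> biannihilator J1 norm J2"
proof -
  have "bidual_part x g = 0" if "g \<in> annihilator J1 norm J2" for g
  proof -
    have g: "g \<in> dual_space J1 norm" "\<And>y. y \<in> J2 \<Longrightarrow> g y = 0"
      using that by (auto simp: annihilator_def)
    have "lift_functional g y = 0" if "y \<in> J2" for y
      using lift_functional(2)[OF g(1)] g(2) that J2_le_J1 by auto
    then have "Q (lift_functional g) x = lift_functional g x"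
      using Q_restrict[of "lift_functional g" x] lift_functional(1)[OF g(1)] x by (simp add: ker_Q_def)
    then show ?thesis using lift_functional(1)[OF g(1)] g(1) by (simp add: ker_Q_def bidual_part_def)
  qed
  then show ?thesis
    using bidual_part(1)[of x] by (simp add: biannihilator_def annihilator_def[of "dual_space J1 norm"] bidual_space_def)
qed

lemma bidual_part_linear: "bidual_part (x + y) = bidual_part x + bidual_part y"
  "bidual_part (c *\<^sub>R x) = c *\<^sub>R bidual_part x"
  using lift_functional(1)
  by (auto simp: bidual_part_def ker_Q_def fun_eq_iff scaleR_fun_def linear_add linear_scale bounded_linear.linear)

end

subsection \<open>Liftings for Lindenstrauss pairs\<close>

context lifting_problem
begin

text \<open>\<open>L\<close> is controlled on \<open>W\<close> only, so it cannot be the comparison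
  operator on \<open>V\<close>. Its damped component in the bidual of \<open>J1\<close> has norm at
  most 1 on \<open>W\<close> and respects the subspaces; injectivity extends it to \<open>V\<close>
  with both properties intact.\<close>

lemma Lindenstrauss_lift_step:
  fixes L :: "'b \<Rightarrow> 'a"
  assumes Lin: "Lindenstrauss_pair J1 J2"
    and V: "V = span G" "finite G" and W: "W = span H" "finite H" "W \<subseteq> V" and d: "0 < d" and e: "0 < e"
    and L: "linear L" "\<And>z. z \<in> W \<Longrightarrow> L z \<in> T z" "\<And>z. z \<in> W \<Longrightarrow> norm (L z) \<le> (1 + d) * norm z"
      "\<And>z. z \<in> W \<inter> Y2 \<Longrightarrow> L z \<in> X2"
    and Z: "finite Z" "Z \<subseteq> W" "\<And>z. z \<in> Z \<Longrightarrow> d * norm z \<le> \<eta>"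
  obtains L' where "linear L'" "\<And>z. z \<in> V \<Longrightarrow> L' z \<in> T z" "\<And>z. z \<in> V \<Longrightarrow> norm (L' z) \<le> (1 + e) * norm z"
    "\<And>z. z \<in> V \<inter> Y2 \<Longrightarrow> L' z \<in> X2" "\<And>z. z \<in> Z \<Longrightarrow> norm (L' z - L z) \<le> \<eta> + e"
proof -
  note J1_dual = normed_space_on_dual[OF normed_space_on_norm[OF subspace_J1]]
  have V_sub: "subspace V" using V by simp
  define \<theta> where "\<theta> = 1 / (1 + d)"
  have \<theta>: "0 < \<theta>" "\<theta> * (1 + d) = 1" using d by (auto simp: \<theta>_def)
  define t where "t z = \<theta> *\<^sub>R bidual_part (L z)" for z
  have t_scale: "t z = bidual_part (\<theta> *\<^sub>R L z)" for z by (simp add: t_def bidual_part_linear)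
  have t_lin: "linear_map_on W (bidual_space J1 norm) t"
    unfolding linear_map_on_def
  proof (intro conjI ballI allI)
    show "t ` W \<subseteq> bidual_space J1 norm" unfolding t_scale using bidual_part(1) by blast
  qed (simp_all add: t_def linear_add[OF L(1)] linear_scale[OF L(1)] bidual_part_linear scaleR_add_right scaleR_left_commute)
  have t_norm: "bidual_norm J1 norm (t w) \<le> 1 * norm w" if "w \<in> W" for w
  proof -
    have "bidual_norm J1 norm (t w) \<le> \<theta> * norm (L w)"
      unfolding t_scale using bidual_part(2)[of "\<theta> *\<^sub>R L w"] \<theta>(1) by simp
    also have "\<dots> \<le> \<theta> * ((1 + d) * norm w)" using L(3)[OF that] \<theta>(1) by (intro mult_left_mono) auto
    also have "\<dots> = 1 * norm w" using \<theta>(2) by (simp add: mult.assoc[symmetric])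
    finally show ?thesis .
  qed
  have t_Y2: "t ` (W \<inter> Y2) \<subseteq> biannihilator J1 norm J2"
    unfolding t_scale using L(4) by (auto intro!: bidual_part_X2 subspace_scale[OF subspace_X2])
  \<comment> \<open>The bidual is carried by this function type, which has to be infinite to offer
    room for the coordinates of \<open>V\<close>.\<close>
  have "infinite (range (\<lambda>(c :: real) (_ :: 'a \<Rightarrow> real). c))"
    by (simp add: finite_image_iff inj_def fun_eq_iff infinite_UNIV_char_0)
  then have inf: "infinite (UNIV :: (('a \<Rightarrow> real) \<Rightarrow> real) set)"
    using finite_subset[OF subset_UNIV] by blast
  obtain t' where t': "linear_map_on V (bidual_space J1 norm) t'" "t' ` (V \<inter> Y2) \<subseteq> biannihilator J1 norm J2"
    "\<And>w. w \<in> W \<Longrightarrow> t' w = t w" "\<And>z. z \<in> V \<Longrightarrow> bidual_norm J1 norm (t' z) \<le> 1 * 1 * norm z"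
    using injective_pair_extend[where t = t and p = "bidual_norm J1 norm" and k = 1, OF Lin[unfolded Lindenstrauss_pair_def] inf normed_space_on_bidual V W
        subspace_Y2 closed_Y2 t_lin t_Y2 t_norm zero_le_one zero_le_one] by metis
  \<comment> \<open>Restriction to \<open>J1\<close> identifies \<open>ker_Q\<close> with the dual
    of \<open>J1\<close>, which turns an element of the bidual into a function on
    \<open>ker_Q\<close>.\<close>
  define c where "c z f = t' z (restrict_functional J1 f)" for z f
  have t'_bidual: "t' z \<in> dual_space (dual_space J1 norm) (dual_norm J1 norm)" if "z \<in> V" for z
    using linear_map_on_imageI[OF t'(1) that] by (simp add: bidual_space_def)
  have c_norm: "\<bar>c z f\<bar> \<le> norm z * onorm f" if z: "z \<in> V" and f: "f \<in> ker_Q" for z f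
  proof -
    have bl: "bounded_linear f" using f by (simp add: ker_Q_def)
    note r = restrict_in_dual[OF bl]
    have "\<bar>c z f\<bar> \<le> bidual_norm J1 norm (t' z) * dual_norm J1 norm (restrict_functional J1 f)"
      unfolding c_def bidual_norm_def by (rule le_dual_norm[OF J1_dual t'_bidual[OF z] r(1)])
    also have "\<dots> \<le> norm z * onorm f"
      using t'(4)[OF z] r(2) dual_norm_nonneg[OF normed_space_on_norm[OF subspace_J1] r(1)]
      by (intro mult_mono) auto
    finally show ?thesis .
  qed
  have c_W: "c z f = 1 / (1 + d) * f (L z)" if "z \<in> W" "f \<in> ker_Q" for z f
  proof -
    have "bounded_linear f" using that(2) by (simp add: ker_Q_def)
    then show ?thesis
      using restrict_in_dual(1)[of f] lift_functional_restrict[OF that(2)]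
      by (simp add: c_def t'(3)[OF that(1)] t_def scaleR_fun_def bidual_part_def \<theta>_def)
  qed
  obtain U where U: "linear U" "\<And>z. z \<in> V \<Longrightarrow> U z \<in> T z" "\<And>z. z \<in> V \<inter> Y2 \<Longrightarrow> U z \<in> X2"
    "\<And>z. z \<in> V \<inter> cball 0 1 \<Longrightarrow> norm (U z) \<le> 1 + e" "\<And>z. z \<in> Z \<Longrightarrow> norm (U z - L z) \<le> \<eta> + e"
  proof (rule approximate_lift[OF V, of "V \<inter> cball 0 1" "\<lambda>z. z" 1 c Z L "\<lambda>z. z" \<eta> e])
    show "linear (\<lambda>z :: 'b. z)" by (rule linear_ident)
    show "linear_map_on V UNIV (\<lambda>z. c z f)" if "f \<in> ker_Q" for f
      using linear_map_on_add[OF t'(1)] linear_map_on_scale[OF t'(1)]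
      by (auto simp: linear_map_on_def c_def scaleR_fun_def)
    show "linear_map_on ker_Q UNIV (c z)" if z: "z \<in> V" for z
      using linear_map_on_add[OF dual_spaceD(1)[OF t'_bidual[OF z]]]
        linear_map_on_scale[OF dual_spaceD(1)[OF t'_bidual[OF z]]] linear_map_on_imageI[OF restrict_linear]
      by (auto simp: linear_map_on_def[of ker_Q UNIV] c_def linear_map_on_add[OF restrict_linear]
          linear_map_on_scale[OF restrict_linear])
    show "\<bar>c z f\<bar> \<le> 1 * onorm f" if "z \<in> V \<inter> cball 0 1" "f \<in> ker_Q" for z f
    proof -
      have "norm z * onorm f \<le> 1 * onorm f"
        using that by (intro mult_right_mono) (auto simp: ker_Q_def onorm_pos_le)
      with c_norm[of z f] that show ?thesis by simp
    qed
    show "c z f = 0" if z: "z \<in> V \<inter> Y2" and f: "f \<in> ker_Q" "\<And>x. x \<in> X2 \<Longrightarrow> f x = 0" for z f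
    proof -
      have "restrict_functional J1 f \<in> annihilator J1 norm J2"
        using restrict_in_dual(1)[of f] f J2_le_X2 by (auto simp: annihilator_def ker_Q_def restrict_functional_def)
      moreover have "t' z \<in> biannihilator J1 norm J2" using t'(2) z by blast
      ultimately show ?thesis
        by (simp add: biannihilator_def annihilator_def[of "dual_space J1 norm"] c_def)
    qed
    show "norm (z - z) \<le> \<eta>" if "z \<in> Z" for z
    proof -
      have "0 \<le> d * norm z" using d by simp
      then show ?thesis using Z(3)[OF that] by simp
    qed
    show "\<bar>c z f - f (L z)\<bar> \<le> \<eta> * onorm f" if z: "z \<in> Z" and f: "f \<in> ker_Q" for z f
    proof -
      have zW: "z \<in> W" using z Z(2) by blast
      have bl: "bounded_linear f" using f by (simp add: ker_Q_def)
      have "\<bar>f (L z)\<bar> \<le> onorm f * norm (L z)" using onorm[OF bl, of "L z"] by simp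
      also have "\<dots> \<le> onorm f * ((1 + d) * norm z)" using L(3)[OF zW] onorm_pos_le[OF bl] by (rule mult_left_mono)
      finally have "\<bar>1 / (1 + d) * f (L z) - f (L z)\<bar> \<le> d * norm z * onorm f"
        by (rule damping_error[OF zero_le_one d])
      also have "\<dots> \<le> \<eta> * onorm f" using Z(3)[OF z] onorm_pos_le[OF bl] by (rule mult_right_mono)
      finally show ?thesis by (simp add: c_W[OF zW f])
    qed
  qed (use Z(1,2) W(3) L(2) e that in \<open>auto intro: bounded_subset[OF bounded_cball]\<close>)
  show thesis
  proof (rule that[OF U(1,2) _ U(3,5)])
    show "norm (U z) \<le> (1 + e) * norm z" if "z \<in> V" for z
      by (rule linear_norm_le_if_unit_ball[OF U(1) V_sub _ that]) (use U(4) in auto)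
  qed
qed

text \<open>Each stage lifts \<open>T\<close> itself, but only on the span of the first
  \<open>n\<close> vectors; the span is trivial at stage 0, where 0 is a lift. Without finite-rank
  operators on the whole space, it is injectivity that passes from one span to the next.\<close>

lemma lifting_of_Lindenstrauss_pair:
  fixes u :: "nat \<Rightarrow> 'b"
  assumes Lin: "Lindenstrauss_pair J1 J2" and u: "closure (range u) = UNIV" "Y2 \<subseteq> closure (range u \<inter> Y2)"
  shows "\<exists>M. bounded_linear M \<and> M ` Y2 \<subseteq> X2 \<and> (\<forall>y. M y \<in> T y) \<and> onorm M \<le> 1"
proof -
  obtain \<delta> :: "nat \<Rightarrow> real" where \<delta>: "\<And>n. 0 < \<delta> n" "\<And>n. \<delta> n \<le> (1 / 2) ^ n"
    "\<And>n i. i < n \<Longrightarrow> \<delta> n * norm (u i) \<le> (1 / 2) ^ n" "\<delta> \<longlonglongrightarrow> 0"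
    using geometric_weights[of u] by metis
  define E where "E n = span (u ` {..<n})" for n
  have E_mono: "E m \<subseteq> E n" if "m \<le> n" for m n
    unfolding E_def using that by (intro span_mono image_mono) auto
  have u_E: "u i \<in> E n" if "i < n" for i n unfolding E_def using that by (intro span_base) auto
  let ?P = "\<lambda>n L. linear L \<and> (\<forall>z\<in>E n. L z \<in> T z) \<and> (\<forall>z\<in>E n. norm (L z) \<le> (1 + \<delta> n) * norm z) \<and>
    (\<forall>z\<in>E n \<inter> Y2. L z \<in> X2)"
  \<comment> \<open>One summand pays for the damping, the other for the error \<delta>
    \<open>(Suc n)\<close> of the approximate lift.\<close>
  let ?R = "\<lambda>n L L'. \<forall>i<n. norm (L' (u i) - L (u i)) \<le> 2 * (1 / 2) ^ n"
  have "\<exists>L. \<forall>n. ?P n (L n) \<and> ?R n (L n) (L (Suc n))"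
  proof (rule dependent_nat_choice)
    have "?P 0 (\<lambda>_. 0)"
      using subspace_0[OF subspace_J1] subspace_0[OF subspace_X2] T_zero by (auto simp: E_def intro: linear_zero)
    then show "\<exists>L. ?P 0 L" by blast
    fix L n assume L: "?P n L"
    then have Lf: "linear L" "\<And>z. z \<in> E n \<Longrightarrow> L z \<in> T z" "\<And>z. z \<in> E n \<Longrightarrow> norm (L z) \<le> (1 + \<delta> n) * norm z"
      "\<And>z. z \<in> E n \<inter> Y2 \<Longrightarrow> L z \<in> X2" by auto
    have fin: "finite (u ` {..<n})" for n by simp
    have sub: "u ` {..<n} \<subseteq> E n" using u_E by auto
    have weight: "\<delta> n * norm z \<le> (1 / 2) ^ n" if "z \<in> u ` {..<n}" for z using that \<delta>(3) by blast
    obtain L' where L': "linear L'" "\<And>z. z \<in> E (Suc n) \<Longrightarrow> L' z \<in> T z"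
      "\<And>z. z \<in> E (Suc n) \<Longrightarrow> norm (L' z) \<le> (1 + \<delta> (Suc n)) * norm z"
      "\<And>z. z \<in> E (Suc n) \<inter> Y2 \<Longrightarrow> L' z \<in> X2"
      "\<And>z. z \<in> u ` {..<n} \<Longrightarrow> norm (L' z - L z) \<le> (1 / 2) ^ n + \<delta> (Suc n)"
      using Lindenstrauss_lift_step[OF Lin E_def fin E_def fin E_mono[OF le_SucI[OF order_refl]]
          \<delta>(1)[of n] \<delta>(1)[of "Suc n"] Lf fin sub weight] by metis
    have "\<delta> (Suc n) \<le> (1 / 2) ^ n" using \<delta>(2)[of "Suc n"] by (rule order_trans) simp
    then have "norm (L' (u i) - L (u i)) \<le> 2 * (1 / 2) ^ n" if "i < n" for i
      using L'(5)[of "u i"] that by auto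
    then show "\<exists>L'. ?P (Suc n) L' \<and> ?R n L L'" using L' by (intro exI[of _ L']) auto
  qed
  then obtain L where ex: "\<forall>n. ?P n (L n) \<and> ?R n (L n) (L (Suc n))" by (rule exE)
  have L: "?P n (L n)" "?R n (L n) (L (Suc n))" for n
    by (rule conjunct1[OF spec[OF ex]], rule conjunct2[OF spec[OF ex]])
  have ev_E: "\<forall>\<^sub>F n in sequentially. u i \<in> E n" for i
    using u_E by (auto simp: eventually_sequentially intro!: exI[of _ "Suc i"])
  show ?thesis
  proof (rule lifting_limit[of E "range u" L 1 \<delta> "\<lambda>_ d. d"])
    show "subspace (E n)" for n by (simp add: E_def)
    show "incseq E" using E_mono by (auto simp: incseq_def)
    show "range u \<subseteq> (\<Union>n. E n)" using u_E by blast
    show "norm (L n z) \<le> (1 + \<delta> n) * norm z" if "z \<in> E n" for n z using L(1)[of n] that by auto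
    show "linear (L n)" for n using L(1)[of n] by blast
    show "convergent (\<lambda>n. L n d)" if d: "d \<in> range u" for d
    proof -
      obtain i where i: "d = u i" using d by blast
      have "\<forall>\<^sub>F n in sequentially. norm (L (Suc n) d - L n d) \<le> 2 * (1 / 2) ^ n"
        using L(2) i by (auto simp: eventually_sequentially intro!: exI[of _ "Suc i"])
      then show ?thesis by (rule convergent_if_geometric_increments)
    qed
    show "\<forall>\<^sub>F n in sequentially. L n d \<in> T d" if d: "d \<in> range u" for d
    proof -
      obtain i where i: "d = u i" using d by blast
      show ?thesis unfolding i using ev_E[of i] by (rule eventually_mono) (use L(1) in blast)
    qed
    show "\<forall>\<^sub>F n in sequentially. L n d \<in> X2" if d: "d \<in> range u \<inter> Y2" for d
    proof -
      obtain i where i: "d = u i" using d by blast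
      show ?thesis unfolding i using ev_E[of i] by (rule eventually_mono) (use L(1) d i in auto)
    qed
  qed (use u \<delta>(4) in auto)
qed

end

section \<open>Cosets, M-ideal projections and the final assembly\<close>

lemma coset_self: "subspace J \<Longrightarrow> x \<in> coset J x"
  using subspace_0[of J] by (force simp: coset_def)

lemma coset_eqI:
  assumes J: "subspace J" and x: "x \<in> coset J y"
  shows "coset J x = coset J y"
proof -
  obtain j where j: "j \<in> J" "x = y + j" using x by (auto simp: coset_def)
  show ?thesis
  proof (intro equalityI subsetI)
    fix z assume "z \<in> coset J x"
    then obtain i where "i \<in> J" "z = y + (j + i)" using j(2) by (auto simp: coset_def add.assoc)
    then show "z \<in> coset J y" using subspace_add[OF J j(1)] by (auto simp: coset_def)
  next
    fix z assume "z \<in> coset J y"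
    then obtain i where "i \<in> J" "z = x + (i - j)" using j(2) by (auto simp: coset_def)
    then show "z \<in> coset J x" using subspace_diff[OF J _ j(1)] by (auto simp: coset_def)
  qed
qed

lemma coset_norm_less:
  assumes J: "subspace J" and x: "x \<in> A" and A: "A \<in> range (coset J)" and less: "coset_norm A < m"
  shows "\<exists>j\<in>J. norm (x + j) < m"
proof -
  have A_eq: "A = coset J x" using coset_eqI[OF J] A x by blast
  obtain a where "a \<in> A" "norm a < m"
    using cInf_lessD[of "norm ` A" m] less x by (auto simp: coset_norm_def)
  then show ?thesis by (auto simp: A_eq coset_def)
qed

lemma M_ideal_projection_fixes:
  assumes Q: "M_ideal_projection X J Q" and f: "f \<in> annihilator X norm J"
  shows "Q f = f"
proof -
  obtain g where "g \<in> dual_space X norm" "f = Q g"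
    using f Q by (auto simp: M_ideal_projection_def)
  then show ?thesis using Q by (simp add: M_ideal_projection_def L_projection_on_def)
qed

text \<open>The commutation hypothesis covers every pair of associated projections, so any two of
  them may be picked. The projection on the dual of \<open>X2\<close> is eliminated by applying it
  to restrictions of functionals that kill \<open>J2\<close>, all of which it fixes.\<close>

lemma simultaneous_M_ideal_projection:
  fixes X2 J1 J2 :: "'a::banach set"
  assumes M: "simultaneous_M_ideal UNIV X2 J1 J2"
  obtains Q where "simultaneous_L_projection X2 J1 J2 Q"
proof -
  obtain Q1 Q2 where Q1: "M_ideal_projection UNIV J1 Q1" and Q2: "M_ideal_projection X2 J2 Q2"
    using M by (auto simp: simultaneous_M_ideal_def M_ideal_def)
  have spaces: "subspace X2" "closed X2" "subspace J1" "closed J1" "subspace J2" "J2 \<subseteq> J1" "J2 \<subseteq> X2"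
    using M by (auto simp: simultaneous_M_ideal_def closed_pair_def M_ideal_def)
  have lin: "linear_map_on (Collect bounded_linear) (Collect bounded_linear) Q1"
    using Q1 by (simp add: M_ideal_projection_def L_projection_on_def dual_space_UNIV)
  have range: "Q1 ` Collect bounded_linear = annihilator UNIV norm J1"
    using Q1 by (simp add: M_ideal_projection_def dual_space_UNIV)
  have Q1_bl: "bounded_linear (Q1 f)" if "bounded_linear f" for f
    using linear_map_on_imageI[OF lin] that by blast
  have "simultaneous_L_projection X2 J1 J2 Q1"
  proof
    show "Q1 f x = 0" if "bounded_linear f" "x \<in> J1" for f x
    proof -
      have "Q1 f \<in> annihilator UNIV norm J1" using range that(1) by blast
      then show ?thesis using that(2) by (simp add: annihilator_def)
    qed
    show "Q1 f = f" if "bounded_linear f" "\<And>x. x \<in> J1 \<Longrightarrow> f x = 0" for f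
      using that by (intro M_ideal_projection_fixes[OF Q1]) (auto simp: annihilator_def dual_space_UNIV)
    show "onorm f = onorm (Q1 f) + onorm (f - Q1 f)" if f: "bounded_linear f" for f
    proof -
      have "bounded_linear (f - Q1 f)"
        using subspace_diff[OF subspace_bounded_linear, of f "Q1 f"] f Q1_bl[OF f] by simp
      moreover have "dual_norm UNIV norm f = dual_norm UNIV norm (Q1 f) + dual_norm UNIV norm (f - Q1 f)"
        using Q1 f unfolding M_ideal_projection_def L_projection_on_def dual_space_UNIV by blast
      ultimately show ?thesis using f Q1_bl[OF f] by (simp add: dual_norm_UNIV)
    qed
    show "Q1 f x = f x" if f: "bounded_linear f" "\<And>y. y \<in> J2 \<Longrightarrow> f y = 0" and x: "x \<in> X2" for f x
    proof -
      have le: "\<bar>restrict_functional X2 f y\<bar> \<le> onorm f * norm y" if "y \<in> X2" for y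
        using onorm[OF f(1), of y] that by (simp add: restrict_functional_def)
      have "restrict_functional X2 f \<in> dual_space X2 norm"
        by (rule dual_spaceI[where C = "onorm f"])
          (use le subspace_add[OF spaces(1)] subspace_scale[OF spaces(1)] in
            \<open>auto simp: restrict_functional_def linear_add linear_scale bounded_linear.linear[OF f(1)]\<close>)
      then have "restrict_functional X2 f \<in> annihilator X2 norm J2"
        using f(2) by (auto simp: annihilator_def restrict_functional_def)
      then have "Q2 (restrict_functional X2 f) = restrict_functional X2 f"
        by (rule M_ideal_projection_fixes[OF Q2])
      moreover have "restrict_functional X2 (Q1 f) = Q2 (restrict_functional X2 f)"
        using M Q1 Q2 f(1) by (auto simp: simultaneous_M_ideal_def dual_space_UNIV)
      ultimately have "restrict_functional X2 (Q1 f) x = restrict_functional X2 f x" by simp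
      then show ?thesis using x by (simp add: restrict_functional_def)
    qed
  qed (use spaces lin in auto)
  then show thesis by (rule that)
qed

theorem theorem5p4:
  fixes X2 J1 J2 :: "'a::banach set"
    and Y2 :: "'b::banach set"
    and T :: "'b \<Rightarrow> 'a set"
    and lam :: real
  assumes "simultaneous_M_ideal UNIV X2 J1 J2"
    and "closed_pair UNIV Y2"
    and "separable_space (euclidean :: 'b topology)"
    and "bounded_linear_quotient_pair Y2 UNIV X2 J1 T"
    and "op_norm UNIV norm coset_norm T = 1"
  shows "(BAP_pair lam Y2 \<longrightarrow>
           (\<exists>L. bounded_linear L \<and> L ` Y2 \<subseteq> X2 \<and> (\<forall>y. coset J1 (L y) = T y) \<and> onorm L \<le> lam)) \<and>
         (Lindenstrauss_pair J1 J2 \<longrightarrow>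
           (\<exists>L. bounded_linear L \<and> L ` Y2 \<subseteq> X2 \<and> (\<forall>y. coset J1 (L y) = T y) \<and> onorm L \<le> 1))"
proof -
  obtain Q where Q: "simultaneous_L_projection X2 J1 J2 Q"
    using simultaneous_M_ideal_projection[OF assms(1)] .
  then interpret simultaneous_L_projection X2 J1 J2 Q .
  have T_range: "T y \<in> range (coset J1)" and T_X2: "y \<in> Y2 \<Longrightarrow> T y \<in> coset J1 ` X2"
    and T_add: "T (y + z) = coset_add (T y) (T z)" and T_scale: "T (c *\<^sub>R y) = coset_scale J1 c (T y)"
    and T_bdd: "bounded_on UNIV norm coset_norm T" for y z c
    using assms(4) by (auto simp: bounded_linear_quotient_pair_def)
  have T_eq: "T y = coset J1 x" if "x \<in> T y" for x y
    using T_range[of y] coset_eqI[OF subspace_J1] that by blast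
  have T_ball: "coset_norm (T y) \<le> 1" if "norm y \<le> 1" for y
  proof -
    obtain C where C: "\<And>y. coset_norm (T y) \<le> C * norm y" using T_bdd by (auto simp: bounded_on_def)
    \<comment> \<open>The supremum in \<open>op_norm\<close> yields pointwise bounds only after
      boundedness has been established.\<close>
    have "bdd_above ((\<lambda>y. coset_norm (T y)) ` {y \<in> UNIV. norm y \<le> 1})"
    proof (rule bdd_aboveI2)
      fix y :: 'b assume y: "y \<in> {y \<in> UNIV. norm y \<le> 1}"
      have "coset_norm (T y) \<le> C * norm y" by (rule C)
      also have "\<dots> \<le> \<bar>C\<bar> * 1" using y by (intro mult_mono) auto
      finally show "coset_norm (T y) \<le> \<bar>C\<bar> * 1" .
    qed
    then have "coset_norm (T y) \<le> op_norm UNIV norm coset_norm T"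
      unfolding op_norm_def using that by (intro cSUP_upper) auto
    with assms(5) show ?thesis by simp
  qed
  interpret lifting_problem X2 J1 J2 Q Y2 T
  proof
    show "subspace Y2" "closed Y2" using assms(2) by (auto simp: closed_pair_def)
    show "\<exists>x. x \<in> T y" for y using T_range[of y] coset_self[OF subspace_J1] by blast
    show "\<exists>x\<in>X2. x \<in> T y" if "y \<in> Y2" for y using T_X2[OF that] coset_self[OF subspace_J1] by blast
    show add: "x + x' \<in> T (y + y')" if "x \<in> T y" "x' \<in> T y'" for x x' y y'
      using that by (auto simp: T_add coset_add_def)
    show scale: "c *\<^sub>R x \<in> T (c *\<^sub>R y)" if "x \<in> T y" for x y c
      using that subspace_0[OF subspace_J1] by (force simp: T_scale coset_scale_def)
    obtain x where "x \<in> T 0" using T_range[of 0] coset_self[OF subspace_J1] by blast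
    then have "0 \<in> T 0" using scale[of x 0 0] by simp
    then show zero: "T 0 = J1" using T_eq[of 0 0] by (simp add: coset_def)
    show "\<exists>j\<in>J1. norm (x + j) \<le> norm y + e" if x: "x \<in> T y" and e: "0 < e" for x y e
    proof (cases "y = 0")
      case True
      then have "- x \<in> J1" using x zero subspace_neg[OF subspace_J1] by simp
      then show ?thesis using e True by (intro bexI[of _ "- x"]) auto
    next
      case False
      define s where "s = norm y"
      have s: "0 < s" using False by (simp add: s_def)
      \<comment> \<open>The bound on the unit ball is applied to \<open>y\<close> normalised. The
        infimum in \<open>coset_norm\<close> need not be attained, and the margin
        \<open>e / s\<close> becomes \<open>e\<close> after scaling back by
        \<open>s\<close>.\<close>
      have "coset_norm (T (inverse s *\<^sub>R y)) \<le> 1" by (rule T_ball) (use False in \<open>simp add: s_def\<close>)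
      also have "\<dots> < 1 + e / s" using e s by simp
      finally obtain j where j: "j \<in> J1" "norm (inverse s *\<^sub>R x + j) < 1 + e / s"
        using coset_norm_less[OF subspace_J1 scale[OF x] T_range] by blast
      have "norm (x + s *\<^sub>R j) = s * norm (inverse s *\<^sub>R x + j)"
      proof -
        have "x + s *\<^sub>R j = s *\<^sub>R (inverse s *\<^sub>R x + j)" using s by (simp add: scaleR_add_right)
        then show ?thesis using s by simp
      qed
      also have "\<dots> \<le> s * (1 + e / s)" using j(2) s by (intro mult_left_mono) auto
      also have "\<dots> = norm y + e" using s by (simp add: s_def distrib_left)
      finally show ?thesis using subspace_scale[OF subspace_J1 j(1)] by blast
    qed
  qed
  obtain u :: "nat \<Rightarrow> 'b" where u: "closure (range u) = UNIV" "Y2 \<subseteq> closure (range u \<inter> Y2)"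
    using dense_sequence_adapted[OF assms(3)] by metis
  have lift: "\<exists>L. bounded_linear L \<and> L ` Y2 \<subseteq> X2 \<and> (\<forall>y. coset J1 (L y) = T y) \<and> onorm L \<le> m"
    if ex: "\<exists>L. bounded_linear L \<and> L ` Y2 \<subseteq> X2 \<and> (\<forall>y. L y \<in> T y) \<and> onorm L \<le> m" for m
  proof -
    obtain L where L: "bounded_linear L" "L ` Y2 \<subseteq> X2" "\<And>y. L y \<in> T y" "onorm L \<le> m" using ex by blast
    have "coset J1 (L y) = T y" for y using T_eq[OF L(3)] by simp
    with L show ?thesis by (intro exI[of _ L]) simp
  qed
  show ?thesis
    by (intro conjI impI lift lifting_of_BAP[OF _ u] lifting_of_Lindenstrauss_pair[OF _ u])
qed

end
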